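(* Let $(M,\nabla,\langle\cdot,\cdot\rangle)$ be an affine-Riemann manifold such that its canonical Hermitian structure $(TM,J_1,g_1)$ is pluriclosed and its adjoint (dual) Koszul form $\xi$ vanishes. Then the Ricci curvature of $\langle\cdot,\cdot\rangle$ is nonnegative. Moreover, if $M$ is compact and $\nabla$ is (geodesically) complete, then $\gamma=0$, i.e., $\nabla$ is the Levi-Civita connection of $\langle\cdot,\cdot\rangle$.
   Context: An affine-Riemann manifold $(M,\nabla,\langle\cdot,\cdot\rangle)$ is a manifold with a flat torsionless connection $\nabla$ and a Riemannian metric. $D$ is the Levi-Civita connection of the metric; the difference tensor is $\gamma_XY=D_XY-\nabla_XY$. The adjoint (dual) Koszul form is the 1-form $\xi(X)=\langle\mathrm{tr}_{\langle,\rangle}(\gamma),X\rangle$, where $\mathrm{tr}_{\langle,\rangle}(\gamma)=\sum_i\gamma_{E_i}E_i$ for a local orthonormal frame $(E_i)$. Canonical Hermitian structure: $\pi_1:TM\to M$ is the projection; for a vector field $X$ on $M$, $X^h$ is the horizontal lift with respect to $\nabla$ and $X^v$ the vertical lift; $J_1X^h=X^v$, $J_1X^v=-X^h$; $g_1(X^h,Y^h)=g_1(X^v,Y^v)=\langle X,Y\rangle\circ\pi_1$, $g_1(X^h,Y^v)=0$. A Hermitian manifold $(N,J,g)$ with fundamental form $\omega=g(J\cdot,\cdot)$ is pluriclosed if $dd^c\omega=0$, equivalently $d(J\,d\omega)=0$ where $(J\eta)(X_1,\dots,X_p)=(-1)^p\eta(JX_1,\dots,JX_p)$. *)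

theory Defs
  imports "HOL-Analysis.Analysis"
begin

section \<open>Smooth maps\<close>

primrec Ck_on :: "nat \<Rightarrow> ('a::real_normed_vector \<Rightarrow> 'b::real_normed_vector) \<Rightarrow> 'a set \<Rightarrow> bool" where
  "Ck_on 0 f S \<longleftrightarrow> continuous_on S f"
| "Ck_on (Suc k) f S \<longleftrightarrow> (\<forall>x\<in>S. f differentiable at x) \<and>
     (\<forall>v. Ck_on k (\<lambda>x. frechet_derivative f (at x) v) S)"

text \<open>Meant for open sets in finite-dimensional spaces.\<close>

definition smooth_on :: "('a::real_normed_vector \<Rightarrow> 'b::real_normed_vector) \<Rightarrow> 'a set \<Rightarrow> bool" where
  "smooth_on f S \<longleftrightarrow> (\<forall>k. Ck_on k f S)"


section \<open>Smooth manifolds\<close>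

text \<open>A manifold is given by an indexed atlas.  The point set and the topology are those determined
  by the charts; Hausdorffness and second countability are required of that topology.  All chart maps
  are total functions, of which only the restriction to the chart domain matters.\<close>

record ('i, 'm, 'e) manifold =
  charts :: "'i set"
  chart_dom :: "'i \<Rightarrow> 'm set"
  chart_map :: "'i \<Rightarrow> 'm \<Rightarrow> 'e"

definition points :: "('i, 'm, 'e) manifold \<Rightarrow> 'm set" where
  "points M = (\<Union>i\<in>charts M. chart_dom M i)"

definition chart_image :: "('i, 'm, 'e) manifold \<Rightarrow> 'i \<Rightarrow> 'e set" where
  "chart_image M i = chart_map M i ` chart_dom M i"

definition overlap :: "('i, 'm, 'e) manifold \<Rightarrow> 'i \<Rightarrow> 'i \<Rightarrow> 'e set" where
  "overlap M i j = chart_map M i ` (chart_dom M i \<inter> chart_dom M j)"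

definition transition :: "('i, 'm, 'e) manifold \<Rightarrow> 'i \<Rightarrow> 'i \<Rightarrow> 'e \<Rightarrow> 'e" where
  "transition M i j x = chart_map M j (inv_into (chart_dom M i) (chart_map M i) x)"

definition jacobian ::
    "('i, 'm, 'e::euclidean_space) manifold \<Rightarrow> 'i \<Rightarrow> 'i \<Rightarrow> 'e \<Rightarrow> 'e \<Rightarrow> 'e" where
  "jacobian M i j x = frechet_derivative (transition M i j) (at x)"

definition smooth_atlas :: "('i, 'm, 'e::euclidean_space) manifold \<Rightarrow> bool" where
  "smooth_atlas M \<longleftrightarrow>
     (\<forall>i\<in>charts M. inj_on (chart_map M i) (chart_dom M i) \<and> open (chart_image M i)) \<and>
     (\<forall>i\<in>charts M. \<forall>j\<in>charts M.
        open (overlap M i j) \<and> smooth_on (transition M i j) (overlap M i j))"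

definition manifold_topology :: "('i, 'm, 'e::euclidean_space) manifold \<Rightarrow> 'm topology" where
  "manifold_topology M = topology (\<lambda>W. W \<subseteq> points M \<and>
     (\<forall>i\<in>charts M. open (chart_map M i ` (W \<inter> chart_dom M i))))"

definition smooth_manifold :: "('i, 'm, 'e::euclidean_space) manifold \<Rightarrow> bool" where
  "smooth_manifold M \<longleftrightarrow> smooth_atlas M \<and>
     Hausdorff_space (manifold_topology M) \<and> second_countable (manifold_topology M)"

lemma openin_manifold_topology:
  assumes "smooth_atlas M"
  shows "openin (manifold_topology M) W \<longleftrightarrow> W \<subseteq> points M \<and>
     (\<forall>i\<in>charts M. open (chart_map M i ` (W \<inter> chart_dom M i)))"
proof -
  let ?P = "\<lambda>W. W \<subseteq> points M \<and> (\<forall>i\<in>charts M. open (chart_map M i ` (W \<inter> chart_dom M i)))"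
  have inj: "inj_on (chart_map M i) (chart_dom M i)" if "i \<in> charts M" for i
    using assms that by (simp add: smooth_atlas_def)
  have "istopology ?P"
    unfolding istopology_def
  proof (intro conjI allI impI)
    fix S T assume S: "?P S" and T: "?P T"
    have "chart_map M i ` (S \<inter> T \<inter> chart_dom M i) =
        chart_map M i ` (S \<inter> chart_dom M i) \<inter> chart_map M i ` (T \<inter> chart_dom M i)"
      if "i \<in> charts M" for i
      using inj_on_image_Int[OF inj[OF that], of "S \<inter> chart_dom M i" "T \<inter> chart_dom M i"]
      by (simp add: Int_ac)
    with S T show "S \<inter> T \<subseteq> points M"
      and "\<forall>i\<in>charts M. open (chart_map M i ` (S \<inter> T \<inter> chart_dom M i))" by auto
  next
    fix K assume K: "\<forall>S\<in>K. ?P S"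
    have "chart_map M i ` (\<Union>K \<inter> chart_dom M i) = (\<Union>S\<in>K. chart_map M i ` (S \<inter> chart_dom M i))" for i
      by blast
    with K show "\<Union>K \<subseteq> points M" and "\<forall>i\<in>charts M. open (chart_map M i ` (\<Union>K \<inter> chart_dom M i))"
      by auto
  qed
  then show ?thesis by (simp add: manifold_topology_def topology_inverse')
qed


section \<open>Tangent bundle\<close>

text \<open>A tangent vector at \<open>p\<close> is the family of its coordinate vectors in the charts around \<open>p\<close>
  (set to 0 for all other indices), related by the Jacobians of the transition maps.\<close>

definition tangent_space ::
    "('i, 'm, 'e::euclidean_space) manifold \<Rightarrow> 'm \<Rightarrow> ('i \<Rightarrow> 'e) set" where
  "tangent_space M p = {v.
     (\<forall>i\<in>charts M. \<forall>j\<in>charts M. p \<in> chart_dom M i \<longrightarrow> p \<in> chart_dom M j \<longrightarrow>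
        v j = jacobian M i j (chart_map M i p) (v i)) \<and>
     (\<forall>i. \<not> (i \<in> charts M \<and> p \<in> chart_dom M i) \<longrightarrow> v i = 0)}"

definition tangent_bundle ::
    "('i, 'm, 'e::euclidean_space) manifold \<Rightarrow> ('i, 'm \<times> ('i \<Rightarrow> 'e), 'e \<times> 'e) manifold" where
  "tangent_bundle M = \<lparr>
     charts = charts M,
     chart_dom = (\<lambda>i. {(p, v). p \<in> chart_dom M i \<and> v \<in> tangent_space M p}),
     chart_map = (\<lambda>i (p, v). (chart_map M i p, v i)) \<rparr>"


section \<open>Metrics and connections\<close>

text \<open>Tensor fields are families, over the charts, of component functions on the chart image that
  transform tensorially; \<open>g i x\<close> is the metric at the point with coordinates \<open>x\<close> in chart \<open>i\<close>.\<close>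

type_synonym ('i, 'e) metric_field = "'i \<Rightarrow> 'e \<Rightarrow> 'e \<Rightarrow> 'e \<Rightarrow> real"

definition riemannian_metric ::
    "('i, 'm, 'e::euclidean_space) manifold \<Rightarrow> ('i, 'e) metric_field \<Rightarrow> bool" where
  "riemannian_metric M g \<longleftrightarrow>
     (\<forall>i\<in>charts M.
        (\<forall>x\<in>chart_image M i. bilinear (g i x) \<and> (\<forall>u v. g i x u v = g i x v u) \<and>
           (\<forall>u. u \<noteq> 0 \<longrightarrow> g i x u u > 0)) \<and>
        (\<forall>u v. smooth_on (\<lambda>x. g i x u v) (chart_image M i))) \<and>
     (\<forall>i\<in>charts M. \<forall>j\<in>charts M. \<forall>x\<in>overlap M i j. \<forall>u v.
        g j (transition M i j x) (jacobian M i j x u) (jacobian M i j x v) = g i x u v)"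

text \<open>A connection is given by its Christoffel symbols \<open>G i x u v\<close>, the coordinate expression of
  the covariant derivative in direction \<open>u\<close> of the coordinate field that is constantly \<open>v\<close>.
  The transformation law says that the covariant derivative of a vector field is a vector field.\<close>

type_synonym ('i, 'e) connection = "'i \<Rightarrow> 'e \<Rightarrow> 'e \<Rightarrow> 'e \<Rightarrow> 'e"

definition is_connection ::
    "('i, 'm, 'e::euclidean_space) manifold \<Rightarrow> ('i, 'e) connection \<Rightarrow> bool" where
  "is_connection M G \<longleftrightarrow>
     (\<forall>i\<in>charts M.
        (\<forall>x\<in>chart_image M i. bilinear (G i x)) \<and>
        (\<forall>u v. smooth_on (\<lambda>x. G i x u v) (chart_image M i))) \<and>
     (\<forall>i\<in>charts M. \<forall>j\<in>charts M. \<forall>x\<in>overlap M i j. \<forall>u v.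
        jacobian M i j x (G i x u v) =
          frechet_derivative (\<lambda>y. jacobian M i j y v) (at x) u
          + G j (transition M i j x) (jacobian M i j x u) (jacobian M i j x v))"

text \<open>The following operators act on local vector fields in a fixed chart.\<close>

definition cov_deriv ::
    "('e \<Rightarrow> 'e \<Rightarrow> 'e \<Rightarrow> 'e) \<Rightarrow> ('e \<Rightarrow> 'e) \<Rightarrow> ('e \<Rightarrow> 'e) \<Rightarrow> 'e \<Rightarrow> 'e::euclidean_space" where
  "cov_deriv G X Y x = frechet_derivative Y (at x) (X x) + G x (X x) (Y x)"

definition lie_bracket :: "('e \<Rightarrow> 'e) \<Rightarrow> ('e \<Rightarrow> 'e) \<Rightarrow> 'e \<Rightarrow> 'e::euclidean_space" where
  "lie_bracket X Y x = frechet_derivative Y (at x) (X x) - frechet_derivative X (at x) (Y x)"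

text \<open>Torsion, curvature and the difference of two connections are tensorial, so their values on
  vectors at \<open>x\<close> may be computed by extending the vectors to constant coordinate fields.\<close>

definition torsion :: "('e \<Rightarrow> 'e \<Rightarrow> 'e \<Rightarrow> 'e) \<Rightarrow> 'e \<Rightarrow> 'e \<Rightarrow> 'e \<Rightarrow> 'e::euclidean_space" where
  "torsion G x u v = (let X = (\<lambda>_. u); Y = (\<lambda>_. v) in
     cov_deriv G X Y x - cov_deriv G Y X x - lie_bracket X Y x)"

definition curvature ::
    "('e \<Rightarrow> 'e \<Rightarrow> 'e \<Rightarrow> 'e) \<Rightarrow> 'e \<Rightarrow> 'e \<Rightarrow> 'e \<Rightarrow> 'e \<Rightarrow> 'e::euclidean_space" where
  "curvature G x u v w = (let X = (\<lambda>_. u); Y = (\<lambda>_. v); Z = (\<lambda>_. w) in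
     cov_deriv G X (cov_deriv G Y Z) x - cov_deriv G Y (cov_deriv G X Z) x
     - cov_deriv G (lie_bracket X Y) Z x)"

definition ricci :: "('e \<Rightarrow> 'e \<Rightarrow> 'e \<Rightarrow> 'e) \<Rightarrow> 'e \<Rightarrow> 'e \<Rightarrow> 'e::euclidean_space \<Rightarrow> real" where
  "ricci G x v w = (\<Sum>b\<in>Basis. curvature G x b v w \<bullet> b)"

definition difference_tensor ::
    "('e \<Rightarrow> 'e \<Rightarrow> 'e \<Rightarrow> 'e) \<Rightarrow> ('e \<Rightarrow> 'e \<Rightarrow> 'e \<Rightarrow> 'e) \<Rightarrow> 'e \<Rightarrow> 'e \<Rightarrow> 'e \<Rightarrow> 'e::euclidean_space" where
  "difference_tensor D G x u v = (let X = (\<lambda>_. u); Y = (\<lambda>_. v) in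
     cov_deriv D X Y x - cov_deriv G X Y x)"

definition torsion_free ::
    "('i, 'm, 'e::euclidean_space) manifold \<Rightarrow> ('i, 'e) connection \<Rightarrow> bool" where
  "torsion_free M G \<longleftrightarrow>
     (\<forall>i\<in>charts M. \<forall>x\<in>chart_image M i. \<forall>u v. torsion (G i) x u v = 0)"

definition flat ::
    "('i, 'm, 'e::euclidean_space) manifold \<Rightarrow> ('i, 'e) connection \<Rightarrow> bool" where
  "flat M G \<longleftrightarrow>
     (\<forall>i\<in>charts M. \<forall>x\<in>chart_image M i. \<forall>u v w. curvature (G i) x u v w = 0)"

definition metric_connection ::
    "('i, 'm, 'e::euclidean_space) manifold \<Rightarrow> ('i, 'e) metric_field \<Rightarrow> ('i, 'e) connection \<Rightarrow> bool" where
  "metric_connection M g G \<longleftrightarrow>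
     (\<forall>i\<in>charts M. \<forall>x\<in>chart_image M i. \<forall>u v w.
        (let X = (\<lambda>_. u); Y = (\<lambda>_. v); Z = (\<lambda>_. w) in
          frechet_derivative (\<lambda>y. g i y (Y y) (Z y)) (at x) (X x) =
          g i x (cov_deriv (G i) X Y x) (Z x) + g i x (Y x) (cov_deriv (G i) X Z x)))"

definition levi_civita_connection ::
    "('i, 'm, 'e::euclidean_space) manifold \<Rightarrow> ('i, 'e) metric_field \<Rightarrow> ('i, 'e) connection \<Rightarrow> bool" where
  "levi_civita_connection M g D \<longleftrightarrow>
     is_connection M D \<and> torsion_free M D \<and> metric_connection M g D"

definition affine_riemann ::
    "('i, 'm, 'e::euclidean_space) manifold \<Rightarrow> ('i, 'e) connection \<Rightarrow> ('i, 'e) metric_field \<Rightarrow> bool" where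
  "affine_riemann M G g \<longleftrightarrow> smooth_manifold M \<and>
     is_connection M G \<and> flat M G \<and> torsion_free M G \<and> riemannian_metric M g"


section \<open>Geodesic completeness\<close>

definition geodesic ::
    "('i, 'm, 'e::euclidean_space) manifold \<Rightarrow> ('i, 'e) connection \<Rightarrow> (real \<Rightarrow> 'm) \<Rightarrow> bool" where
  "geodesic M G c \<longleftrightarrow> continuous_map euclideanreal (manifold_topology M) c \<and>
     (\<forall>i\<in>charts M. \<forall>t. c t \<in> chart_dom M i \<longrightarrow>
        (\<exists>c'. (\<forall>\<^sub>F s in nhds t. ((\<lambda>r. chart_map M i (c r)) has_vector_derivative c' s) (at s)) \<and>
              (c' has_vector_derivative - G i (chart_map M i (c t)) (c' t) (c' t)) (at t)))"

definition geodesically_complete ::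
    "('i, 'm, 'e::euclidean_space) manifold \<Rightarrow> ('i, 'e) connection \<Rightarrow> bool" where
  "geodesically_complete M G \<longleftrightarrow>
     (\<forall>i\<in>charts M. \<forall>p\<in>chart_dom M i. \<forall>v. \<exists>c. geodesic M G c \<and> c 0 = p \<and>
        ((\<lambda>r. chart_map M i (c r)) has_vector_derivative v) (at 0))"


section \<open>Dual Koszul form\<close>

definition orthonormal_frame :: "('e \<Rightarrow> 'e \<Rightarrow> real) \<Rightarrow> ('e \<Rightarrow> 'e::euclidean_space) \<Rightarrow> bool" where
  "orthonormal_frame g E \<longleftrightarrow> (\<forall>a\<in>Basis. \<forall>b\<in>Basis. g (E a) (E b) = (if a = b then 1 else 0))"

text \<open>For an inner product \<open>g\<close> and a bilinear \<open>B\<close> the choice of the frame is immaterial.\<close>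

definition metric_trace :: "('e \<Rightarrow> 'e \<Rightarrow> real) \<Rightarrow> ('e \<Rightarrow> 'e \<Rightarrow> 'e) \<Rightarrow> 'e::euclidean_space" where
  "metric_trace g B = (let E = (SOME E. orthonormal_frame g E) in \<Sum>b\<in>Basis. B (E b) (E b))"

definition dual_koszul_form ::
    "('e \<Rightarrow> 'e \<Rightarrow> 'e \<Rightarrow> real) \<Rightarrow> ('e \<Rightarrow> 'e \<Rightarrow> 'e \<Rightarrow> 'e) \<Rightarrow> 'e \<Rightarrow> 'e::euclidean_space \<Rightarrow> real" where
  "dual_koszul_form g \<gamma> x u = g x (metric_trace (g x) (\<gamma> x)) u"


section \<open>Differential forms and pluriclosed metrics\<close>

text \<open>A \<open>p\<close>-form in a chart is evaluated on lists of \<open>p\<close> vectors.  The exterior derivative is the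
  invariant formula for constant coordinate fields, whose Lie brackets vanish.\<close>

definition ext_deriv ::
    "('v::euclidean_space \<Rightarrow> 'v list \<Rightarrow> real) \<Rightarrow> 'v \<Rightarrow> 'v list \<Rightarrow> real" where
  "ext_deriv \<eta> x vs = (\<Sum>k<length vs.
     (- 1) ^ k * frechet_derivative (\<lambda>y. \<eta> y (take k vs @ drop (Suc k) vs)) (at x) (vs ! k))"

definition J_form ::
    "('v \<Rightarrow> 'v \<Rightarrow> 'v) \<Rightarrow> ('v \<Rightarrow> 'v list \<Rightarrow> real) \<Rightarrow> 'v \<Rightarrow> 'v list \<Rightarrow> real" where
  "J_form J \<eta> x vs = (- 1) ^ length vs * \<eta> x (map (J x) vs)"

definition fundamental_form ::
    "('v \<Rightarrow> 'v \<Rightarrow> 'v) \<Rightarrow> ('v \<Rightarrow> 'v \<Rightarrow> 'v \<Rightarrow> real) \<Rightarrow> 'v \<Rightarrow> 'v list \<Rightarrow> real" where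
  "fundamental_form J g x vs = g x (J x (vs ! 0)) (vs ! 1)"

definition pluriclosed ::
    "('i, 'm, 'v::euclidean_space) manifold \<Rightarrow> ('i \<Rightarrow> 'v \<Rightarrow> 'v \<Rightarrow> 'v) \<Rightarrow> ('i, 'v) metric_field \<Rightarrow> bool" where
  "pluriclosed N J g \<longleftrightarrow>
     (\<forall>i\<in>charts N. \<forall>z\<in>chart_image N i. \<forall>vs. length vs = 4 \<longrightarrow>
        ext_deriv (J_form (J i) (ext_deriv (fundamental_form (J i) (g i)))) z vs = 0)"


section \<open>Canonical Hermitian structure on the tangent bundle\<close>

definition horizontal_lift ::
    "('i, 'e::euclidean_space) connection \<Rightarrow> 'i \<Rightarrow> 'e \<times> 'e \<Rightarrow> 'e \<Rightarrow> 'e \<times> 'e" where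
  "horizontal_lift G i z u = (u, - G i (fst z) u (snd z))"

definition vertical_lift :: "'e::euclidean_space \<Rightarrow> 'e \<times> 'e" where
  "vertical_lift u = (0, u)"

text \<open>Every \<open>w\<close> tangent to the tangent bundle at \<open>z\<close> is the sum of the horizontal lift of its
  projection \<open>fst w\<close> and the vertical lift of \<open>vertical_part G i z w\<close>; the structures \<open>J1\<close> and \<open>g1\<close>
  are written in terms of this decomposition, and the lemmas below give their values on lifts.\<close>

definition vertical_part ::
    "('i, 'e::euclidean_space) connection \<Rightarrow> 'i \<Rightarrow> 'e \<times> 'e \<Rightarrow> 'e \<times> 'e \<Rightarrow> 'e" where
  "vertical_part G i z w = snd w + G i (fst z) (fst w) (snd z)"

definition J1 ::
    "('i, 'e::euclidean_space) connection \<Rightarrow> 'i \<Rightarrow> 'e \<times> 'e \<Rightarrow> 'e \<times> 'e \<Rightarrow> 'e \<times> 'e" where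
  "J1 G i z w = vertical_lift (fst w) - horizontal_lift G i z (vertical_part G i z w)"

definition g1 ::
    "('i, 'e::euclidean_space) connection \<Rightarrow> ('i, 'e) metric_field \<Rightarrow> ('i, 'e \<times> 'e) metric_field" where
  "g1 G g i z w w' = g i (fst z) (fst w) (fst w')
     + g i (fst z) (vertical_part G i z w) (vertical_part G i z w')"

lemma lift_decomposition:
  "w = horizontal_lift G i z (fst w) + vertical_lift (vertical_part G i z w)"
  by (simp add: horizontal_lift_def vertical_lift_def vertical_part_def prod_eq_iff)

lemma vertical_part_lifts:
  assumes "bilinear (G i (fst z))"
  shows "vertical_part G i z (horizontal_lift G i z u) = 0"
    and "vertical_part G i z (vertical_lift u) = u"
  using bilinear_lzero[OF assms]
  by (simp_all add: vertical_part_def horizontal_lift_def vertical_lift_def)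

lemma J1_lifts:
  assumes "bilinear (G i (fst z))"
  shows "J1 G i z (horizontal_lift G i z u) = vertical_lift u"
    and "J1 G i z (vertical_lift u) = - horizontal_lift G i z u"
  using bilinear_lzero[OF assms]
  by (simp_all add: J1_def vertical_part_lifts[of G i z, OF assms])
    (simp_all add: horizontal_lift_def vertical_lift_def zero_prod_def)

lemma g1_lifts:
  assumes "bilinear (G i (fst z))" "bilinear (g i (fst z))"
  shows "g1 G g i z (horizontal_lift G i z u) (horizontal_lift G i z v) = g i (fst z) u v"
    and "g1 G g i z (vertical_lift u) (vertical_lift v) = g i (fst z) u v"
    and "g1 G g i z (horizontal_lift G i z u) (vertical_lift v) = 0"
  using bilinear_lzero[OF assms(2)] bilinear_rzero[OF assms(2)]
  by (simp_all add: g1_def vertical_part_lifts[of G i z, OF assms(1)])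
    (simp_all add: horizontal_lift_def vertical_lift_def)

end

theory Submission
  imports Defs
begin

text \<open>Write \<open>\<gamma> = D - \<nabla>\<close>.  Flatness of \<open>\<nabla>\<close>, skew symmetry of the curvature \<open>R\<close> of \<open>D\<close> and the
  pluriclosed condition combine to a Gauss equation
  \<open>\<langle>R(u,v)w, z\<rangle> = \<langle>\<gamma>\<^sub>u w, \<gamma>\<^sub>v z\<rangle> - \<langle>\<gamma>\<^sub>v w, \<gamma>\<^sub>u z\<rangle>\<close>.  As the trace of \<open>\<gamma>\<close> vanishes, tracing it gives
  \<open>Ric(v,v) = \<Sum> |\<gamma>(e\<^sub>i, v)|\<^sup>2\<close>, and the 1-form \<open>\<kappa>(u) = tr \<gamma>\<^sub>u\<close> satisfies
  \<open>div \<kappa> = - 1/2 \<Sum> (\<gamma>\<^sub>i\<^sub>j\<^sub>k - \<gamma>\<^sub>i\<^sub>k\<^sub>j)\<^sup>2\<close>.  On a compact manifold the divergence theorem therefore makes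
  \<open>\<gamma>\<close> totally symmetric, and then also \<open>D\<gamma>\<close>.  In that case Calabi's computation gives
  \<open>1/2 \<Delta>|\<gamma>|\<^sup>2 = |D\<gamma>|\<^sup>2 + |Ric|\<^sup>2 + \<Sum> |[\<gamma>\<^sub>i, \<gamma>\<^sub>j]|\<^sup>2\<close>, and a second use of the divergence theorem
  forces \<open>Ric = 0\<close>, hence \<open>\<gamma> = 0\<close>.\<close>

section \<open>Differentiation of multilinear fields\<close>

text \<open>The Gauss equation comes from reading the pluriclosed condition only at the zero
  section, on two horizontal and two vertical vectors. There it controls the skew part of
  \<open>D tor\<close> in the horizontal arguments. By flatness the skew part of
  \<open>D gamma\<close> is the curvature plus a commutator; \<open>tor\<close> pairs it with the
  vertical arguments in both orders with opposite signs, so the skew symmetry of the curvature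
  doubles it, and it can be solved for. Orthonormal frames are chosen pointwise and never
  differentiated: a trace that has to be differentiated is contracted with the inverse metric, and
  the frame returns once all derivatives are taken. No integral over the manifold is defined. Each
  chart is integrated against one weight of a partition of unity; the terms with derivatives of
  weights are split by the weights once more and regrouped chart by chart, where those derivatives
  add up to zero. Only first derivatives of weights occur, so class C^1 suffices, and the density
  transforms by the absolute value of the Jacobian, so no orientation enters.\<close>

abbreviation pd :: "('a::real_normed_vector \<Rightarrow> 'b::real_normed_vector) \<Rightarrow> 'a \<Rightarrow> 'a \<Rightarrow> 'b" where
  "pd f x \<equiv> frechet_derivative f (at x)"

lemma pd_eqI: "(f has_derivative f') (at x) \<Longrightarrow> pd f x = f'"
  using frechet_derivative_at by metis

text \<open>The derivative is selected by the predicate \<open>has_derivative\<close> at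
  \<open>x\<close>, which sees only the germ of the function, so the equality holds even where
  neither side is differentiable. Identities on an open set are differentiated through this
  lemma.\<close>

lemma pd_cong_open:
  assumes "open S" "x \<in> S" "\<And>y. y \<in> S \<Longrightarrow> f y = h y"
  shows "pd f x = pd h x"
proof -
  have "(f has_derivative f') (at x) = (h has_derivative f') (at x)" for f'
    using assms has_derivative_transform_within_open[of f f' x UNIV S h]
      has_derivative_transform_within_open[of h f' x UNIV S f] by auto
  then show ?thesis by (simp add: frechet_derivative_def)
qed

lemma differentiable_cong_open:
  assumes "open S" "x \<in> S" "\<And>y. y \<in> S \<Longrightarrow> f y = h y" "f differentiable at x"
  shows "h differentiable at x"
  using assms has_derivative_transform_within_open[of f _ x UNIV S h]
  unfolding differentiable_def by blast

lemma Ck_on_cong: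
  assumes "open S" "\<And>y. y \<in> S \<Longrightarrow> f y = h y" "Ck_on k f S"
  shows "Ck_on k h S"
  using assms(2,3)
proof (induction k arbitrary: f h)
  case 0
  then show ?case using continuous_on_cong[OF refl, of S f h] by simp
next
  case (Suc k)
  have "Ck_on k (\<lambda>x. pd h x v) S" for v
    by (rule Suc.IH[of "\<lambda>x. pd f x v"])
      (use Suc.prems pd_cong_open[OF assms(1), of _ f h] in auto)
  then show ?case using Suc.prems differentiable_cong_open[OF assms(1), of _ f h] by auto
qed

lemma Ck_on_SucD: "Ck_on (Suc k) f S \<Longrightarrow> Ck_on k f S"
proof (induction k arbitrary: f)
  case 0
  then show ?case
    by (auto intro!: continuous_at_imp_continuous_on differentiable_imp_continuous_within)
next
  case (Suc k)
  then show ?case unfolding Ck_on.simps(2)[of "Suc k"] Ck_on.simps(2)[of k f] by blast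
qed

lemma Ck_on_const [simp]: "Ck_on k (\<lambda>x. c) S"
  by (induction k arbitrary: c) auto

lemma Ck_on_continuous: "Ck_on k f S \<Longrightarrow> continuous_on S f"
proof (induction k)
  case (Suc k)
  then show ?case using Ck_on_SucD by blast
qed simp

lemma Ck_on_Un:
  assumes "open S" "open T" "Ck_on k f S" "Ck_on k f T"
  shows "Ck_on k f (S \<union> T)"
  using assms(3,4) by (induction k arbitrary: f) (auto intro: continuous_on_open_Un assms(1,2))

lemma Ck_on_subset: "Ck_on k f S \<Longrightarrow> T \<subseteq> S \<Longrightarrow> Ck_on k f T"
  by (induction k arbitrary: f) (auto intro: continuous_on_subset)

lemma Ck_on_add:
  assumes "open S" "Ck_on k f S" "Ck_on k h S"
  shows "Ck_on k (\<lambda>x. f x + h x) S"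
  using assms(2,3)
proof (induction k arbitrary: f h)
  case (Suc k)
  have eq: "pd (\<lambda>x. f x + h x) x = (\<lambda>v. pd f x v + pd h x v)" if "x \<in> S" for x
    using Suc.prems that
    by (intro pd_eqI has_derivative_add) (auto simp: frechet_derivative_works[symmetric])
  have "Ck_on k (\<lambda>x. pd f x v + pd h x v) S" for v
    using Suc by auto
  then have "Ck_on k (\<lambda>x. pd (\<lambda>x. f x + h x) x v) S" for v
    by (rule Ck_on_cong[OF assms(1), rotated]) (simp only: eq)
  then show ?case using Suc.prems by auto
qed (auto intro: continuous_on_add)

lemma Ck_on_bilinear:
  assumes "open S" "bounded_bilinear b" "Ck_on k f S" "Ck_on k h S"
  shows "Ck_on k (\<lambda>x. b (f x) (h x)) S"
  using assms(3,4)
proof (induction k arbitrary: f h)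
  case 0
  then show ?case using bounded_bilinear.continuous_on[OF assms(2)] by auto
next
  case (Suc k)
  have der: "((\<lambda>x. b (f x) (h x)) has_derivative (\<lambda>v. b (f x) (pd h x v) + b (pd f x v) (h x))) (at x)"
    if "x \<in> S" for x
    using Suc.prems that
    by (intro bounded_bilinear.FDERIV[OF assms(2)]) (auto simp: frechet_derivative_works[symmetric])
  have "Ck_on k (\<lambda>x. b (f x) (pd h x v) + b (pd f x v) (h x)) S" for v
    by (intro Ck_on_add[OF assms(1)] Suc.IH) (use Suc.prems Ck_on_SucD in auto)
  then have "Ck_on k (\<lambda>x. pd (\<lambda>x. b (f x) (h x)) x v) S" for v
    by (rule Ck_on_cong[OF assms(1), rotated]) (simp only: pd_eqI[OF der])
  then show ?case using der differentiableI[OF der] by simp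
qed

lemmas Ck_on_mult = Ck_on_bilinear[OF _ bounded_bilinear_mult]
lemmas Ck_on_scaleR = Ck_on_bilinear[OF _ bounded_bilinear_scaleR]
lemmas Ck_on_inner = Ck_on_bilinear[OF _ bounded_bilinear_inner]

lemma Ck_on_minus: "open S \<Longrightarrow> Ck_on k f S \<Longrightarrow> Ck_on k (\<lambda>x. - f x) S"
  using Ck_on_scaleR[of S k "\<lambda>x. -1" f] by simp

lemma Ck_on_diff: "open S \<Longrightarrow> Ck_on k f S \<Longrightarrow> Ck_on k h S \<Longrightarrow> Ck_on k (\<lambda>x. f x - h x) S"
  using Ck_on_add[of S k f "\<lambda>x. - h x"] Ck_on_minus[of S k h] by simp

lemma Ck_on_sum:
  "open S \<Longrightarrow> (\<And>i. i \<in> I \<Longrightarrow> Ck_on k (f i) S) \<Longrightarrow> Ck_on k (\<lambda>x. \<Sum>i\<in>I. f i x) S"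
  by (induction I rule: infinite_finite_induct) (auto intro: Ck_on_add)

lemma linear_Basis_expand:
  fixes L :: "'a::euclidean_space \<Rightarrow> 'b::real_vector"
  assumes "linear L" shows "L v = (\<Sum>b\<in>Basis. (v \<bullet> b) *\<^sub>R L b)"
  by (subst euclidean_representation[of v, symmetric])
    (simp only: linear_sum[OF assms] linear_cmul[OF assms])

text \<open>Regularity of a field of linear maps is known only on constant vectors. Expanding the
  argument in the standard basis reduces a variable argument to finitely many products.\<close>

lemma Ck_on_field:
  fixes L :: "'a::real_normed_vector \<Rightarrow> 'c::euclidean_space \<Rightarrow> 'b::real_normed_vector"
  assumes "open S" "\<And>x. x \<in> S \<Longrightarrow> linear (L x)" "\<And>v. Ck_on k (\<lambda>x. L x v) S" "Ck_on k Y S"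
  shows "Ck_on k (\<lambda>x. L x (Y x)) S"
proof (rule Ck_on_cong[OF assms(1)])
  show "Ck_on k (\<lambda>x. \<Sum>b\<in>Basis. (Y x \<bullet> b) *\<^sub>R L x b) S"
    by (intro Ck_on_sum Ck_on_scaleR Ck_on_inner assms Ck_on_const)
qed (rule linear_Basis_expand[OF assms(2), symmetric])

lemma smooth_on_cong:
  "open S \<Longrightarrow> (\<And>y. y \<in> S \<Longrightarrow> f y = h y) \<Longrightarrow> smooth_on f S \<Longrightarrow> smooth_on h S"
  unfolding smooth_on_def using Ck_on_cong[of S f h] by simp

lemma smooth_on_const [simp]: "smooth_on (\<lambda>x. c) S"
  and smooth_on_add: "open S \<Longrightarrow> smooth_on f S \<Longrightarrow> smooth_on h S \<Longrightarrow> smooth_on (\<lambda>x. f x + h x) S"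
  and smooth_on_diff: "open S \<Longrightarrow> smooth_on f S \<Longrightarrow> smooth_on h S \<Longrightarrow> smooth_on (\<lambda>x. f x - h x) S"
  and smooth_on_sum: "open S \<Longrightarrow> (\<And>i. i \<in> I \<Longrightarrow> smooth_on (F i) S) \<Longrightarrow> smooth_on (\<lambda>x. \<Sum>i\<in>I. F i x) S"
  by (auto simp: smooth_on_def intro: Ck_on_add Ck_on_diff Ck_on_sum)

lemma smooth_on_scaleR: "open S \<Longrightarrow> smooth_on f S \<Longrightarrow> smooth_on h S \<Longrightarrow> smooth_on (\<lambda>x. f x *\<^sub>R h x) S"
  by (simp add: smooth_on_def Ck_on_scaleR)

lemma smooth_on_mult:
  fixes f h :: "_ \<Rightarrow> 'b::real_normed_algebra"
  shows "open S \<Longrightarrow> smooth_on f S \<Longrightarrow> smooth_on h S \<Longrightarrow> smooth_on (\<lambda>x. f x * h x) S"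
  by (simp add: smooth_on_def Ck_on_mult)

lemma smooth_on_inner: "open S \<Longrightarrow> smooth_on f S \<Longrightarrow> smooth_on h S \<Longrightarrow> smooth_on (\<lambda>x. f x \<bullet> h x) S"
  by (simp add: smooth_on_def Ck_on_inner)

lemma smooth_on_field:
  fixes L :: "'a::real_normed_vector \<Rightarrow> 'c::euclidean_space \<Rightarrow> 'b::real_normed_vector"
  assumes "open S" "\<And>x. x \<in> S \<Longrightarrow> linear (L x)" "\<And>v. smooth_on (\<lambda>x. L x v) S" "smooth_on Y S"
  shows "smooth_on (\<lambda>x. L x (Y x)) S"
  using Ck_on_field[OF assms(1,2)] assms(3,4) unfolding smooth_on_def by simp

lemma smooth_on_pd: "smooth_on f S \<Longrightarrow> smooth_on (\<lambda>x. pd f x v) S"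
  unfolding smooth_on_def by (metis Ck_on.simps(2))

lemma smooth_on_differentiable: "smooth_on f S \<Longrightarrow> x \<in> S \<Longrightarrow> f differentiable at x"
  unfolding smooth_on_def by (metis Ck_on.simps(2))

lemma smooth_on_has_derivative: "smooth_on f S \<Longrightarrow> x \<in> S \<Longrightarrow> (f has_derivative pd f x) (at x)"
  using smooth_on_differentiable frechet_derivative_works by blast

lemma smooth_on_linear_pd: "smooth_on f S \<Longrightarrow> x \<in> S \<Longrightarrow> linear (pd f x)"
  using smooth_on_differentiable linear_frechet_derivative by blast

lemma pd_add: "f differentiable at x \<Longrightarrow> h differentiable at x \<Longrightarrow> pd (\<lambda>y. f y + h y) x u = pd f x u + pd h x u"
  by (rule fun_cong[OF pd_eqI, of _ "\<lambda>u. pd f x u + pd h x u"])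
    (auto intro!: derivative_eq_intros simp: frechet_derivative_works[symmetric])

lemma pd_diff: "f differentiable at x \<Longrightarrow> h differentiable at x \<Longrightarrow> pd (\<lambda>y. f y - h y) x u = pd f x u - pd h x u"
  by (rule fun_cong[OF pd_eqI, of _ "\<lambda>u. pd f x u - pd h x u"])
    (auto intro!: derivative_eq_intros simp: frechet_derivative_works[symmetric])

lemma pd_scaleR: "f differentiable at x \<Longrightarrow> pd (\<lambda>y. c *\<^sub>R f y) x u = c *\<^sub>R pd f x u"
  by (rule fun_cong[OF pd_eqI, of _ "\<lambda>u. c *\<^sub>R pd f x u"])
    (auto intro!: derivative_eq_intros simp: frechet_derivative_works[symmetric])

lemma pd_sum:
  "(\<And>i. i \<in> I \<Longrightarrow> f i differentiable at x) \<Longrightarrow> pd (\<lambda>y. \<Sum>i\<in>I. f i y) x u = (\<Sum>i\<in>I. pd (f i) x u)"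
  by (rule fun_cong[OF pd_eqI, of _ "\<lambda>u. \<Sum>i\<in>I. pd (f i) x u"])
    (auto intro!: has_derivative_sum simp: frechet_derivative_works[symmetric])

lemma pd_inner_right: "f differentiable at x \<Longrightarrow> pd (\<lambda>y. f y \<bullet> b) x u = pd f x u \<bullet> b"
  by (rule fun_cong[OF pd_eqI, of _ "\<lambda>u. pd f x u \<bullet> b"])
    (auto intro!: derivative_eq_intros simp: frechet_derivative_works[symmetric])

text \<open>Multilinear fields are differentiated by applying this product rule one argument at a time.\<close>

lemma field_has_derivative:
  fixes L :: "'a::real_normed_vector \<Rightarrow> 'c::euclidean_space \<Rightarrow> 'b::real_normed_vector"
  assumes "open S" "x \<in> S" "\<And>x. x \<in> S \<Longrightarrow> linear (L x)"
    and "\<And>v. (\<lambda>x. L x v) differentiable at x" "Y differentiable at x"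
  shows "((\<lambda>y. L y (Y y)) has_derivative (\<lambda>u. pd (\<lambda>y. L y (Y x)) x u + L x (pd Y x u))) (at x)"
proof -
  note w = frechet_derivative_works[THEN iffD1]
  have "((\<lambda>y. \<Sum>b\<in>Basis. (Y y \<bullet> b) *\<^sub>R L y b) has_derivative
      (\<lambda>u. \<Sum>b\<in>Basis. (Y x \<bullet> b) *\<^sub>R pd (\<lambda>y. L y b) x u + (pd Y x u \<bullet> b) *\<^sub>R L x b)) (at x)"
    by (intro has_derivative_sum has_derivative_scaleR has_derivative_inner_left w assms)
  moreover have "pd (\<lambda>y. L y (Y x)) x u = (\<Sum>b\<in>Basis. (Y x \<bullet> b) *\<^sub>R pd (\<lambda>y. L y b) x u)" for u
  proof -
    have "pd (\<lambda>y. L y (Y x)) x u = pd (\<lambda>y. \<Sum>b\<in>Basis. (Y x \<bullet> b) *\<^sub>R L y b) x u"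
      by (rule fun_cong[OF pd_cong_open[OF assms(1,2)]]) (rule linear_Basis_expand[OF assms(3)])
    also have "\<dots> = (\<Sum>b\<in>Basis. (Y x \<bullet> b) *\<^sub>R pd (\<lambda>y. L y b) x u)"
      using assms(4) by (subst pd_sum) (auto simp: pd_scaleR)
    finally show ?thesis .
  qed
  ultimately have "((\<lambda>y. \<Sum>b\<in>Basis. (Y y \<bullet> b) *\<^sub>R L y b) has_derivative
     (\<lambda>u. pd (\<lambda>y. L y (Y x)) x u + L x (pd Y x u))) (at x)"
    by (simp add: sum.distrib linear_Basis_expand[OF assms(3)[OF assms(2)], of "pd Y x _"])
  then show ?thesis
    by (rule has_derivative_transform_within_open[OF _ assms(1,2)])
      (rule linear_Basis_expand[OF assms(3), symmetric])
qed

lemma pd_field: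
  fixes L :: "'a::real_normed_vector \<Rightarrow> 'c::euclidean_space \<Rightarrow> 'b::real_normed_vector"
  assumes "open S" "x \<in> S" "\<And>x. x \<in> S \<Longrightarrow> linear (L x)"
    and "\<And>v. (\<lambda>x. L x v) differentiable at x" "Y differentiable at x"
  shows "pd (\<lambda>y. L y (Y y)) x u = pd (\<lambda>y. L y (Y x)) x u + L x (pd Y x u)"
  using pd_eqI[OF field_has_derivative[OF assms]] by simp

lemma linear_pd_field:
  fixes L :: "'a::real_normed_vector \<Rightarrow> 'c::real_normed_vector \<Rightarrow> 'b::real_normed_vector"
  assumes "open S" "x \<in> S" "\<And>x. x \<in> S \<Longrightarrow> linear (L x)" "\<And>v. (\<lambda>x. L x v) differentiable at x"
  shows "linear (\<lambda>v. pd (\<lambda>y. L y v) x u)"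
proof (rule linearI)
  fix v w :: 'c and c :: real
  have "pd (\<lambda>y. L y (v + w)) x u = pd (\<lambda>y. L y v + L y w) x u"
    by (rule fun_cong[OF pd_cong_open[OF assms(1,2)]]) (rule linear_add[OF assms(3)])
  then show "pd (\<lambda>y. L y (v + w)) x u = pd (\<lambda>y. L y v) x u + pd (\<lambda>y. L y w) x u"
    by (simp add: pd_add assms(4))
  have "pd (\<lambda>y. L y (c *\<^sub>R v)) x u = pd (\<lambda>y. c *\<^sub>R L y v) x u"
    by (rule fun_cong[OF pd_cong_open[OF assms(1,2)]]) (rule linear_cmul[OF assms(3)])
  then show "pd (\<lambda>y. L y (c *\<^sub>R v)) x u = c *\<^sub>R pd (\<lambda>y. L y v) x u"
    by (simp add: pd_scaleR assms(4))
qed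


section \<open>Symmetry of second derivatives\<close>

lemma second_difference_mean_value:
  fixes f :: "'a::real_normed_vector \<Rightarrow> real"
  assumes C2: "Ck_on 2 f S" and h: "0 < h"
    and S: "\<And>s t. 0 \<le> s \<Longrightarrow> s \<le> h \<Longrightarrow> 0 \<le> t \<Longrightarrow> t \<le> h \<Longrightarrow> x + s *\<^sub>R u + t *\<^sub>R v \<in> S"
  shows "\<exists>s t. 0 < s \<and> s < h \<and> 0 < t \<and> t < h \<and>
    f (x + h *\<^sub>R u + h *\<^sub>R v) - f (x + h *\<^sub>R u) - f (x + h *\<^sub>R v) + f x
      = h * (h * pd (\<lambda>y. pd f y u) (x + s *\<^sub>R u + t *\<^sub>R v) v)"
proof -
  have C: "f differentiable at y" "(\<lambda>y. pd f y u) differentiable at y" if "y \<in> S" for y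
    using C2 that by (auto simp: numeral_2_eq_2)
  note lin = linear_cmul[OF linear_frechet_derivative]
  have der: "DERIV (\<lambda>s. k (a + s *\<^sub>R w)) s :> pd k (a + s *\<^sub>R w) w"
    if "k differentiable at (a + s *\<^sub>R w)" for k :: "'a \<Rightarrow> real" and a s w
  proof -
    have "((\<lambda>s. k (a + s *\<^sub>R w)) has_derivative (\<lambda>t. pd k (a + s *\<^sub>R w) (t *\<^sub>R w))) (at s)"
      by (rule has_derivative_compose[where g = k and f = "\<lambda>s. a + s *\<^sub>R w"])
        (use that in \<open>auto intro!: derivative_eq_intros simp: frechet_derivative_works[symmetric]\<close>)
    then show ?thesis using lin[OF that] by (simp add: has_field_derivative_def mult_commute_abs)
  qed
  \<comment> \<open>The mean value theorem is used twice: first for the increment along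
    \<open>h v\<close> as a function of the step along \<open>u\<close>, then for
    \<open>pd f _ u\<close> along \<open>v\<close>.\<close>
  have "\<exists>s>0. s < h \<and> (f (x + h *\<^sub>R v + h *\<^sub>R u) - f (x + h *\<^sub>R u)) - (f (x + h *\<^sub>R v + 0 *\<^sub>R u) - f (x + 0 *\<^sub>R u))
      = (h - 0) * (pd f (x + h *\<^sub>R v + s *\<^sub>R u) u - pd f (x + s *\<^sub>R u) u)"
  proof (rule MVT2[OF h, where f = "\<lambda>s. f (x + h *\<^sub>R v + s *\<^sub>R u) - f (x + s *\<^sub>R u)"])
    fix s assume "0 \<le> s" "s \<le> h"
    then have "x + h *\<^sub>R v + s *\<^sub>R u \<in> S" "x + s *\<^sub>R u \<in> S"
      using S[of s h] S[of s 0] h by (simp_all add: add_ac)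
    then show "DERIV (\<lambda>s. f (x + h *\<^sub>R v + s *\<^sub>R u) - f (x + s *\<^sub>R u)) s :>
        pd f (x + h *\<^sub>R v + s *\<^sub>R u) u - pd f (x + s *\<^sub>R u) u"
      by (intro DERIV_diff der C)
  qed
  then obtain s where s: "0 < s" "s < h"
    "(f (x + h *\<^sub>R v + h *\<^sub>R u) - f (x + h *\<^sub>R u)) - (f (x + h *\<^sub>R v) - f x)
      = h * (pd f (x + h *\<^sub>R v + s *\<^sub>R u) u - pd f (x + s *\<^sub>R u) u)" by auto
  have "\<exists>t>0. t < h \<and> pd f (x + s *\<^sub>R u + h *\<^sub>R v) u - pd f (x + s *\<^sub>R u + 0 *\<^sub>R v) u
      = (h - 0) * pd (\<lambda>y. pd f y u) (x + s *\<^sub>R u + t *\<^sub>R v) v"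
    by (rule MVT2[OF h, where f = "\<lambda>t. pd f (x + s *\<^sub>R u + t *\<^sub>R v) u"])
      (use S[of s] s h C(2) in \<open>auto intro!: der\<close>)
  then obtain t where "0 < t" "t < h" "pd f (x + s *\<^sub>R u + h *\<^sub>R v) u - pd f (x + s *\<^sub>R u) u
      = h * pd (\<lambda>y. pd f y u) (x + s *\<^sub>R u + t *\<^sub>R v) v" by auto
  with s show ?thesis
    by (intro exI[of _ s] exI[of _ t]) (simp add: algebra_simps)
qed

text \<open>Both orders of differentiation arise from one second difference of \<open>f\<close>, so
  the two mixed derivatives agree at two points near \<open>x\<close>; their continuity moves both
  points to \<open>x\<close>.\<close>

lemma pd_pd_commute_real:
  fixes f :: "'a::real_normed_vector \<Rightarrow> real"
  assumes "open S" "x \<in> S" and C2: "Ck_on 2 f S"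
  shows "pd (\<lambda>y. pd f y u) x v = pd (\<lambda>y. pd f y v) x u"
proof -
  define A where "A u v y = pd (\<lambda>y. pd f y u) y v" for u v y
  have "isCont (A u v) x" for u v
    using C2 assms(1,2) by (auto simp: numeral_2_eq_2 A_def[abs_def] continuous_on_eq_continuous_at)
  then have cont: "\<exists>d>0. \<forall>y. dist y x < d \<longrightarrow> \<bar>A u v y - A u v x\<bar> < e" if "e > 0" for u v e
    using that by (simp add: continuous_at_eps_delta dist_real_def)
  obtain r where r: "0 < r" "ball x r \<subseteq> S" using assms by (meson open_contains_ball)
  have "\<bar>A u v x - A v u x\<bar> \<le> 0 + e" if "e > 0" for e
  proof -
    obtain d1 where d1: "d1 > 0" "\<And>y. dist y x < d1 \<Longrightarrow> \<bar>A u v y - A u v x\<bar> < e / 2"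
      using cont[of "e / 2"] \<open>e > 0\<close> by (meson half_gt_zero)
    obtain d2 where d2: "d2 > 0" "\<And>y. dist y x < d2 \<Longrightarrow> \<bar>A v u y - A v u x\<bar> < e / 2"
      using cont[of "e / 2"] \<open>e > 0\<close> by (meson half_gt_zero)
    define m where "m = min r (min d1 d2)"
    have m: "m > 0" using r d1 d2 by (simp add: m_def)
    \<comment> \<open>The summand 1 keeps the divisor positive and makes
      \<open>h * (norm u + norm v)\<close> strictly smaller than \<open>m\<close>.\<close>
    define h where "h = m / (norm u + norm v + 1)"
    have np: "norm u + norm v + 1 > 0" by (simp add: add_nonneg_pos)
    then have h: "h > 0" using m by (simp add: h_def)
    have hh: "h * (norm u + norm v) < m"
    proof -
      have "h * (norm u + norm v + 1) = m" using np by (simp add: h_def)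
      then show ?thesis using h by (simp add: distrib_left)
    qed
    \<comment> \<open>Here \<open>u'\<close> and \<open>v'\<close> stand for \<open>u\<close> and
      \<open>v\<close> in either order, as the second difference is expanded in both.\<close>
    have near: "dist (x + s *\<^sub>R u' + t *\<^sub>R v') x < m"
      if "0 \<le> s" "s \<le> h" "0 \<le> t" "t \<le> h" "norm u' + norm v' = norm u + norm v" for s t u' v'
    proof -
      have "dist (x + s *\<^sub>R u' + t *\<^sub>R v') x \<le> s * norm u' + t * norm v'"
        using norm_triangle_ineq[of "s *\<^sub>R u'" "t *\<^sub>R v'"] that by (simp add: dist_norm)
      also have "\<dots> \<le> h * norm u' + h * norm v'"
        using that by (intro add_mono mult_right_mono) auto
      also have "\<dots> = h * (norm u + norm v)" unfolding that(5)[symmetric] by (simp add: algebra_simps)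
      finally show ?thesis using hh by simp
    qed
    then have inS: "x + s *\<^sub>R u' + t *\<^sub>R v' \<in> S"
      if "0 \<le> s" "s \<le> h" "0 \<le> t" "t \<le> h" "norm u' + norm v' = norm u + norm v" for s t u' v'
      using near[OF that] r(2) by (auto simp: m_def dist_commute subset_iff)
    obtain s t where st: "0 < s" "s < h" "0 < t" "t < h"
      "f (x + h *\<^sub>R u + h *\<^sub>R v) - f (x + h *\<^sub>R u) - f (x + h *\<^sub>R v) + f x = h * (h * A u v (x + s *\<^sub>R u + t *\<^sub>R v))"
      using second_difference_mean_value[OF C2 h, of x u v] inS[of _ _ u v] unfolding A_def by auto
    obtain s' t' where st': "0 < s'" "s' < h" "0 < t'" "t' < h"
      "f (x + h *\<^sub>R v + h *\<^sub>R u) - f (x + h *\<^sub>R v) - f (x + h *\<^sub>R u) + f x = h * (h * A v u (x + s' *\<^sub>R v + t' *\<^sub>R u))"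
      using second_difference_mean_value[OF C2 h, of x v u] inS[of _ _ v u] unfolding A_def by (auto simp: add.commute)
    have "h * (h * A u v (x + s *\<^sub>R u + t *\<^sub>R v)) = h * (h * A v u (x + s' *\<^sub>R v + t' *\<^sub>R u))"
      unfolding st(5)[symmetric] st'(5)[symmetric] by (simp add: algebra_simps)
    then have "A u v (x + s *\<^sub>R u + t *\<^sub>R v) = A v u (x + s' *\<^sub>R v + t' *\<^sub>R u)" using h by simp
    moreover have "\<bar>A u v (x + s *\<^sub>R u + t *\<^sub>R v) - A u v x\<bar> < e / 2"
      using near[of s t u v] st by (intro d1) (auto simp: m_def)
    moreover have "\<bar>A v u (x + s' *\<^sub>R v + t' *\<^sub>R u) - A v u x\<bar> < e / 2"
      using near[of s' t' v u] st' by (intro d2) (auto simp: m_def)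
    ultimately show ?thesis by linarith
  qed
  then have "A u v x = A v u x" using field_le_epsilon[of "\<bar>A u v x - A v u x\<bar>" 0] by simp
  then show ?thesis by (simp add: A_def)
qed

lemma pd_pd_commute:
  fixes f :: "'a::real_normed_vector \<Rightarrow> 'b::euclidean_space"
  assumes "open S" "x \<in> S" and sm: "smooth_on f S"
  shows "pd (\<lambda>y. pd f y u) x v = pd (\<lambda>y. pd f y v) x u"
proof (rule euclidean_eqI)
  fix b :: 'b
  have d: "f differentiable at y" "(\<lambda>y. pd f y w) differentiable at y" if "y \<in> S" for y w
    using sm smooth_on_pd smooth_on_differentiable that by blast+
  have "pd (\<lambda>y. pd (\<lambda>y. f y \<bullet> b) y w) x z = pd (\<lambda>y. pd f y w) x z \<bullet> b" for w z
  proof -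
    have "pd (\<lambda>y. pd (\<lambda>y. f y \<bullet> b) y w) x z = pd (\<lambda>y. pd f y w \<bullet> b) x z"
      by (rule fun_cong[OF pd_cong_open[OF assms(1,2)]]) (simp add: pd_inner_right d)
    then show ?thesis using d assms(2) by (simp add: pd_inner_right)
  qed
  moreover have "Ck_on 2 (\<lambda>y. f y \<bullet> b) S"
    using smooth_on_inner[OF assms(1) sm smooth_on_const] unfolding smooth_on_def by blast
  ultimately show "pd (\<lambda>y. pd f y u) x v \<bullet> b = pd (\<lambda>y. pd f y v) x u \<bullet> b"
    using pd_pd_commute_real[OF assms(1,2)] by metis
qed

section \<open>Charts and the pluriclosed condition\<close>

lemma bilinear_imp_linear: 
  assumes "bilinear B" shows "linear (B u)" "linear (\<lambda>u. B u v)"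
  using assms by (auto simp: bilinear_def)

lemma smooth_on_bilinear_field:
  fixes B :: "'a::real_normed_vector \<Rightarrow> 'c::euclidean_space \<Rightarrow> 'd::euclidean_space \<Rightarrow> 'b::real_normed_vector"
  assumes "open S" "\<And>x. x \<in> S \<Longrightarrow> bilinear (B x)" "\<And>u v. smooth_on (\<lambda>x. B x u v) S"
    and "smooth_on X S" "smooth_on Y S"
  shows "smooth_on (\<lambda>x. B x (X x) (Y x)) S"
proof (rule smooth_on_field[OF assms(1) _ _ assms(5), of "\<lambda>x. B x (X x)"])
  show "smooth_on (\<lambda>x. B x (X x) v) S" for v
    by (rule smooth_on_field[OF assms(1) _ _ assms(4), of "\<lambda>x u. B x u v"])
      (use assms in \<open>auto intro: bilinear_imp_linear\<close>)
qed (use assms in \<open>auto intro: bilinear_imp_linear\<close>)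

lemma pd_bilinear_field:
  fixes B :: "'a::real_normed_vector \<Rightarrow> 'c::euclidean_space \<Rightarrow> 'd::euclidean_space \<Rightarrow> 'b::real_normed_vector"
  assumes "open S" "x \<in> S" "\<And>x. x \<in> S \<Longrightarrow> bilinear (B x)" "\<And>u v. smooth_on (\<lambda>x. B x u v) S"
    and "smooth_on X S" "smooth_on Y S"
  shows "pd (\<lambda>y. B y (X y) (Y y)) x u =
    pd (\<lambda>y. B y (X x) (Y x)) x u + B x (pd X x u) (Y x) + B x (X x) (pd Y x u)"
proof -
  have sm: "smooth_on (\<lambda>y. B y (X y) v) S" for v
    by (rule smooth_on_bilinear_field[OF assms(1,3,4,5) smooth_on_const])
  have "pd (\<lambda>y. B y (X y) (Y y)) x u = pd (\<lambda>y. B y (X y) (Y x)) x u + B x (X x) (pd Y x u)"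
    by (rule pd_field[OF assms(1,2), of "\<lambda>y. B y (X y)"])
      (use assms in \<open>auto intro: bilinear_imp_linear smooth_on_differentiable[OF sm] smooth_on_differentiable\<close>)
  also have "pd (\<lambda>y. B y (X y) (Y x)) x u = pd (\<lambda>y. B y (X x) (Y x)) x u + B x (pd X x u) (Y x)"
    by (rule pd_field[OF assms(1,2), of "\<lambda>y u. B y u (Y x)"])
      (use assms in \<open>auto intro: bilinear_imp_linear smooth_on_differentiable\<close>)
  finally show ?thesis by simp
qed

lemma pd_fst:
  assumes "f differentiable at (fst z)"
  shows "pd (\<lambda>z. f (fst z)) z h = pd f (fst z) (fst h)" "(\<lambda>z. f (fst z)) differentiable at z"
proof -
  have "((\<lambda>z. f (fst z)) has_derivative (\<lambda>h. pd f (fst z) (fst h))) (at z)"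
    by (rule has_derivative_compose[where g = f and f = fst])
      (use assms in \<open>auto intro!: derivative_eq_intros simp: frechet_derivative_works[symmetric]\<close>)
  then show "pd (\<lambda>z. f (fst z)) z h = pd f (fst z) (fst h)" "(\<lambda>z. f (fst z)) differentiable at z"
    using pd_eqI differentiableI by (fastforce, blast)
qed

lemma ext_deriv_3:
  "ext_deriv \<eta> z [w1, w2, w3] = pd (\<lambda>y. \<eta> y [w2, w3]) z w1 - pd (\<lambda>y. \<eta> y [w1, w3]) z w2
     + pd (\<lambda>y. \<eta> y [w1, w2]) z w3"
  by (simp add: ext_deriv_def numeral_3_eq_3 lessThan_Suc)

lemma ext_deriv_4:
  "ext_deriv \<eta> z [w1, w2, w3, w4] = pd (\<lambda>y. \<eta> y [w2, w3, w4]) z w1 - pd (\<lambda>y. \<eta> y [w1, w3, w4]) z w2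
     + pd (\<lambda>y. \<eta> y [w1, w2, w4]) z w3 - pd (\<lambda>y. \<eta> y [w1, w2, w3]) z w4"
  by (simp add: ext_deriv_def lessThan_Suc eval_nat_numeral)

text \<open>The data of a single chart, with absence of torsion, metricity of \<open>D\<close> and
  flatness of \<open>G\<close> already evaluated on constant coordinate fields.\<close>

locale affine_riemann_chart =
  fixes U :: "'e::euclidean_space set"
    and g :: "'e \<Rightarrow> 'e \<Rightarrow> 'e \<Rightarrow> real"
    and D G :: "'e \<Rightarrow> 'e \<Rightarrow> 'e \<Rightarrow> 'e"
  assumes open_U: "open U"
    and g_bil: "x \<in> U \<Longrightarrow> bilinear (g x)"
    and g_sym: "x \<in> U \<Longrightarrow> g x u v = g x v u"
    and g_pos: "x \<in> U \<Longrightarrow> u \<noteq> 0 \<Longrightarrow> g x u u > 0"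
    and g_smooth: "smooth_on (\<lambda>x. g x u v) U"
    and D_bil: "x \<in> U \<Longrightarrow> bilinear (D x)"
    and D_smooth: "smooth_on (\<lambda>x. D x u v) U"
    and D_sym: "x \<in> U \<Longrightarrow> D x u v = D x v u"
    and G_bil: "x \<in> U \<Longrightarrow> bilinear (G x)"
    and G_smooth: "smooth_on (\<lambda>x. G x u v) U"
    and G_sym: "x \<in> U \<Longrightarrow> G x u v = G x v u"
    and D_metric: "x \<in> U \<Longrightarrow> pd (\<lambda>y. g y v w) x u = g x (D x u v) w + g x v (D x u w)"
    and G_flat: "x \<in> U \<Longrightarrow>
      pd (\<lambda>y. G y v w) x u - pd (\<lambda>y. G y u w) x v + G x u (G x v w) - G x v (G x u w) = 0"
begin

definition gam :: "'e \<Rightarrow> 'e \<Rightarrow> 'e \<Rightarrow> 'e" where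
  "gam x u v = D x u v - G x u v"

lemmas g_simps = bilinear_ladd[OF g_bil] bilinear_radd[OF g_bil] bilinear_lsub[OF g_bil]
  bilinear_rsub[OF g_bil] bilinear_lneg[OF g_bil] bilinear_rneg[OF g_bil] bilinear_lzero[OF g_bil]
  bilinear_rzero[OF g_bil] bilinear_lmul[OF g_bil] bilinear_rmul[OF g_bil]
lemmas D_simps = bilinear_ladd[OF D_bil] bilinear_radd[OF D_bil] bilinear_lsub[OF D_bil]
  bilinear_rsub[OF D_bil] bilinear_lneg[OF D_bil] bilinear_rneg[OF D_bil] bilinear_lzero[OF D_bil]
  bilinear_rzero[OF D_bil] bilinear_lmul[OF D_bil] bilinear_rmul[OF D_bil]
lemmas G_simps = bilinear_ladd[OF G_bil] bilinear_radd[OF G_bil] bilinear_lsub[OF G_bil]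
  bilinear_rsub[OF G_bil] bilinear_lneg[OF G_bil] bilinear_rneg[OF G_bil] bilinear_lzero[OF G_bil]
  bilinear_rzero[OF G_bil] bilinear_lmul[OF G_bil] bilinear_rmul[OF G_bil]

lemma gam_bil: assumes "x \<in> U" shows "bilinear (gam x)"
  unfolding bilinear_def gam_def
  by (intro conjI allI linearI)
    (simp_all add: D_simps[OF assms] G_simps[OF assms] scaleR_diff_right algebra_simps)

lemmas gam_simps = bilinear_ladd[OF gam_bil] bilinear_radd[OF gam_bil] bilinear_lsub[OF gam_bil]
  bilinear_rsub[OF gam_bil] bilinear_lneg[OF gam_bil] bilinear_rneg[OF gam_bil]
  bilinear_lzero[OF gam_bil] bilinear_rzero[OF gam_bil] bilinear_lmul[OF gam_bil]
  bilinear_rmul[OF gam_bil]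

lemma gam_smooth: "smooth_on (\<lambda>x. gam x u v) U"
  unfolding gam_def by (intro smooth_on_diff open_U D_smooth G_smooth)

lemma gam_sym: "x \<in> U \<Longrightarrow> gam x u v = gam x v u"
  by (simp add: gam_def D_sym G_sym)

lemmas g_diff = smooth_on_differentiable[OF g_smooth]
lemmas D_diff = smooth_on_differentiable[OF D_smooth]
lemmas G_diff = smooth_on_differentiable[OF G_smooth]
lemmas gam_diff = smooth_on_differentiable[OF gam_smooth]

context
  fixes X Y :: "'e \<Rightarrow> 'e"
  assumes XY: "smooth_on X U" "smooth_on Y U"
begin

lemma g_smooth_field: "smooth_on (\<lambda>x. g x (X x) (Y x)) U"
  by (rule smooth_on_bilinear_field[OF open_U g_bil g_smooth XY])

lemma D_smooth_field: "smooth_on (\<lambda>x. D x (X x) (Y x)) U"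
  by (rule smooth_on_bilinear_field[OF open_U D_bil D_smooth XY])

lemma gam_smooth_field: "smooth_on (\<lambda>x. gam x (X x) (Y x)) U"
  by (rule smooth_on_bilinear_field[OF open_U gam_bil gam_smooth XY])

lemma pd_g_field: "x \<in> U \<Longrightarrow> pd (\<lambda>y. g y (X y) (Y y)) x u =
    pd (\<lambda>y. g y (X x) (Y x)) x u + g x (pd X x u) (Y x) + g x (X x) (pd Y x u)"
  by (rule pd_bilinear_field[OF open_U _ g_bil g_smooth XY])

lemma pd_D_field: "x \<in> U \<Longrightarrow> pd (\<lambda>y. D y (X y) (Y y)) x u =
    pd (\<lambda>y. D y (X x) (Y x)) x u + D x (pd X x u) (Y x) + D x (X x) (pd Y x u)"
  by (rule pd_bilinear_field[OF open_U _ D_bil D_smooth XY])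

lemma pd_gam_field: "x \<in> U \<Longrightarrow> pd (\<lambda>y. gam y (X y) (Y y)) x u =
    pd (\<lambda>y. gam y (X x) (Y x)) x u + gam x (pd X x u) (Y x) + gam x (X x) (pd Y x u)"
  by (rule pd_bilinear_field[OF open_U _ gam_bil gam_smooth XY])

end

text \<open>\<open>tor x p q v\<close> equals \<open>(\<nabla>\<^sub>p g)(q, v) - (\<nabla>\<^sub>q g)(p, v)\<close>, because \<open>D\<close> is metric.\<close>

definition tor :: "'e \<Rightarrow> 'e \<Rightarrow> 'e \<Rightarrow> 'e \<Rightarrow> real" where
  "tor x p q v = g x q (gam x p v) - g x p (gam x q v)"

lemma tor_smooth: "smooth_on (\<lambda>x. tor x p q v) U"
  unfolding tor_def
  by (intro smooth_on_diff open_U g_smooth_field gam_smooth smooth_on_const)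

lemma tor_linear: 
  assumes "x \<in> U" shows "linear (\<lambda>p. tor x p q v)"
  by (intro linearI) (simp_all add: tor_def g_simps[OF assms] gam_simps[OF assms] algebra_simps)

lemma tor_skew: "tor x p q v = - tor x q p v"
  by (simp add: tor_def)

section \<open>The Hermitian structure of the tangent bundle over a chart\<close>

abbreviation TU :: "('e \<times> 'e) set" where "TU \<equiv> U \<times> UNIV"

lemma open_TU: "open TU" by (simp add: open_Times open_U)

abbreviation vp :: "'e \<times> 'e \<Rightarrow> 'e \<times> 'e \<Rightarrow> 'e" where
  "vp z w \<equiv> snd w + G (fst z) (fst w) (snd z)"

lemma vp_has_derivative:
  assumes "z \<in> TU"
  shows "((\<lambda>z. vp z w) has_derivative
    (\<lambda>h. pd (\<lambda>y. G y (fst w) (snd z)) (fst z) (fst h) + G (fst z) (fst w) (snd h))) (at z)"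
proof -
  have z: "fst z \<in> U" using assms by (cases z) auto
  have "((\<lambda>z. G (fst z) (fst w) (snd z)) has_derivative
    (\<lambda>h. pd (\<lambda>y. G (fst y) (fst w) (snd z)) z h + G (fst z) (fst w) (pd snd z h))) (at z)"
    by (rule field_has_derivative[OF open_TU assms])
      (auto intro!: bilinear_imp_linear(1) G_bil pd_fst(2) G_diff z
        differentiableI[OF has_derivative_snd[OF has_derivative_ident]])
  moreover have "pd snd z = snd" by (rule pd_eqI[OF has_derivative_snd[OF has_derivative_ident]])
  moreover have "pd (\<lambda>y. G (fst y) (fst w) (snd z)) z h = pd (\<lambda>y. G y (fst w) (snd z)) (fst z) (fst h)" for h
    by (rule pd_fst(1)[OF G_diff[OF z]])
  ultimately have "((\<lambda>z. G (fst z) (fst w) (snd z)) has_derivative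
    (\<lambda>h. pd (\<lambda>y. G y (fst w) (snd z)) (fst z) (fst h) + G (fst z) (fst w) (snd h))) (at z)"
    by simp
  from has_derivative_add[OF has_derivative_const this, of "snd w"] show ?thesis by simp
qed

lemma g_vp_has_derivative:
  assumes "z \<in> TU"
  shows "((\<lambda>z. g (fst z) a (vp z w)) has_derivative
    (\<lambda>h. g (fst z) (D (fst z) (fst h) a) (vp z w) + g (fst z) a (D (fst z) (fst h) (vp z w)) +
      g (fst z) a (pd (\<lambda>y. G y (fst w) (snd z)) (fst z) (fst h) + G (fst z) (fst w) (snd h)))) (at z)"
proof -
  have z: "fst z \<in> U" using assms by (cases z) auto
  have "((\<lambda>z. g (fst z) a (vp z w)) has_derivative
    (\<lambda>h. pd (\<lambda>y. g (fst y) a (vp z w)) z h + g (fst z) a (pd (\<lambda>z. vp z w) z h))) (at z)"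
    by (rule field_has_derivative[OF open_TU assms])
      (auto intro!: bilinear_imp_linear(1) g_bil pd_fst(2) g_diff z differentiableI[OF vp_has_derivative[OF assms]])
  moreover have "pd (\<lambda>y. g (fst y) a (vp z w)) z h =
      g (fst z) (D (fst z) (fst h) a) (vp z w) + g (fst z) a (D (fst z) (fst h) (vp z w))" for h
    using pd_fst(1)[OF g_diff[OF z]] by (simp add: D_metric[OF z])
  ultimately show ?thesis by (simp add: pd_eqI[OF vp_has_derivative[OF assms]])
qed

context
  fixes N :: "('i, 'e) connection" and k :: "('i, 'e) metric_field" and i :: 'i
  assumes Ni [simp]: "N i = G" and ki [simp]: "k i = g"
begin

lemma fst_J1: "fst (J1 N i z w) = - vp z w"
  by (simp add: J1_def vertical_lift_def horizontal_lift_def vertical_part_def)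

lemma vp_J1: "z \<in> TU \<Longrightarrow> vp z (J1 N i z w) = fst w"
  by (cases z)
    (simp add: J1_def vertical_lift_def horizontal_lift_def vertical_part_def G_simps)

text \<open>\<open>J1\<close> exchanges horizontal and vertical parts while \<open>g1\<close> keeps
  them orthogonal, so the fundamental form pairs horizontal parts with vertical ones only.\<close>

lemma fundamental_form_eq:
  assumes "z \<in> TU"
  shows "fundamental_form (J1 N i) (g1 N k i) z [w, w'] =
    g (fst z) (fst w) (vp z w') - g (fst z) (fst w') (vp z w)"
proof -
  have z: "fst z \<in> U" using assms by (cases z) auto
  have "fundamental_form (J1 N i) (g1 N k i) z [w, w'] =
      g (fst z) (fst (J1 N i z w)) (fst w') + g (fst z) (vp z (J1 N i z w)) (vp z w')"
    by (simp add: fundamental_form_def g1_def vertical_part_def)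
  also have "\<dots> = g (fst z) (fst w) (vp z w') - g (fst z) (fst w') (vp z w)"
    unfolding vp_J1[OF assms] unfolding fst_J1 bilinear_lneg[OF g_bil[OF z]]
    using g_sym[OF z, of "vp z w" "fst w'"] by simp
  finally show ?thesis .
qed

text \<open>Only two horizontal arguments and one vertical argument contribute, through the skew
  part of the covariant derivative of the metric, which is \<open>tor\<close>. The horizontal
  distribution itself contributes nothing because \<open>G\<close> is flat and symmetric.\<close>

lemma ext_deriv_fundamental_form:
  assumes "z \<in> TU"
  shows "ext_deriv (fundamental_form (J1 N i) (g1 N k i)) z [w1, w2, w3] =
    tor (fst z) (fst w1) (fst w2) (vp z w3) + tor (fst z) (fst w2) (fst w3) (vp z w1)
      + tor (fst z) (fst w3) (fst w1) (vp z w2)"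
proof -
  obtain x y where zz: "z = (x, y)" by (cases z)
  then have x: "x \<in> U" using assms by auto
  obtain a1 b1 a2 b2 a3 b3 where w: "w1 = (a1, b1)" "w2 = (a2, b2)" "w3 = (a3, b3)"
    by (metis surj_pair)
  have "pd (\<lambda>z. fundamental_form (J1 N i) (g1 N k i) z [w, w']) z =
      pd (\<lambda>z. g (fst z) (fst w) (vp z w') - g (fst z) (fst w') (vp z w)) z" for w w'
    by (rule pd_cong_open[OF open_TU assms]) (rule fundamental_form_eq)
  note 1 = this[THEN trans, OF pd_eqI[OF has_derivative_diff[OF g_vp_has_derivative[OF assms] g_vp_has_derivative[OF assms]]]]
  \<comment> \<open>Antisymmetrising the derivatives of \<open>G\<close> yields the curvature of the
    flat connection applied to the fibre coordinate. Hence one order of differentiation can be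
    traded for the other plus products of \<open>G\<close>, which then cancel.\<close>
  have fl: "g x c (pd (\<lambda>y. G y v y') x u) = g x c (pd (\<lambda>y. G y u y') x v)
       - g x c (G x u (G x v y')) + g x c (G x v (G x u y'))" for c u v y'
  proof -
    have "pd (\<lambda>y. G y v y') x u = pd (\<lambda>y. G y u y') x v - G x u (G x v y') + G x v (G x u y')"
      using G_flat[OF x, of v y' u] by (simp add: algebra_simps)
    then show ?thesis by (simp add: g_simps[OF x])
  qed
  show ?thesis
    unfolding ext_deriv_3 1 using g_sym[OF x] D_sym[OF x]
    by (simp add: zz w tor_def gam_def g_simps[OF x] D_simps[OF x] G_simps[OF x]
      fl[of _ a2 _ a1] fl[of _ a3 _ a1] fl[of _ a3 _ a2])
qed

text \<open>\<open>J1\<close> swaps the roles of horizontal and vertical parts. The sign it puts on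
  the new horizontal parts occurs twice in each \<open>tor\<close> and disappears; the remaining
  sign is the factor for a 3-form.\<close>

lemma J_form_ext_deriv:
  assumes "z \<in> TU"
  shows "J_form (J1 N i) (ext_deriv (fundamental_form (J1 N i) (g1 N k i))) z [w1, w2, w3] =
    - (tor (fst z) (vp z w1) (vp z w2) (fst w3) + tor (fst z) (vp z w2) (vp z w3) (fst w1)
      + tor (fst z) (vp z w3) (vp z w1) (fst w2))"
proof -
  have z: "fst z \<in> U" using assms by (cases z) auto
  have n: "tor (fst z) (- p) (- q) v = tor (fst z) p q v" for p q v
    by (simp add: tor_def g_simps[OF z] gam_simps[OF z])
  show ?thesis
    unfolding J_form_def list.map ext_deriv_fundamental_form[OF assms] vp_J1[OF assms]
    unfolding fst_J1 n
    by simp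
qed

text \<open>At the zero section the horizontal vectors are the \<open>(u, 0)\<close>, so on the arguments below most
  terms of the exterior derivative vanish and what remains is the skew part of the covariant
  derivative of \<open>tor\<close>.\<close>

lemma pluriclosed_imp_tor:
  assumes x: "x \<in> U"
    and pl: "ext_deriv (J_form (J1 N i) (ext_deriv (fundamental_form (J1 N i) (g1 N k i)))) (x, 0)
      [(u, 0), (v, 0), (0, p), (0, q)] = 0"
  shows "pd (\<lambda>y. tor y p q v) x u - pd (\<lambda>y. tor y p q u) x v + tor x (G x v p) q u
    + tor x q (G x u p) v - tor x (G x v q) p u - tor x p (G x u q) v = 0"
proof -
  let ?\<eta> = "J_form (J1 N i) (ext_deriv (fundamental_form (J1 N i) (g1 N k i)))"
  have z: "(x, 0) \<in> TU" using x by simp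
  \<comment> \<open>The vertical part of \<open>(0, p)\<close> is \<open>p\<close> at every point,
    so this component depends on the base point alone.\<close>
  have 1: "pd (\<lambda>z. ?\<eta> z [(v, 0), (0, p), (0, q)]) (x, 0) (u, 0) = - pd (\<lambda>y. tor y p q v) x u" for u v
  proof -
    have "pd (\<lambda>z. ?\<eta> z [(v, 0), (0, p), (0, q)]) (x, 0) = pd (\<lambda>z. - tor (fst z) p q v) (x, 0)"
      by (rule pd_cong_open[OF open_TU z])
        (auto simp: J_form_ext_deriv tor_def g_simps gam_simps G_simps)
    then have "pd (\<lambda>z. ?\<eta> z [(v, 0), (0, p), (0, q)]) (x, 0) (u, 0) = pd (\<lambda>z. - tor (fst z) p q v) (x, 0::'e) (u, 0)"
      by (rule fun_cong)
    also have "\<dots> = pd (\<lambda>y. - tor y p q v) x u"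
      using pd_fst(1)[of "\<lambda>y. - tor y p q v" "(x, 0::'e)" "(u, 0)"] smooth_on_differentiable[OF tor_smooth x]
      by simp
    also have "\<dots> = - pd (\<lambda>y. tor y p q v) x u"
      using pd_scaleR[OF smooth_on_differentiable[OF tor_smooth x], of "-1"] by simp
    finally show ?thesis .
  qed
  have 2: "pd (\<lambda>z. ?\<eta> z [(u, 0), (v, 0), (0, q)]) (x, 0) (0, p) =
      - tor x (G x v p) q u + tor x (G x u p) q v" for p q
  proof -
    have der: "((\<lambda>z. tor (fst z) (vp z (c, 0)) q u) has_derivative
        (\<lambda>h. pd (\<lambda>y. tor (fst y) (vp (x, 0) (c, 0)) q u) (x, 0) h + tor x (pd (\<lambda>z. vp z (c, 0)) (x, 0) h) q u)) (at (x, 0))" for c u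
    proof -
      have "((\<lambda>z. tor (fst z) (vp z (c, 0)) q u) has_derivative
        (\<lambda>h. pd (\<lambda>y. tor (fst y) (vp (x, 0) (c, 0)) q u) (x, 0) h
          + tor (fst (x, 0::'e)) (pd (\<lambda>z. vp z (c, 0)) (x, 0) h) q u)) (at (x, 0))"
        by (rule field_has_derivative[OF open_TU z, where L = "\<lambda>z p. tor (fst z) p q u" and Y = "\<lambda>z. vp z (c, 0)"])
          (use x in \<open>auto intro!: tor_linear pd_fst(2) smooth_on_differentiable[OF tor_smooth]
            differentiableI[OF vp_has_derivative[OF z, of "(c, 0)", simplified]]\<close>)
      then show ?thesis by simp
    qed
    \<comment> \<open>The vertical part of \<open>(c, 0)\<close> vanishes on the zero section, but
      its derivative in the fibre direction \<open>p\<close> does not. This is the source of the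
      terms with \<open>G\<close> in the conclusion.\<close>
    have vpd: "pd (\<lambda>z. vp z (c, 0)) (x, 0) (0, p) = G x c p" for c
      unfolding pd_eqI[OF vp_has_derivative[OF z]]
      using linear_0[OF linear_frechet_derivative[OF G_diff[OF x]]] by simp
    have tz: "pd (\<lambda>y. tor (fst y) (vp (x, 0) (c, 0)) q u) (x, 0) (0, p) = 0" for c u
      using pd_fst(1)[OF smooth_on_differentiable[OF tor_smooth], of "(x, 0::'e)"] x
        linear_0[OF smooth_on_linear_pd[OF tor_smooth x]] by simp
    have "pd (\<lambda>z. ?\<eta> z [(u, 0), (v, 0), (0, q)]) (x, 0) =
        pd (\<lambda>z. tor (fst z) (vp z (u, 0)) q v - tor (fst z) (vp z (v, 0)) q u) (x, 0)"
      by (rule pd_cong_open[OF open_TU z])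
        (auto simp: J_form_ext_deriv tor_def g_simps gam_simps G_simps)
    then show ?thesis using tz vpd unfolding pd_eqI[OF has_derivative_diff[OF der der]] by simp
  qed
  show ?thesis
    using pl unfolding ext_deriv_4 1 2 using tor_skew[of x "G x u p" q v] tor_skew[of x "G x u q" p v]
    by simp
qed

end
end

section \<open>Curvature\<close>

context affine_riemann_chart
begin

definition curv :: "'e \<Rightarrow> 'e \<Rightarrow> 'e \<Rightarrow> 'e \<Rightarrow> 'e" where
  "curv x u v w = pd (\<lambda>y. D y v w) x u - pd (\<lambda>y. D y u w) x v + D x u (D x v w) - D x v (D x u w)"

definition dgam :: "'e \<Rightarrow> 'e \<Rightarrow> 'e \<Rightarrow> 'e \<Rightarrow> 'e" where
  "dgam x u v w = pd (\<lambda>y. gam y v w) x u + D x u (gam x v w) - gam x (D x u v) w - gam x v (D x u w)"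

text \<open>The curvature of \<open>D = G + gam\<close> is expanded around the flat connection
  \<open>G\<close>. The commutator has a minus sign because the derivative of \<open>gam\<close> is
  taken with \<open>D\<close> and not with \<open>G\<close>.\<close>

lemma curv_dgam:
  assumes x: "x \<in> U"
  shows "curv x u v w = dgam x u v w - dgam x v u w - (gam x u (gam x v w) - gam x v (gam x u w))"
proof -
  have "pd (\<lambda>y. D y v w) x u = pd (\<lambda>y. gam y v w) x u + pd (\<lambda>y. G y v w) x u" for u v w
    using pd_diff[OF D_diff[OF x] G_diff[OF x]] by (simp add: gam_def)
  then have "curv x u v w = pd (\<lambda>y. gam y v w) x u - pd (\<lambda>y. gam y u w) x v
     + (- G x u (G x v w) + G x v (G x u w)) + D x u (D x v w) - D x v (D x u w)"
    using G_flat[OF x, of v w u] by (simp add: curv_def algebra_simps)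
  moreover have "G x a (G x b w) = D x a (D x b w) - D x a (gam x b w) - gam x a (D x b w) + gam x a (gam x b w)" for a b
    by (simp add: gam_def D_simps[OF x] G_simps[OF x])
  ultimately show ?thesis
    using D_sym[OF x, of u v] by (simp add: dgam_def)
qed

text \<open>Differentiating the metric twice by \<open>D_metric\<close> and antisymmetrising leaves
  exactly this sum, while second partial derivatives commute.\<close>

lemma curv_skew:
  assumes x: "x \<in> U"
  shows "g x (curv x u v w) z + g x w (curv x u v z) = 0"
proof -
  have "pd (\<lambda>y. pd (\<lambda>y. g y w z) y v) x u =
      g x (D x u (D x v w)) z + g x (D x v w) (D x u z) + g x (pd (\<lambda>y. D y v w) x u) z
      + (g x (D x u w) (D x v z) + g x w (D x u (D x v z)) + g x w (pd (\<lambda>y. D y v z) x u))" for u v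
  proof -
    have "pd (\<lambda>y. pd (\<lambda>y. g y w z) y v) x u = pd (\<lambda>y. g y (D y v w) z + g y w (D y v z)) x u"
      by (rule fun_cong[OF pd_cong_open[OF open_U x]]) (rule D_metric)
    also have "\<dots> = pd (\<lambda>y. g y (D y v w) z) x u + pd (\<lambda>y. g y w (D y v z)) x u"
      by (intro pd_add smooth_on_differentiable[OF _ x] g_smooth_field D_smooth smooth_on_const)
    also have "pd (\<lambda>y. g y (D y v w) z) x u =
        pd (\<lambda>y. g y (D x v w) z) x u + g x (pd (\<lambda>y. D y v w) x u) z + g x (D x v w) (pd (\<lambda>y. z) x u)"
      by (rule pd_g_field[OF D_smooth smooth_on_const x])
    also have "pd (\<lambda>y. g y w (D y v z)) x u =
        pd (\<lambda>y. g y w (D x v z)) x u + g x (pd (\<lambda>y. w) x u) (D x v z) + g x w (pd (\<lambda>y. D y v z) x u)"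
      by (rule pd_g_field[OF smooth_on_const D_smooth x])
    finally show ?thesis by (simp add: D_metric[OF x] g_simps[OF x])
  qed
  note 1 = this
  show ?thesis
    using pd_pd_commute[OF open_U x g_smooth, of w z u v] unfolding 1 curv_def
    by (simp add: g_simps[OF x])
qed

lemma pd_tor:
  assumes x: "x \<in> U"
  shows "pd (\<lambda>y. tor y p q v) x u =
    g x (D x u q) (gam x p v) + g x q (D x u (gam x p v)) + g x q (pd (\<lambda>y. gam y p v) x u)
    - (g x (D x u p) (gam x q v) + g x p (D x u (gam x q v)) + g x p (pd (\<lambda>y. gam y q v) x u))"
proof -
  have "pd (\<lambda>y. tor y p q v) x u = pd (\<lambda>y. g y q (gam y p v)) x u - pd (\<lambda>y. g y p (gam y q v)) x u"
    unfolding tor_def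
    by (intro pd_diff smooth_on_differentiable[OF _ x] g_smooth_field gam_smooth smooth_on_const)
  moreover have "pd (\<lambda>y. g y q (gam y p v)) x u =
        pd (\<lambda>y. g y q (gam x p v)) x u + g x (pd (\<lambda>y. q) x u) (gam x p v) + g x q (pd (\<lambda>y. gam y p v) x u)" for p q
    by (rule pd_g_field[OF smooth_on_const gam_smooth x])
  ultimately show ?thesis by (simp add: D_metric[OF x] g_simps[OF x])
qed

text \<open>The assumption equates the skew part of \<open>D tor\<close> with products of
  \<open>gam\<close>. That skew part contains \<open>curv x u v w\<close> paired with
  \<open>z\<close> minus \<open>curv x u v z\<close> paired with \<open>w\<close>, which by
  \<open>curv_skew\<close> is twice the left-hand side; the commutators from
  \<open>curv_dgam\<close> supply the rest.\<close>

lemma curv_eq_gam: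
  assumes x: "x \<in> U"
    and pc: "pd (\<lambda>y. tor y w z v) x u - pd (\<lambda>y. tor y w z u) x v + tor x (G x v w) z u
    + tor x z (G x u w) v - tor x (G x v z) w u - tor x w (G x u z) v = 0"
  shows "g x (curv x u v w) z = g x (gam x u w) (gam x v z) - g x (gam x v w) (gam x u z)"
proof -
  have G: "G x a b = D x a b - gam x a b" for a b by (simp add: gam_def)
  \<comment> \<open>The symmetry of \<open>gam\<close> brings the field that is differentiated into
    the slot order of \<open>dgam\<close> which \<open>curv_dgam\<close> antisymmetrises.\<close>
  have P: "pd (\<lambda>y. gam y w v) x u = dgam x u v w - D x u (gam x v w) + gam x (D x u v) w + gam x v (D x u w)" for u v w
  proof -
    have "pd (\<lambda>y. gam y w v) x u = pd (\<lambda>y. gam y v w) x u"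
      by (rule fun_cong[OF pd_cong_open[OF open_U x]]) (rule gam_sym)
    then show ?thesis by (simp add: dgam_def)
  qed
  note cs = g_sym[OF x] D_sym[OF x] gam_sym[OF x]
  have 1: "g x (curv x u v w) z = - g x w (curv x u v z)" using curv_skew[OF x, of u v w z] by simp
  have t: "tor x (G x a b) c d = tor x (D x a b) c d - tor x (gam x a b) c d"
    "tor x c (G x a b) d = tor x c (D x a b) d - tor x c (gam x a b) d" for a b c d
    unfolding G by (simp_all add: tor_def gam_simps[OF x] g_simps[OF x])
  have pc': "pd (\<lambda>y. tor y w z v) x u - pd (\<lambda>y. tor y w z u) x v + tor x (D x v w) z u
    + tor x z (D x u w) v - tor x (D x v z) w u - tor x w (D x u z) v
    = tor x (gam x v w) z u + tor x z (gam x u w) v - tor x (gam x v z) w u - tor x w (gam x u z) v"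
    using pc unfolding t by simp
  show ?thesis
    using pc' 1 unfolding pd_tor[OF x] P curv_dgam[OF x] unfolding tor_def
    by (simp add: D_simps[OF x] gam_simps[OF x] g_simps[OF x], simp add: cs)
qed

end

section \<open>Traces and the inverse metric\<close>

definition tr :: "('e::euclidean_space \<Rightarrow> 'e) \<Rightarrow> real" where
  "tr L = (\<Sum>b\<in>Basis. L b \<bullet> b)"

lemma tr_comp_commute:
  fixes A B :: "'e::euclidean_space \<Rightarrow> 'e"
  assumes "linear A" "linear B"
  shows "tr (\<lambda>v. A (B v)) = tr (\<lambda>v. B (A v))"
proof -
  have "tr (\<lambda>v. A (B v)) = (\<Sum>b\<in>Basis. \<Sum>c\<in>Basis. (B b \<bullet> c) * (A c \<bullet> b))"
    if "linear A" for A B :: "'e \<Rightarrow> 'e"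
    unfolding tr_def
    by (intro sum.cong refl, subst linear_Basis_expand[OF that]) (simp add: inner_sum_left)
  from this[OF assms(1)] this[OF assms(2)] show ?thesis
    by (subst (asm) (2) sum.swap) (simp add: mult.commute)
qed

lemma tr_add: "tr (\<lambda>v. A v + B v) = tr A + tr B"
  and tr_diff: "tr (\<lambda>v. A v - B v) = tr A - tr B"
  by (simp_all add: tr_def inner_add_left inner_diff_left sum.distrib sum_subtractf)

locale inner_form =
  fixes h :: "'e::euclidean_space \<Rightarrow> 'e \<Rightarrow> real"
  assumes bil: "bilinear h" and sym: "h u v = h v u" and pos: "u \<noteq> 0 \<Longrightarrow> h u u > 0"
begin

lemmas h_simps = bilinear_ladd[OF bil] bilinear_radd[OF bil] bilinear_lsub[OF bil]
  bilinear_rsub[OF bil] bilinear_lneg[OF bil] bilinear_rneg[OF bil] bilinear_lzero[OF bil]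
  bilinear_rzero[OF bil] bilinear_lmul[OF bil] bilinear_rmul[OF bil]

lemma sum_left: "h (sum f A) v = (\<Sum>a\<in>A. h (f a) v)"
  by (rule linear_sum[OF bilinear_imp_linear(2)[OF bil]])

lemma sum_right: "h v (sum f A) = (\<Sum>a\<in>A. h v (f a))"
  by (rule linear_sum[OF bilinear_imp_linear(1)[OF bil]])

lemma nonneg: "0 \<le> h u u"
  using pos[of u] by (cases "u = 0") (auto simp: h_simps)

lemma eqI: assumes "\<And>v. h a v = h b v" shows "a = b"
proof (rule ccontr)
  assume "a \<noteq> b"
  then have "h (a - b) (a - b) > 0" by (intro pos) simp
  then show False using assms by (simp add: h_simps)
qed

text \<open>Gram-Schmidt: fewer vectors than the dimension cannot span, so some vector has a nonzero
  component orthogonal to the list.\<close>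

lemma ex_orthonormal_list:
  "n \<le> DIM('e) \<Longrightarrow> \<exists>e :: nat \<Rightarrow> 'e. \<forall>i<n. \<forall>j<n. h (e i) (e j) = (if i = j then 1 else 0)"
proof (induction n)
  case (Suc n)
  then obtain e :: "nat \<Rightarrow> 'e" where e: "\<And>i j. i < n \<Longrightarrow> j < n \<Longrightarrow> h (e i) (e j) = (if i = j then 1 else 0)"
    by auto
  have "dim (e ` {..<n}) \<le> card (e ` {..<n})" by (rule dim_le_card) (auto intro: span_base)
  also have "\<dots> \<le> n" using card_image_le[of "{..<n}" e] by simp
  finally have "dim (e ` {..<n}) < DIM('e)" using Suc.prems by simp
  then have "span (e ` {..<n}) \<noteq> UNIV" using dim_eq_full by (metis nat_neq_iff)
  then obtain w where w: "w \<notin> span (e ` {..<n})" by auto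
  define w' where "w' = w - (\<Sum>i<n. h w (e i) *\<^sub>R e i)"
  have "(\<Sum>i<n. h w (e i) *\<^sub>R e i) \<in> span (e ` {..<n})"
    by (intro span_sum span_scale span_base) auto
  then have "w' \<noteq> 0" using w by (auto simp: w'_def)
  then have p: "h w' w' > 0" by (rule pos)
  define f where "f = w' /\<^sub>R sqrt (h w' w')"
  have o: "h w' (e j) = 0" if "j < n" for j
  proof -
    have "h w' (e j) = h w (e j) - (\<Sum>i<n. h w (e i) * h (e i) (e j))"
      by (simp add: w'_def h_simps sum_left)
    also have "(\<Sum>i<n. h w (e i) * h (e i) (e j)) = (\<Sum>i<n. if i = j then h w (e i) else 0)"
      using e that by (intro sum.cong) auto
    finally show ?thesis using that by simp
  qed
  have ff: "h f f = 1" using p by (simp add: f_def h_simps field_simps)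
  have fe: "h f (e j) = 0" if "j < n" for j using o[OF that] by (simp add: f_def h_simps)
  have ef: "h (e j) f = 0" if "j < n" for j using fe[OF that] sym by metis
  show ?case
    by (rule exI[of _ "e(n := f)"])
      (use e ff fe ef in \<open>auto simp: less_Suc_eq\<close>)
qed auto

lemma ex_orthonormal_frame: "\<exists>E. orthonormal_frame h E"
proof -
  obtain e :: "nat \<Rightarrow> 'e" where e: "\<And>i j. i < DIM('e) \<Longrightarrow> j < DIM('e) \<Longrightarrow> h (e i) (e j) = (if i = j then 1 else 0)"
    using ex_orthonormal_list[OF order_refl] by blast
  obtain k where k: "bij_betw k (Basis::'e set) {0..<DIM('e)}"
    using ex_bij_betw_finite_nat[OF finite_Basis] by blast
  have "h (e (k a)) (e (k b)) = (if a = b then 1 else 0)" if "a \<in> Basis" "b \<in> Basis" for a b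
    using e[of "k a" "k b"] bij_betwE[OF k] that bij_betw_imp_inj_on[OF k] by (auto simp: inj_on_eq_iff)
  then show ?thesis unfolding orthonormal_frame_def by (intro exI[of _ "\<lambda>a. e (k a)"]) auto
qed

context
  fixes E assumes E: "orthonormal_frame h E"
begin

lemma frame: "a \<in> Basis \<Longrightarrow> b \<in> Basis \<Longrightarrow> h (E a) (E b) = (if a = b then 1 else 0)"
  using E by (auto simp: orthonormal_frame_def)

lemma frame_inj: "inj_on E Basis"
  by (rule inj_onI) (metis frame zero_neq_one)

text \<open>Orthonormality makes the frame independent, and by its cardinality it then
  spans.\<close>

lemma frame_expand: "v = (\<Sum>b\<in>Basis. h v (E b) *\<^sub>R E b)"
proof -
  have indep: "independent (E ` Basis)"
    unfolding independent_explicit_module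
  proof (intro allI impI)
    fix T f v assume T: "finite T" "T \<subseteq> E ` Basis" "(\<Sum>v\<in>T. f v *\<^sub>R v) = (0::'e)" "v \<in> T"
    have *: "f w * h w v = (if w = v then f w else 0)" if wT: "w \<in> T" for w
    proof -
      obtain a b where "a \<in> Basis" "b \<in> Basis" "v = E a" "w = E b" using T wT by blast
      then show ?thesis using frame[of b a] inj_on_eq_iff[OF frame_inj] by auto
    qed
    have "0 = h (\<Sum>v\<in>T. f v *\<^sub>R v) v" unfolding T(3) by (simp add: h_simps)
    also have "\<dots> = (\<Sum>w\<in>T. if w = v then f w else 0)"
      unfolding sum_left using * by (intro sum.cong) (auto simp: h_simps)
    also have "\<dots> = f v" using T by simp
    finally show "f v = 0" by simp
  qed
  have "UNIV \<subseteq> span (E ` Basis)"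
    by (rule card_ge_dim_independent[OF subset_UNIV indep]) (simp add: card_image[OF frame_inj])
  then have "v \<in> span (E ` Basis)" by auto
  then obtain f where f: "v = (\<Sum>w\<in>E ` Basis. f w *\<^sub>R w)" by (auto simp: span_finite)
  then have v: "v = (\<Sum>b\<in>Basis. f (E b) *\<^sub>R E b)" by (simp add: sum.reindex[OF frame_inj])
  have "h v (E b) = f (E b)" if "b \<in> Basis" for b
  proof -
    have "h v (E b) = (\<Sum>c\<in>Basis. f (E c) * h (E c) (E b))"
      by (subst v) (simp add: sum_left h_simps)
    also have "\<dots> = (\<Sum>c\<in>Basis. if c = b then f (E c) else 0)"
      using frame that by (intro sum.cong) auto
    finally show ?thesis using that by simp
  qed
  then show ?thesis using v by (metis (no_types, lifting) sum.cong)
qed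

lemma h_frame: "h u v = (\<Sum>b\<in>Basis. h u (E b) * h v (E b))"
  by (subst frame_expand[of u]) (simp add: sum_left h_simps sym[of v])

lemma tr_frame: assumes "linear L" shows "tr L = (\<Sum>b\<in>Basis. h (L (E b)) (E b))"
proof -
  have "tr L = (\<Sum>b\<in>Basis. \<Sum>c\<in>Basis. h b (E c) * (L (E c) \<bullet> b))"
    unfolding tr_def
  proof (intro sum.cong refl)
    fix b :: 'e
    have "L b = (\<Sum>c\<in>Basis. h b (E c) *\<^sub>R L (E c))"
      by (subst frame_expand[of b]) (simp add: linear_sum[OF assms] linear_cmul[OF assms])
    then show "L b \<bullet> b = (\<Sum>c\<in>Basis. h b (E c) * (L (E c) \<bullet> b))" by (simp add: inner_sum_left)
  qed
  also have "\<dots> = (\<Sum>c\<in>Basis. \<Sum>b\<in>Basis. h b (E c) * (L (E c) \<bullet> b))" by (rule sum.swap)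
  also have "\<dots> = (\<Sum>c\<in>Basis. h (L (E c)) (E c))"
  proof (intro sum.cong refl)
    fix c :: 'e
    have "h (L (E c)) (E c) = h (\<Sum>b\<in>Basis. (L (E c) \<bullet> b) *\<^sub>R b) (E c)"
      by (simp add: euclidean_representation)
    then show "(\<Sum>b\<in>Basis. h b (E c) * (L (E c) \<bullet> b)) = h (L (E c)) (E c)"
      by (simp add: sum_left h_simps mult.commute)
  qed
  finally show ?thesis .
qed

end

text \<open>The isomorphism from covectors, written as vectors by means of the Euclidean inner product,
  to vectors that is induced by \<open>h\<close>.\<close>

definition sharp :: "'e \<Rightarrow> 'e" where
  "sharp b = (\<Sum>c\<in>Basis. (b \<bullet> (SOME E. orthonormal_frame h E) c) *\<^sub>R (SOME E. orthonormal_frame h E) c)"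

lemma h_sharp: "h (sharp b) v = b \<bullet> v"
proof -
  define E where "E = (SOME E. orthonormal_frame h E)"
  have E: "orthonormal_frame h E" unfolding E_def by (rule someI_ex[OF ex_orthonormal_frame])
  have "h (sharp b) v = (\<Sum>c\<in>Basis. (b \<bullet> E c) * h v (E c))"
    unfolding sharp_def E_def[symmetric] by (simp add: sum_left h_simps sym[of v])
  also have "\<dots> = b \<bullet> (\<Sum>c\<in>Basis. h v (E c) *\<^sub>R E c)" by (simp add: inner_sum_right mult.commute)
  finally show ?thesis using frame_expand[OF E, of v] by simp
qed

lemma linear_sharp: "linear sharp"
  by (intro linearI eqI) (simp_all add: h_sharp h_simps inner_add_left)

text \<open>The left side is the contraction with the inverse metric. It involves no choice of
  frame, so it varies smoothly with the base point, while the right side is suited to computations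
  at one point.\<close>

lemma sum_sharp_frame:
  fixes B :: "'e \<Rightarrow> 'e \<Rightarrow> real"
  assumes E: "orthonormal_frame h E" and B: "bilinear B"
  shows "(\<Sum>b\<in>Basis. B (sharp b) b) = (\<Sum>b\<in>Basis. B (E b) (E b))"
proof -
  have "sharp b = (\<Sum>c\<in>Basis. (b \<bullet> E c) *\<^sub>R E c)" for b
    using frame_expand[OF E, of "sharp b"] by (simp add: h_sharp)
  then have "(\<Sum>b\<in>Basis. B (sharp b) b) = (\<Sum>b\<in>Basis. \<Sum>c\<in>Basis. (b \<bullet> E c) * B (E c) b)"
    by (simp add: linear_sum[OF bilinear_imp_linear(2)[OF B]] bilinear_lmul[OF B])
  also have "\<dots> = (\<Sum>c\<in>Basis. \<Sum>b\<in>Basis. (b \<bullet> E c) * B (E c) b)" by (rule sum.swap)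
  also have "\<dots> = (\<Sum>c\<in>Basis. B (E c) (E c))"
  proof (intro sum.cong refl)
    fix c :: 'e
    have "B (E c) (E c) = (\<Sum>b\<in>Basis. (E c \<bullet> b) *\<^sub>R B (E c) b)"
      by (rule linear_Basis_expand[OF bilinear_imp_linear(1)[OF B]])
    then show "(\<Sum>b\<in>Basis. (b \<bullet> E c) * B (E c) b) = B (E c) (E c)" by (simp add: inner_commute)
  qed
  finally show ?thesis .
qed

end

section \<open>The inverse metric and derivatives of traces\<close>

context affine_riemann_chart
begin

lemma inner_form: "x \<in> U \<Longrightarrow> inner_form (g x)"
  by unfold_locales (auto intro: g_bil g_sym g_pos)

definition ginv :: "'e \<Rightarrow> 'e \<Rightarrow> 'e" where "ginv x = inner_form.sharp (g x)"

lemma g_ginv: "x \<in> U \<Longrightarrow> g x (ginv x b) v = b \<bullet> v"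
  unfolding ginv_def by (rule inner_form.h_sharp[OF inner_form])

lemma linear_ginv: "x \<in> U \<Longrightarrow> linear (ginv x)"
  unfolding ginv_def by (rule inner_form.linear_sharp[OF inner_form])

text \<open>The bundle map \<open>(x, v)\<close> to \<open>(x, g x v)\<close>, with covectors
  written as vectors, is differentiable and has a known inverse with an invertible derivative. The
  inverse function theorem then differentiates \<open>ginv\<close> without any formula for an
  inverse matrix.\<close>

lemma ginv_differentiable:
  assumes x: "x \<in> U"
  shows "(\<lambda>x. ginv x b) differentiable at x"
proof -
  define L where "L x v = (\<Sum>c\<in>Basis. g x v c *\<^sub>R c)" for x v
  have L_inner: "L y v \<bullet> w = g y v w" if "y \<in> U" for y v w
  proof -
    have "g y v w = (\<Sum>c\<in>Basis. (w \<bullet> c) *\<^sub>R g y v c)"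
      by (rule linear_Basis_expand[OF bilinear_imp_linear(1)[OF g_bil[OF that]]])
    then show ?thesis by (simp add: L_def inner_sum_left inner_sum_right inner_commute[of _ w] mult.commute)
  qed
  have L_lin: "linear (L y)" if "y \<in> U" for y
    by (rule linearI; rule euclidean_eqI) (simp_all add: L_inner[OF that] g_simps[OF that] inner_add_left)
  have L_smooth: "smooth_on (\<lambda>y. L y v) U" for v
    unfolding L_def by (intro smooth_on_sum smooth_on_scaleR open_U g_smooth smooth_on_const)
  have gL: "ginv y (L y v) = v" if "y \<in> U" for y v
    by (rule inner_form.eqI[OF inner_form[OF that]]) (simp add: g_ginv[OF that] L_inner[OF that])
  have Lg: "L y (ginv y v) = v" if "y \<in> U" for y v
    by (rule euclidean_eqI) (simp add: g_ginv[OF that] L_inner[OF that])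
  define \<Phi> where "\<Phi> z = (fst z, L (fst z) (snd z))" for z :: "'e \<times> 'e"
  define \<Psi> where "\<Psi> z = (fst z, ginv (fst z) (snd z))" for z :: "'e \<times> 'e"
  have der: "((\<lambda>z. L (fst z) (snd z)) has_derivative
      (\<lambda>h. pd (\<lambda>y. L y (snd z)) (fst z) (fst h) + L (fst z) (snd h))) (at z)" if z: "z \<in> TU" for z
  proof -
    have z1: "fst z \<in> U" using that by (cases z) auto
    have "((\<lambda>z. L (fst z) (snd z)) has_derivative
        (\<lambda>h. pd (\<lambda>y. L (fst y) (snd z)) z h + L (fst z) (pd snd z h))) (at z)"
      by (rule field_has_derivative[OF open_TU z])
        (auto intro!: L_lin pd_fst(2) smooth_on_differentiable[OF L_smooth] z1
          differentiableI[OF has_derivative_snd[OF has_derivative_ident]])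
    moreover have "pd snd z = snd" by (rule pd_eqI[OF has_derivative_snd[OF has_derivative_ident]])
    moreover have "pd (\<lambda>y. L (fst y) (snd z)) z h = pd (\<lambda>y. L y (snd z)) (fst z) (fst h)" for h
      by (rule pd_fst(1)[OF smooth_on_differentiable[OF L_smooth z1]])
    ultimately show ?thesis by simp
  qed
  have der2: "(\<Phi> has_derivative (\<lambda>h. (fst h, pd (\<lambda>y. L y (snd z)) (fst z) (fst h) + L (fst z) (snd h)))) (at z)"
    if "z \<in> TU" for z
    unfolding \<Phi>_def[abs_def] by (intro has_derivative_Pair der[OF that] has_derivative_fst has_derivative_ident)
  have z: "(x, ginv x b) \<in> TU" using x by simp
  have "(\<Psi> has_derivative (\<lambda>h. (fst h, ginv x (snd h - pd (\<lambda>y. L y (ginv x b)) x (fst h))))) (at (\<Phi> (x, ginv x b)))"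
  proof (rule has_derivative_inverse_strong[OF open_TU z])
    show "continuous_on TU \<Phi>"
      using der2 by (intro continuous_at_imp_continuous_on ballI has_derivative_continuous)
    show "\<Psi> (\<Phi> z) = z" if "z \<in> TU" for z using that by (auto simp: \<Phi>_def \<Psi>_def gL)
    show "(\<Phi> has_derivative (\<lambda>h. (fst h, pd (\<lambda>y. L y (ginv x b)) x (fst h) + L x (snd h)))) (at (x, ginv x b))"
      using der2[OF z] by simp
  qed (simp add: fun_eq_iff Lg[OF x])
  then have "\<Psi> differentiable at (x, b)" by (auto simp: \<Phi>_def Lg[OF x] intro: differentiableI)
  then have "(\<lambda>y. \<Psi> (y, b)) differentiable at x"
    using differentiable_chain_at[of "\<lambda>y. (y, b)" x \<Psi>]
    by (auto simp: o_def intro!: differentiableI[OF has_derivative_Pair[OF has_derivative_ident has_derivative_const]])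
  then obtain f' where "((\<lambda>y. \<Psi> (y, b)) has_derivative f') (at x)" by (auto simp: differentiable_def)
  from has_derivative_snd[OF this] show ?thesis by (auto simp: \<Psi>_def intro: differentiableI)
qed

text \<open>The transpose of \<open>D x u\<close> for the Euclidean inner product, that is, its
  action on covectors written as vectors.\<close>

definition DT :: "'e \<Rightarrow> 'e \<Rightarrow> 'e \<Rightarrow> 'e" where
  "DT x u b = (\<Sum>c\<in>Basis. (b \<bullet> D x u c) *\<^sub>R c)"

lemma DT_inner: assumes "x \<in> U" shows "DT x u b \<bullet> v = b \<bullet> D x u v"
proof -
  have "D x u v = (\<Sum>c\<in>Basis. (v \<bullet> c) *\<^sub>R D x u c)"
    by (rule linear_Basis_expand[OF bilinear_imp_linear(1)[OF D_bil[OF assms]]])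
  then have "b \<bullet> D x u v = b \<bullet> (\<Sum>c\<in>Basis. (v \<bullet> c) *\<^sub>R D x u c)" by (rule arg_cong)
  then show ?thesis by (simp add: DT_def inner_sum_left inner_sum_right inner_commute[of _ v] mult.commute)
qed

lemma DT_smooth: "smooth_on (\<lambda>x. DT x u b) U"
  unfolding DT_def by (intro smooth_on_sum smooth_on_scaleR smooth_on_inner open_U D_smooth smooth_on_const)

text \<open>The identity \<open>g_ginv\<close> is differentiated; in invariant terms the inverse
  metric is parallel for \<open>D\<close>.\<close>

lemma pd_ginv:
  assumes x: "x \<in> U"
  shows "pd (\<lambda>y. ginv y b) x u = - D x u (ginv x b) - ginv x (DT x u b)"
proof (rule inner_form.eqI[OF inner_form[OF x]])
  fix v
  have "pd (\<lambda>y. g y (ginv y b) v) x u = pd (\<lambda>y. g y (ginv x b) v) x u + g x (pd (\<lambda>y. ginv y b) x u) v"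
    by (rule pd_field[OF open_U x, where L = "\<lambda>y a. g y a v"])
      (auto intro: bilinear_imp_linear g_bil g_diff x ginv_differentiable)
  moreover have "pd (\<lambda>y. g y (ginv y b) v) x = pd (\<lambda>y. b \<bullet> v) x"
    by (rule pd_cong_open[OF open_U x]) (rule g_ginv)
  ultimately show "g x (pd (\<lambda>y. ginv y b) x u) v = g x (- D x u (ginv x b) - ginv x (DT x u b)) v"
    by (simp add: D_metric[OF x] g_simps[OF x] g_ginv[OF x] DT_inner[OF x])
qed

text \<open>\<open>pd_ginv\<close> expresses the derivatives of \<open>ginv\<close> through
  \<open>ginv\<close> and smooth fields, so each order of differentiability yields the next.\<close>

lemma ginv_smooth: "smooth_on (\<lambda>x. ginv x b) U"
proof -
  have "Ck_on k (\<lambda>x. ginv x b) U" for k b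
  proof (induction k arbitrary: b)
    case 0
    then show ?case
      by (auto intro!: continuous_at_imp_continuous_on differentiable_imp_continuous_within ginv_differentiable)
  next
    case (Suc k)
    have 1: "Ck_on k (\<lambda>x. D x u (ginv x b)) U" for u
      by (rule Ck_on_field[OF open_U _ _ Suc])
        (use D_smooth in \<open>auto simp: smooth_on_def intro: bilinear_imp_linear D_bil\<close>)
    have 2: "Ck_on k (\<lambda>x. ginv x (DT x u b)) U" for u
      by (rule Ck_on_field[OF open_U linear_ginv Suc])
        (use DT_smooth in \<open>auto simp: smooth_on_def\<close>)
    have "Ck_on k (\<lambda>x. pd (\<lambda>y. ginv y b) x u) U" for u
      by (rule Ck_on_cong[OF open_U _ Ck_on_diff[OF open_U Ck_on_minus[OF open_U 1] 2]]) (simp add: pd_ginv)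
    then show ?case using ginv_differentiable by simp
  qed
  then show ?thesis by (simp add: smooth_on_def)
qed

definition mtrace :: "'e \<Rightarrow> ('e \<Rightarrow> 'e \<Rightarrow> real) \<Rightarrow> real" where
  "mtrace x B = (\<Sum>b\<in>Basis. B (ginv x b) b)"

lemma mtrace_frame:
  "x \<in> U \<Longrightarrow> orthonormal_frame (g x) E \<Longrightarrow> bilinear B \<Longrightarrow> mtrace x B = (\<Sum>b\<in>Basis. B (E b) (E b))"
  using inner_form.sum_sharp_frame[OF inner_form, of x E B] by (simp add: mtrace_def ginv_def)

lemma mtrace_smooth:
  assumes "\<And>x. x \<in> U \<Longrightarrow> bilinear (B x)" "\<And>u v. smooth_on (\<lambda>x. B x u v) U"
  shows "smooth_on (\<lambda>x. mtrace x (B x)) U"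
  unfolding mtrace_def
  by (intro smooth_on_sum open_U smooth_on_bilinear_field[OF open_U assms(1,2)] ginv_smooth smooth_on_const)

text \<open>The trace commutes with the covariant derivative because \<open>D\<close> is metric. The
  left side is free of frames, so no derivative of a frame appears.\<close>

lemma pd_mtrace:
  assumes x: "x \<in> U" and B: "\<And>x. x \<in> U \<Longrightarrow> bilinear (B x)" "\<And>u v. smooth_on (\<lambda>x. B x u v) U"
  shows "pd (\<lambda>y. mtrace y (B y)) x u =
    mtrace x (\<lambda>a b. pd (\<lambda>y. B y a b) x u - B x (D x u a) b - B x a (D x u b))"
proof -
  note Bx = B(1)[OF x]
  have "pd (\<lambda>y. mtrace y (B y)) x u = (\<Sum>b\<in>Basis. pd (\<lambda>y. B y (ginv y b) b) x u)"
    unfolding mtrace_def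
    by (intro pd_sum smooth_on_differentiable[OF _ x] smooth_on_bilinear_field[OF open_U B] ginv_smooth smooth_on_const)
  also have "\<dots> = (\<Sum>b\<in>Basis. pd (\<lambda>y. B y (ginv x b) b) x u - B x (D x u (ginv x b)) b - B x (ginv x (DT x u b)) b)"
  proof (intro sum.cong refl)
    fix b
    have "pd (\<lambda>y. B y (ginv y b) b) x u = pd (\<lambda>y. B y (ginv x b) b) x u
        + B x (pd (\<lambda>y. ginv y b) x u) b + B x (ginv x b) (pd (\<lambda>y. b) x u)"
      by (rule pd_bilinear_field[OF open_U x B ginv_smooth smooth_on_const])
    then show "pd (\<lambda>y. B y (ginv y b) b) x u = pd (\<lambda>y. B y (ginv x b) b) x u - B x (D x u (ginv x b)) b - B x (ginv x (DT x u b)) b"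
      by (simp add: pd_ginv[OF x] bilinear_rzero[OF Bx] bilinear_lsub[OF Bx] bilinear_lneg[OF Bx])
  qed
  also have "\<dots> = (\<Sum>b\<in>Basis. pd (\<lambda>y. B y (ginv x b) b) x u - B x (D x u (ginv x b)) b)
      - (\<Sum>b\<in>Basis. B x (ginv x (DT x u b)) b)"
    by (rule sum_subtractf)
  also have "(\<Sum>b\<in>Basis. B x (ginv x (DT x u b)) b) = (\<Sum>b\<in>Basis. \<Sum>c\<in>Basis. (b \<bullet> D x u c) * B x (ginv x c) b)"
    unfolding DT_def
    by (simp add: linear_sum[OF linear_ginv[OF x]] linear_cmul[OF linear_ginv[OF x]]
      linear_sum[OF bilinear_imp_linear(2)[OF Bx]] bilinear_lmul[OF Bx])
  \<comment> \<open>Interchanging the sums moves the transpose off the first slot and becomes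
    \<open>D x u\<close> in the second slot.\<close>
  also have "\<dots> = (\<Sum>c\<in>Basis. \<Sum>b\<in>Basis. (b \<bullet> D x u c) * B x (ginv x c) b)" by (rule sum.swap)
  also have "\<dots> = (\<Sum>c\<in>Basis. B x (ginv x c) (D x u c))"
  proof (intro sum.cong refl)
    fix c :: 'e
    have "B x (ginv x c) (D x u c) = (\<Sum>b\<in>Basis. (D x u c \<bullet> b) *\<^sub>R B x (ginv x c) b)"
      by (rule linear_Basis_expand[OF bilinear_imp_linear(1)[OF Bx]])
    then show "(\<Sum>b\<in>Basis. (b \<bullet> D x u c) * B x (ginv x c) b) = B x (ginv x c) (D x u c)"
      by (simp add: inner_commute)
  qed
  finally show ?thesis by (simp add: mtrace_def sum_subtractf)
qed

end

section \<open>Nonnegative Ricci curvature and the divergence of the Koszul form\<close>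

lemma pd_tr:
  assumes "\<And>w. (\<lambda>y. A y w) differentiable at x"
  shows "pd (\<lambda>y. tr (A y)) x u = tr (\<lambda>w. pd (\<lambda>y. A y w) x u)"
  unfolding tr_def
  by (subst pd_sum) (auto simp: pd_inner_right assms intro!: differentiable_inner)

lemma smooth_on_tr:
  assumes "open S" "\<And>w. smooth_on (\<lambda>y. A y w) S"
  shows "smooth_on (\<lambda>y. tr (A y)) S"
  unfolding tr_def by (intro smooth_on_sum smooth_on_inner assms smooth_on_const)

lemma bilinear_inner: "bilinear B \<Longrightarrow> bilinear (\<lambda>a b. B a b \<bullet> e)"
  unfolding bilinear_def[of "\<lambda>a b. B a b \<bullet> e"]
  by (intro conjI allI linearI)
    (simp_all add: bilinear_ladd bilinear_radd bilinear_lmul bilinear_rmul inner_add_left)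

context affine_riemann_chart
begin

lemma linear_pd_gam:
  assumes x: "x \<in> U"
  shows "linear (\<lambda>v. pd (\<lambda>y. gam y v w) x u)" "linear (\<lambda>w. pd (\<lambda>y. gam y v w) x u)"
  by (rule linear_pd_field[OF open_U x, where L = "\<lambda>y v. gam y v w"],
      auto intro: bilinear_imp_linear gam_bil gam_diff x)
    (rule linear_pd_field[OF open_U x, where L = "\<lambda>y w. gam y v w"],
      auto intro: bilinear_imp_linear gam_bil gam_diff x)

lemma dgam_linear:
  assumes x: "x \<in> U"
  shows "linear (\<lambda>u. dgam x u v w)" "linear (\<lambda>v. dgam x u v w)" "linear (\<lambda>w. dgam x u v w)"
proof -
  note l = linear_add[OF smooth_on_linear_pd[OF gam_smooth x]] linear_cmul[OF smooth_on_linear_pd[OF gam_smooth x]]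
    linear_add[OF linear_pd_gam(1)[OF x]] linear_cmul[OF linear_pd_gam(1)[OF x]]
    linear_add[OF linear_pd_gam(2)[OF x]] linear_cmul[OF linear_pd_gam(2)[OF x]]
    D_simps[OF x] gam_simps[OF x]
  show "linear (\<lambda>u. dgam x u v w)" by (rule linearI) (simp_all add: dgam_def l algebra_simps)
  show "linear (\<lambda>v. dgam x u v w)" by (rule linearI) (simp_all add: dgam_def l algebra_simps)
  show "linear (\<lambda>w. dgam x u v w)" by (rule linearI) (simp_all add: dgam_def l algebra_simps)
qed

lemma dgam_smooth: "smooth_on (\<lambda>x. dgam x u v w) U"
  unfolding dgam_def
  by (intro smooth_on_diff smooth_on_add open_U smooth_on_pd gam_smooth D_smooth_field
      gam_smooth_field D_smooth smooth_on_const)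

lemma dgam_sym:
  assumes x: "x \<in> U" shows "dgam x u v w = dgam x u w v"
proof -
  have "pd (\<lambda>y. gam y v w) x = pd (\<lambda>y. gam y w v) x"
    by (rule pd_cong_open[OF open_U x]) (rule gam_sym)
  then show ?thesis
    using gam_sym[OF x, of v w] gam_sym[OF x, of "D x u v" w] gam_sym[OF x, of v "D x u w"]
    by (simp add: dgam_def)
qed

section \<open>Divergence of 1-forms\<close>

definition divg :: "('e \<Rightarrow> 'e \<Rightarrow> real) \<Rightarrow> 'e \<Rightarrow> real" where
  "divg \<beta> x = mtrace x (\<lambda>u v. pd (\<lambda>y. \<beta> y v) x u - \<beta> x (D x u v))"

definition raise :: "('e \<Rightarrow> 'e \<Rightarrow> real) \<Rightarrow> 'e \<Rightarrow> 'e" where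
  "raise \<beta> x = (\<Sum>b\<in>Basis. \<beta> x b *\<^sub>R ginv x b)"

lemma g_raise:
  assumes x: "x \<in> U" and l: "linear (\<beta> x)" shows "g x (raise \<beta> x) v = \<beta> x v"
proof -
  have "\<beta> x v = (\<Sum>b\<in>Basis. (v \<bullet> b) *\<^sub>R \<beta> x b)" by (rule linear_Basis_expand[OF l])
  then show ?thesis
    by (simp add: raise_def inner_form.sum_left[OF inner_form[OF x]] g_simps[OF x] g_ginv[OF x] inner_commute mult.commute)
qed

lemma raise_smooth:
  assumes "\<And>v. smooth_on (\<lambda>x. \<beta> x v) U" shows "smooth_on (raise \<beta>) U"
  unfolding raise_def[abs_def] by (intro smooth_on_sum smooth_on_scaleR open_U assms ginv_smooth)

text \<open>This is the coordinate expression of the divergence: it differs from the trace of the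
  coordinate derivative by the contracted Christoffel symbol. The same term appears in the
  derivative of \<open>vol\<close> and cancels there.\<close>

lemma divergence_raise:
  assumes x: "x \<in> U" and l: "\<And>x. x \<in> U \<Longrightarrow> linear (\<beta> x)" and sm: "\<And>v. smooth_on (\<lambda>x. \<beta> x v) U"
  shows "tr (pd (raise \<beta>) x) = divg \<beta> x - tr (D x (raise \<beta> x))"
proof -
  note lx = l[OF x]
  have pdX: "pd (raise \<beta>) x u = (\<Sum>b\<in>Basis. (pd (\<lambda>y. \<beta> y b) x u - \<beta> x (D x u b)) *\<^sub>R ginv x b) - D x u (raise \<beta> x)" for u
  proof -
    have "pd (raise \<beta>) x u = (\<Sum>b\<in>Basis. pd (\<lambda>y. \<beta> y b *\<^sub>R ginv y b) x u)"
      unfolding raise_def[abs_def]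
      by (intro pd_sum smooth_on_differentiable[OF _ x] smooth_on_scaleR open_U sm ginv_smooth)
    also have "\<dots> = (\<Sum>b\<in>Basis. pd (\<lambda>y. \<beta> y b) x u *\<^sub>R ginv x b - \<beta> x b *\<^sub>R D x u (ginv x b) - \<beta> x b *\<^sub>R ginv x (DT x u b))"
    proof (intro sum.cong refl)
      fix b
      have "((\<lambda>y. \<beta> y b *\<^sub>R ginv y b) has_derivative
          (\<lambda>u. \<beta> x b *\<^sub>R pd (\<lambda>y. ginv y b) x u + pd (\<lambda>y. \<beta> y b) x u *\<^sub>R ginv x b)) (at x)"
        by (intro has_derivative_scaleR smooth_on_has_derivative[OF _ x] sm ginv_smooth)
      then show "pd (\<lambda>y. \<beta> y b *\<^sub>R ginv y b) x u =
          pd (\<lambda>y. \<beta> y b) x u *\<^sub>R ginv x b - \<beta> x b *\<^sub>R D x u (ginv x b) - \<beta> x b *\<^sub>R ginv x (DT x u b)"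
        by (simp add: pd_eqI pd_ginv[OF x] scaleR_diff_right)
    qed
    also have "\<dots> = (\<Sum>b\<in>Basis. pd (\<lambda>y. \<beta> y b) x u *\<^sub>R ginv x b) - D x u (raise \<beta> x) - (\<Sum>b\<in>Basis. \<beta> x b *\<^sub>R ginv x (DT x u b))"
      by (simp add: sum_subtractf raise_def linear_sum[OF bilinear_imp_linear(1)[OF D_bil[OF x]]] D_simps[OF x])
    also have "(\<Sum>b\<in>Basis. \<beta> x b *\<^sub>R ginv x (DT x u b)) = (\<Sum>b\<in>Basis. \<Sum>c\<in>Basis. (\<beta> x b * (b \<bullet> D x u c)) *\<^sub>R ginv x c)"
      by (simp add: DT_def linear_sum[OF linear_ginv[OF x]] linear_cmul[OF linear_ginv[OF x]] scaleR_sum_right)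
    also have "\<dots> = (\<Sum>c\<in>Basis. \<Sum>b\<in>Basis. (\<beta> x b * (b \<bullet> D x u c)) *\<^sub>R ginv x c)" by (rule sum.swap)
    also have "\<dots> = (\<Sum>c\<in>Basis. \<beta> x (D x u c) *\<^sub>R ginv x c)"
    proof (intro sum.cong refl)
      fix c
      have "\<beta> x (D x u c) = (\<Sum>b\<in>Basis. (D x u c \<bullet> b) *\<^sub>R \<beta> x b)" by (rule linear_Basis_expand[OF lx])
      then show "(\<Sum>b\<in>Basis. (\<beta> x b * (b \<bullet> D x u c)) *\<^sub>R ginv x c) = \<beta> x (D x u c) *\<^sub>R ginv x c"
        by (simp add: scaleR_sum_left[symmetric] inner_commute mult.commute)
    qed
    finally show ?thesis by (simp add: scaleR_diff_left sum_subtractf)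
  qed
  define \<delta> where "\<delta> u v = pd (\<lambda>y. \<beta> y v) x u - \<beta> x (D x u v)" for u v
  have lin: "linear (\<lambda>u. \<delta> u v)" for v
    by (rule linearI) (simp_all add: \<delta>_def linear_add[OF smooth_on_linear_pd[OF sm x]]
      linear_cmul[OF smooth_on_linear_pd[OF sm x]] D_simps[OF x] linear_add[OF lx] linear_cmul[OF lx] algebra_simps)
  have "tr (pd (raise \<beta>) x) = (\<Sum>c\<in>Basis. \<Sum>b\<in>Basis. \<delta> c b * (ginv x b \<bullet> c)) - tr (D x (raise \<beta> x))"
    \<comment> \<open>The symmetry of \<open>D\<close> turns the trace of the map taking
      \<open>u\<close> to \<open>D x u (raise \<beta> x)\<close> into the trace of
      \<open>D x (raise \<beta> x)\<close>.\<close>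
    using D_sym[OF x, of _ "raise \<beta> x"]
    by (simp add: pdX tr_def \<delta>_def[symmetric] inner_diff_left sum_subtractf inner_sum_left)
  also have "(\<Sum>c\<in>Basis. \<Sum>b\<in>Basis. \<delta> c b * (ginv x b \<bullet> c)) = (\<Sum>b\<in>Basis. \<Sum>c\<in>Basis. \<delta> c b * (ginv x b \<bullet> c))"
    by (rule sum.swap)
  also have "\<dots> = (\<Sum>b\<in>Basis. \<delta> (ginv x b) b)"
  proof (intro sum.cong refl)
    fix b
    have "\<delta> (ginv x b) b = (\<Sum>c\<in>Basis. (ginv x b \<bullet> c) *\<^sub>R \<delta> c b)" by (rule linear_Basis_expand[OF lin])
    then show "(\<Sum>c\<in>Basis. \<delta> c b * (ginv x b \<bullet> c)) = \<delta> (ginv x b) b" by (simp add: mult.commute)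
  qed
  finally show ?thesis by (simp add: divg_def mtrace_def \<delta>_def)
qed

definition kap :: "'e \<Rightarrow> 'e \<Rightarrow> real" where "kap x u = tr (gam x u)"

lemma kap_linear: "x \<in> U \<Longrightarrow> linear (kap x)"
  by (rule linearI) (simp_all add: kap_def tr_def gam_simps inner_add_left sum.distrib sum_distrib_left)

lemma kap_smooth: "smooth_on (\<lambda>x. kap x v) U"
  unfolding kap_def by (intro smooth_on_tr open_U gam_smooth)

text \<open>The two terms in which \<open>D x u\<close> acts before and after \<open>gam x v\<close>
  have the same trace, so taking the trace commutes with the covariant derivative.\<close>

lemma cov_deriv_kap:
  assumes x: "x \<in> U"
  shows "pd (\<lambda>y. kap y v) x u - kap x (D x u v) = tr (dgam x u v)"
proof -
  have "tr (dgam x u v) = tr (\<lambda>w. pd (\<lambda>y. gam y v w) x u) + tr (\<lambda>w. D x u (gam x v w)) - tr (gam x (D x u v)) - tr (\<lambda>w. gam x v (D x u w))"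
    unfolding dgam_def[abs_def] tr_diff tr_add by simp
  also have "tr (\<lambda>w. D x u (gam x v w)) = tr (\<lambda>w. gam x v (D x u w))"
    by (intro tr_comp_commute bilinear_imp_linear(1) D_bil gam_bil x)
  also have "tr (\<lambda>w. pd (\<lambda>y. gam y v w) x u) = pd (\<lambda>y. kap y v) x u"
    unfolding kap_def by (rule pd_tr[symmetric]) (rule gam_diff[OF x])
  finally show ?thesis by (simp add: kap_def)
qed

end

text \<open>The Gauss equation and the vanishing Koszul form are the only local consequences of the
  hypotheses used from here on. The vector-valued trace is tested against each \<open>e\<close>
  because \<open>mtrace\<close> takes real-valued bilinear maps.\<close>

locale trace_free_pluriclosed_chart = affine_riemann_chart +
  assumes curv_gam: "x \<in> U \<Longrightarrow>
      g x (curv x u v w) z = g x (gam x u w) (gam x v z) - g x (gam x v w) (gam x u z)"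
    and mtrace_gam: "x \<in> U \<Longrightarrow> mtrace x (\<lambda>a b. gam x a b \<bullet> e) = 0"
begin

lemma sum_gam_frame:
  assumes x: "x \<in> U" and E: "orthonormal_frame (g x) E"
  shows "(\<Sum>b\<in>Basis. gam x (E b) (E b)) = 0"
proof (rule euclidean_eqI)
  fix e :: 'a
  show "(\<Sum>b\<in>Basis. gam x (E b) (E b)) \<bullet> e = 0 \<bullet> e"
    using mtrace_gam[OF x, of e] mtrace_frame[OF x E bilinear_inner[OF gam_bil[OF x]], of e]
    by (simp add: inner_sum_left)
qed

text \<open>In the traced Gauss equation the second product contains the trace of
  \<open>gam\<close>, so it drops out and a sum of definite sign remains on the diagonal.\<close>

lemma tr_curv:
  assumes x: "x \<in> U" and E: "orthonormal_frame (g x) E"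
  shows "tr (\<lambda>u. curv x u v w) = (\<Sum>b\<in>Basis. g x (gam x (E b) w) (gam x v (E b)))"
proof -
  interpret h: inner_form "g x" by (rule inner_form[OF x])
  have "linear (\<lambda>u. curv x u v w)"
    unfolding curv_dgam[OF x]
    by (rule linearI) (simp_all add: linear_add[OF dgam_linear(1)[OF x]] linear_add[OF dgam_linear(2)[OF x]]
        linear_cmul[OF dgam_linear(1)[OF x]] linear_cmul[OF dgam_linear(2)[OF x]] gam_simps[OF x] algebra_simps)
  then have "tr (\<lambda>u. curv x u v w) = (\<Sum>b\<in>Basis. g x (gam x (E b) w) (gam x v (E b)) - g x (gam x v w) (gam x (E b) (E b)))"
    by (simp add: h.tr_frame[OF E] curv_gam[OF x])
  also have "\<dots> = (\<Sum>b\<in>Basis. g x (gam x (E b) w) (gam x v (E b)))"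
    unfolding sum_subtractf h.sum_right[symmetric] sum_gam_frame[OF x E] by (simp add: g_simps[OF x])
  finally show ?thesis .
qed

lemma tr_curv_nonneg:
  assumes x: "x \<in> U" shows "0 \<le> tr (\<lambda>u. curv x u v v)"
proof -
  obtain E where E: "orthonormal_frame (g x) E"
    using inner_form.ex_orthonormal_frame[OF inner_form[OF x]] by blast
  show ?thesis unfolding tr_curv[OF x E] gam_sym[OF x, of v]
    by (intro sum_nonneg inner_form.nonneg[OF inner_form[OF x]])
qed

text \<open>The frame exists at the single point \<open>x\<close>, so the vanishing of the trace is
  differentiated in the form \<open>mtrace_gam\<close>. What is left over is \<open>D x u\<close>
  applied to the trace, which is zero again.\<close>

lemma sum_dgam_frame:
  assumes x: "x \<in> U" and E: "orthonormal_frame (g x) E"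
  shows "(\<Sum>b\<in>Basis. dgam x u (E b) (E b)) = 0"
proof (rule euclidean_eqI)
  fix e :: 'a
  let ?P = "\<lambda>a b. dgam x u a b"
  have bil: "bilinear ?P" unfolding bilinear_def using dgam_linear[OF x] by auto
  have bilD: "bilinear (\<lambda>a b. D x u (gam x a b))"
    unfolding bilinear_def by (auto intro!: linearI simp: D_simps[OF x] gam_simps[OF x])
  have B: "bilinear (\<lambda>a b. gam y a b \<bullet> e)" if "y \<in> U" for y by (intro bilinear_inner gam_bil that)
  have "pd (\<lambda>y. mtrace y (\<lambda>a b. gam y a b \<bullet> e)) x = pd (\<lambda>y. 0) x"
    by (rule pd_cong_open[OF open_U x]) (rule mtrace_gam)
  then have "0 = pd (\<lambda>y. mtrace y (\<lambda>a b. gam y a b \<bullet> e)) x u" by simp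
  also have "\<dots> = mtrace x (\<lambda>a b. pd (\<lambda>y. gam y a b \<bullet> e) x u - gam x (D x u a) b \<bullet> e - gam x a (D x u b) \<bullet> e)"
    by (rule pd_mtrace[OF x B]) (auto intro!: smooth_on_inner open_U gam_smooth)
  also have "\<dots> = mtrace x (\<lambda>a b. dgam x u a b \<bullet> e) - mtrace x (\<lambda>a b. D x u (gam x a b) \<bullet> e)"
    by (simp add: mtrace_def dgam_def pd_inner_right gam_diff[OF x] inner_diff_left inner_add_left sum_subtractf[symmetric] algebra_simps)
  also have "mtrace x (\<lambda>a b. dgam x u a b \<bullet> e) = (\<Sum>b\<in>Basis. dgam x u (E b) (E b)) \<bullet> e"
    by (simp add: mtrace_frame[OF x E bilinear_inner[OF bil]] inner_sum_left)
  also have "mtrace x (\<lambda>a b. D x u (gam x a b) \<bullet> e) = D x u (\<Sum>b\<in>Basis. gam x (E b) (E b)) \<bullet> e"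
    by (simp add: mtrace_frame[OF x E bilinear_inner[OF bilD]] inner_sum_left linear_sum[OF bilinear_imp_linear(1)[OF D_bil[OF x]]])
  finally show "(\<Sum>b\<in>Basis. dgam x u (E b) (E b)) \<bullet> e = 0 \<bullet> e"
    by (simp add: sum_gam_frame[OF x E] D_simps[OF x])
qed

text \<open>Exchanging the first two slots of \<open>dgam\<close> by \<open>curv_dgam\<close>
  produces the derivative of the vanishing trace. The Gauss equation turns the remaining curvature
  into products of \<open>gam\<close>, and those containing a trace vanish.\<close>

lemma divergence_kap:
  assumes x: "x \<in> U" and E: "orthonormal_frame (g x) E"
  shows "divg kap x =
    - (\<Sum>a\<in>Basis. \<Sum>b\<in>Basis. \<Sum>c\<in>Basis. (g x (gam x (E a) (E b)) (E c) - g x (gam x (E a) (E c)) (E b))\<^sup>2) / 2"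
proof -
  interpret h: inner_form "g x" by (rule inner_form[OF x])
  define t where "t a b c = g x (gam x (E a) (E b)) (E c)" for a b c
  let ?B = "Basis :: 'a set"
  have bil: "bilinear (\<lambda>u v. tr (dgam x u v))"
    unfolding bilinear_def tr_def
    by (auto intro!: linearI simp: linear_add[OF dgam_linear(1)[OF x]] linear_add[OF dgam_linear(2)[OF x]]
        linear_cmul[OF dgam_linear(1)[OF x]] linear_cmul[OF dgam_linear(2)[OF x]] inner_add_left
        sum.distrib sum_distrib_left)
  have "divg kap x = (\<Sum>a\<in>?B. tr (dgam x (E a) (E a)))"
    unfolding divg_def cov_deriv_kap[OF x] by (rule mtrace_frame[OF x E bil])
  also have "\<dots> = (\<Sum>a\<in>?B. \<Sum>b\<in>?B. g x (dgam x (E a) (E a) (E b)) (E b))"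
    by (simp add: h.tr_frame[OF E dgam_linear(3)[OF x]])
  also have "\<dots> = (\<Sum>a\<in>?B. \<Sum>b\<in>?B. g x (dgam x (E b) (E a) (E a)) (E b) + g x (gam x (E a) (E a)) (gam x (E b) (E b))
      - g x (gam x (E b) (E a)) (gam x (E a) (E b)) + g x (gam x (E a) (gam x (E b) (E a))) (E b)
      - g x (gam x (E b) (gam x (E a) (E a))) (E b))"
  proof (intro sum.cong refl)
    fix a b
    have "dgam x (E a) (E a) (E b) = dgam x (E b) (E a) (E a) + curv x (E a) (E b) (E a)
       + (gam x (E a) (gam x (E b) (E a)) - gam x (E b) (gam x (E a) (E a)))"
      using dgam_sym[OF x, of "E a" "E a" "E b"] by (simp add: curv_dgam[OF x])
    then show "g x (dgam x (E a) (E a) (E b)) (E b) = g x (dgam x (E b) (E a) (E a)) (E b) + g x (gam x (E a) (E a)) (gam x (E b) (E b))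
      - g x (gam x (E b) (E a)) (gam x (E a) (E b)) + g x (gam x (E a) (gam x (E b) (E a))) (E b)
      - g x (gam x (E b) (gam x (E a) (E a))) (E b)"
      by (simp add: g_simps[OF x] curv_gam[OF x])
  qed
  also have "\<dots> = (\<Sum>a\<in>?B. \<Sum>b\<in>?B. g x (gam x (E a) (gam x (E b) (E a))) (E b) - g x (gam x (E b) (E a)) (gam x (E a) (E b)))"
  proof -
    have "(\<Sum>a\<in>?B. \<Sum>b\<in>?B. g x (dgam x (E b) (E a) (E a)) (E b)) = 0"
      by (subst sum.swap) (simp add: h.sum_left[symmetric] sum_dgam_frame[OF x E] g_simps[OF x])
    moreover have "(\<Sum>a\<in>?B. \<Sum>b\<in>?B. g x (gam x (E a) (E a)) (gam x (E b) (E b))) = 0"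
      by (simp add: h.sum_right[symmetric] sum_gam_frame[OF x E] g_simps[OF x])
    moreover have "(\<Sum>a\<in>?B. \<Sum>b\<in>?B. g x (gam x (E b) (gam x (E a) (E a))) (E b)) = 0"
      by (subst sum.swap) (simp add: h.sum_left[symmetric] linear_sum[OF bilinear_imp_linear(1)[OF gam_bil[OF x]], symmetric]
          sum_gam_frame[OF x E] g_simps[OF x] gam_simps[OF x])
    ultimately show ?thesis by (simp add: sum.distrib sum_subtractf)
  qed
  also have "\<dots> = (\<Sum>a\<in>?B. \<Sum>b\<in>?B. \<Sum>c\<in>?B. t a b c * t a c b - t a b c * t a b c)"
  proof (intro sum.cong refl)
    fix a b assume "a \<in> ?B" "b \<in> ?B"
    have "gam x (E a) (E b) = (\<Sum>c\<in>?B. t a b c *\<^sub>R E c)" unfolding t_def by (rule h.frame_expand[OF E])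
    then have "gam x (E a) (gam x (E a) (E b)) = (\<Sum>c\<in>?B. t a b c *\<^sub>R gam x (E a) (E c))"
      by (simp add: linear_sum[OF bilinear_imp_linear(1)[OF gam_bil[OF x]]] gam_simps[OF x])
    then have "g x (gam x (E a) (gam x (E b) (E a))) (E b) = (\<Sum>c\<in>?B. t a b c * t a c b)"
      by (simp add: gam_sym[OF x, of "E b" "E a"] h.sum_left g_simps[OF x] t_def)
    moreover have "g x (gam x (E b) (E a)) (gam x (E a) (E b)) = (\<Sum>c\<in>?B. t a b c * t a b c)"
      unfolding gam_sym[OF x, of "E b" "E a"] t_def by (rule h.h_frame[OF E])
    ultimately show "g x (gam x (E a) (gam x (E b) (E a))) (E b) - g x (gam x (E b) (E a)) (gam x (E a) (E b)) =
      (\<Sum>c\<in>?B. t a b c * t a c b - t a b c * t a b c)"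
      by (simp add: sum_subtractf)
  qed
  also have "\<dots> = - (\<Sum>a\<in>?B. \<Sum>b\<in>?B. \<Sum>c\<in>?B. (t a b c - t a c b)\<^sup>2) / 2"
  proof -
    \<comment> \<open>Renaming the indices \<open>b\<close> and \<open>c\<close> shows that the two
      squares contribute equally, which completes the square.\<close>
    have "(\<Sum>b\<in>?B. \<Sum>c\<in>?B. (t a b c - t a c b)\<^sup>2) = - 2 * (\<Sum>b\<in>?B. \<Sum>c\<in>?B. t a b c * t a c b - t a b c * t a b c)" for a
    proof -
      have "(\<Sum>b\<in>?B. \<Sum>c\<in>?B. t a c b * t a c b) = (\<Sum>b\<in>?B. \<Sum>c\<in>?B. t a b c * t a b c)" by (rule sum.swap)
      then show ?thesis
        by (simp add: power2_eq_square algebra_simps sum.distrib sum_subtractf sum_distrib_left sum_negf)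
    qed
    then show ?thesis by (simp add: sum_distrib_left[symmetric] sum_negf)
  qed
  finally show ?thesis by (simp add: t_def)
qed

end

section \<open>A Bochner formula for Hessian metrics\<close>

context affine_riemann_chart
begin

definition ddgam :: "'e \<Rightarrow> 'e \<Rightarrow> 'e \<Rightarrow> 'e \<Rightarrow> 'e \<Rightarrow> 'e" where
  "ddgam x a u v w = pd (\<lambda>y. dgam y u v w) x a + D x a (dgam x u v w)
     - dgam x (D x a u) v w - dgam x u (D x a v) w - dgam x u v (D x a w)"

lemmas dgam_diff = smooth_on_differentiable[OF dgam_smooth]

context
  fixes x assumes x: "x \<in> U"
begin

lemmas dgam_add = linear_add[OF dgam_linear(1)[OF x]] linear_add[OF dgam_linear(2)[OF x]] linear_add[OF dgam_linear(3)[OF x]]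
lemmas dgam_cmul = linear_cmul[OF dgam_linear(1)[OF x]] linear_cmul[OF dgam_linear(2)[OF x]] linear_cmul[OF dgam_linear(3)[OF x]]

lemma pd_dgam_linear:
  "linear (\<lambda>u. pd (\<lambda>y. dgam y u v w) x a)"
  "linear (\<lambda>v. pd (\<lambda>y. dgam y u v w) x a)"
  "linear (\<lambda>w. pd (\<lambda>y. dgam y u v w) x a)"
  by (rule linear_pd_field[OF open_U x, where L = "\<lambda>y u. dgam y u v w"], erule dgam_linear, rule dgam_diff[OF x])
    (rule linear_pd_field[OF open_U x, where L = "\<lambda>y v. dgam y u v w"], erule dgam_linear, rule dgam_diff[OF x],
     rule linear_pd_field[OF open_U x, where L = "\<lambda>y w. dgam y u v w"], erule dgam_linear, rule dgam_diff[OF x])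

lemma ddgam_linear:
  "linear (\<lambda>a. ddgam x a u v w)" "linear (\<lambda>u. ddgam x a u v w)"
  "linear (\<lambda>v. ddgam x a u v w)" "linear (\<lambda>w. ddgam x a u v w)"
proof -
  note l = dgam_add dgam_cmul D_simps[OF x] pd_dgam_linear[THEN linear_add] pd_dgam_linear[THEN linear_cmul]
    linear_add[OF smooth_on_linear_pd[OF dgam_smooth x]] linear_cmul[OF smooth_on_linear_pd[OF dgam_smooth x]]
  show "linear (\<lambda>a. ddgam x a u v w)" by (rule linearI) (simp_all add: ddgam_def l algebra_simps)
  show "linear (\<lambda>u. ddgam x a u v w)" by (rule linearI) (simp_all add: ddgam_def l algebra_simps)
  show "linear (\<lambda>v. ddgam x a u v w)" by (rule linearI) (simp_all add: ddgam_def l algebra_simps)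
  show "linear (\<lambda>w. ddgam x a u v w)" by (rule linearI) (simp_all add: ddgam_def l algebra_simps)
qed

lemma pd_dgam:
  "pd (\<lambda>y. dgam y u v w) x a = pd (\<lambda>y. pd (\<lambda>y. gam y v w) y u) x a
    + (pd (\<lambda>y. D y u (gam x v w)) x a + D x u (pd (\<lambda>y. gam y v w) x a))
    - (pd (\<lambda>y. gam y (D x u v) w) x a + gam x (pd (\<lambda>y. D y u v) x a) w)
    - (pd (\<lambda>y. gam y v (D x u w)) x a + gam x v (pd (\<lambda>y. D y u w) x a))"
proof -
  have s: "smooth_on (\<lambda>y. pd (\<lambda>y. gam y v w) y u) U" "smooth_on (\<lambda>y. D y u (gam y v w)) U"
    "smooth_on (\<lambda>y. gam y (D y u v) w) U" "smooth_on (\<lambda>y. gam y v (D y u w)) U"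
    by (intro smooth_on_pd gam_smooth D_smooth_field gam_smooth_field D_smooth smooth_on_const)+
  note d = s[THEN smooth_on_differentiable, OF x]
  have "pd (\<lambda>y. dgam y u v w) x a = pd (\<lambda>y. pd (\<lambda>y. gam y v w) y u) x a + pd (\<lambda>y. D y u (gam y v w)) x a
      - pd (\<lambda>y. gam y (D y u v) w) x a - pd (\<lambda>y. gam y v (D y u w)) x a"
    unfolding dgam_def by (simp only: pd_diff pd_add d differentiable_add differentiable_diff)
  moreover have "pd (\<lambda>y. D y u (gam y v w)) x a = pd (\<lambda>y. D y u (gam x v w)) x a + D x u (pd (\<lambda>y. gam y v w) x a)"
    using pd_D_field[OF smooth_on_const gam_smooth x] by (simp add: D_simps[OF x])
  moreover have "pd (\<lambda>y. gam y (D y u v) w) x a = pd (\<lambda>y. gam y (D x u v) w) x a + gam x (pd (\<lambda>y. D y u v) x a) w"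
    using pd_gam_field[OF D_smooth smooth_on_const x] by (simp add: gam_simps[OF x])
  moreover have "pd (\<lambda>y. gam y v (D y u w)) x a = pd (\<lambda>y. gam y v (D x u w)) x a + gam x v (pd (\<lambda>y. D y u w) x a)"
    using pd_gam_field[OF smooth_on_const D_smooth x] by (simp add: gam_simps[OF x])
  ultimately show ?thesis by simp
qed

text \<open>The Ricci identity: second partial derivatives of \<open>gam\<close> commute, so only
  the curvature acting on the value and on both arguments survives.\<close>

lemma ddgam_commute:
  "ddgam x a u v w - ddgam x u a v w =
    curv x a u (gam x v w) - gam x (curv x a u v) w - gam x v (curv x a u w)"
  using pd_pd_commute[OF open_U x gam_smooth, of v w a u] D_sym[OF x, of u a]
  unfolding ddgam_def pd_dgam curv_def
  by (simp add: dgam_def D_simps[OF x] gam_simps[OF x] algebra_simps)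

end

section \<open>The trace form of gamma and the Hessian of its trace\<close>

definition rho :: "'e \<Rightarrow> 'e \<Rightarrow> 'e \<Rightarrow> real" where
  "rho x a b = tr (\<lambda>w. gam x a (gam x b w))"

text \<open>When each \<open>gam x a\<close> is self-adjoint, \<open>rho\<close> is the Ricci tensor
  by \<open>tr_curv\<close> and \<open>scal\<close> is the squared norm of \<open>gam\<close>. The
  trace formula is preferred because it needs neither a frame nor self-adjointness to be
  differentiated.\<close>

definition scal :: "'e \<Rightarrow> real" where "scal x = mtrace x (rho x)"

lemma rho_bil: "x \<in> U \<Longrightarrow> bilinear (rho x)"
  unfolding bilinear_def rho_def tr_def
  by (auto intro!: linearI simp: gam_simps inner_add_left sum.distrib sum_distrib_left)

lemma rho_smooth: "smooth_on (\<lambda>x. rho x a b) U"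
  unfolding rho_def by (intro smooth_on_tr open_U gam_smooth_field gam_smooth smooth_on_const)

lemma scal_smooth: "smooth_on scal U"
  unfolding scal_def[abs_def] by (rule mtrace_smooth[OF rho_bil rho_smooth])

text \<open>One of the two terms that the product rule yields for the covariant derivative of
  \<open>rho\<close>; the other has \<open>a\<close> and \<open>b\<close> exchanged.\<close>

definition sig :: "'e \<Rightarrow> 'e \<Rightarrow> 'e \<Rightarrow> 'e \<Rightarrow> real" where
  "sig x u a b = tr (\<lambda>w. dgam x u a (gam x b w))"

lemma sig_bil: assumes x: "x \<in> U" shows "bilinear (sig x u)"
  unfolding bilinear_def sig_def tr_def
  by (auto intro!: linearI simp: dgam_add[OF x] dgam_cmul[OF x] gam_simps[OF x] inner_add_left sum.distrib sum_distrib_left)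

lemma dgam_gam_smooth: "smooth_on (\<lambda>y. dgam y u a (gam y b w)) U"
  by (rule smooth_on_field[OF open_U dgam_linear(3) dgam_smooth gam_smooth])

lemma sig_smooth: "smooth_on (\<lambda>x. sig x u a b) U"
  unfolding sig_def by (intro smooth_on_tr open_U dgam_gam_smooth)

lemma cov_deriv_rho:
  assumes x: "x \<in> U"
  shows "pd (\<lambda>y. rho y a b) x u - rho x (D x u a) b - rho x a (D x u b) = sig x u a b + sig x u b a"
proof -
  have "pd (\<lambda>y. gam y a (gam y b w)) x u = pd (\<lambda>y. gam y a (gam x b w)) x u + gam x a (pd (\<lambda>y. gam y b w) x u)" for w
    using pd_gam_field[OF smooth_on_const gam_smooth x] by (simp add: gam_simps[OF x])
  then have 1: "pd (\<lambda>y. rho y a b) x u = tr (\<lambda>w. pd (\<lambda>y. gam y a (gam x b w)) x u + gam x a (pd (\<lambda>y. gam y b w) x u))"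
    unfolding rho_def
    by (subst pd_tr) (auto intro!: smooth_on_differentiable[OF gam_smooth_field x] gam_smooth)
  have "sig x u b a = tr (\<lambda>w. gam x a (dgam x u b w))"
    unfolding sig_def by (intro tr_comp_commute dgam_linear(3) bilinear_imp_linear(1) gam_bil x)
  then have "sig x u a b + sig x u b a = tr (\<lambda>w. dgam x u a (gam x b w) + gam x a (dgam x u b w))"
    by (simp add: sig_def tr_add)
  \<comment> \<open>The terms of \<open>dgam\<close> are regrouped so that the last bracket is the
    commutator of \<open>D x u\<close> with a product of two \<open>gam\<close>; its trace is
    zero.\<close>
  also have "\<dots> = tr (\<lambda>w. pd (\<lambda>y. gam y a (gam x b w)) x u + gam x a (pd (\<lambda>y. gam y b w) x u)
      - gam x (D x u a) (gam x b w) - gam x a (gam x (D x u b) w)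
      + (D x u (gam x a (gam x b w)) - gam x a (gam x b (D x u w))))"
    by (rule arg_cong[where f = tr]) (simp add: dgam_def gam_simps[OF x] fun_eq_iff algebra_simps)
  also have "\<dots> = pd (\<lambda>y. rho y a b) x u - rho x (D x u a) b - rho x a (D x u b)
     + (tr (\<lambda>w. D x u (gam x a (gam x b w))) - tr (\<lambda>w. gam x a (gam x b (D x u w))))"
    unfolding 1 by (simp add: rho_def tr_add tr_diff)
  also have "tr (\<lambda>w. D x u (gam x a (gam x b w))) = tr (\<lambda>w. gam x a (gam x b (D x u w)))"
    by (rule tr_comp_commute[where B = "\<lambda>w. gam x a (gam x b w)", OF bilinear_imp_linear(1)[OF D_bil[OF x]]])
      (auto intro!: linearI simp: gam_simps[OF x])
  finally show ?thesis by simp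
qed

text \<open>The two terms of the product rule have the same metric trace, whence the factor
  2.\<close>

lemma pd_scal:
  assumes x: "x \<in> U"
  shows "pd scal x u = 2 * mtrace x (sig x u)"
proof -
  obtain E where E: "orthonormal_frame (g x) E"
    using inner_form.ex_orthonormal_frame[OF inner_form[OF x]] by blast
  have bil: "bilinear (\<lambda>a b. sig x u a b + sig x u b a)"
    using sig_bil[OF x, of u] unfolding bilinear_def by (auto intro!: linear_compose_add)
  have "pd scal x u = mtrace x (\<lambda>a b. pd (\<lambda>y. rho y a b) x u - rho x (D x u a) b - rho x a (D x u b))"
    unfolding scal_def[abs_def] by (rule pd_mtrace[OF x rho_bil rho_smooth])
  then have "pd scal x u = mtrace x (\<lambda>a b. sig x u a b + sig x u b a)"
    unfolding cov_deriv_rho[OF x] .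
  then show ?thesis
    by (simp add: mtrace_frame[OF x E bil] mtrace_frame[OF x E sig_bil[OF x]] sum_distrib_left)
qed

lemma cov_deriv_sig:
  assumes x: "x \<in> U"
  shows "pd (\<lambda>y. sig y u a b) x z - sig x u (D x z a) b - sig x u a (D x z b) - sig x (D x z u) a b =
    tr (\<lambda>w. ddgam x z u a (gam x b w)) + tr (\<lambda>w. dgam x u a (dgam x z b w))"
proof -
  have "pd (\<lambda>y. dgam y u a (gam y b w)) x z = pd (\<lambda>y. dgam y u a (gam x b w)) x z + dgam x u a (pd (\<lambda>y. gam y b w) x z)" for w
    by (rule pd_field[OF open_U x dgam_linear(3) dgam_diff[OF x] gam_diff[OF x]])
  then have 1: "pd (\<lambda>y. sig y u a b) x z = tr (\<lambda>w. pd (\<lambda>y. dgam y u a (gam x b w)) x z + dgam x u a (pd (\<lambda>y. gam y b w) x z))"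
    unfolding sig_def by (subst pd_tr) (auto intro!: smooth_on_differentiable[OF dgam_gam_smooth x])
  have "tr (\<lambda>w. ddgam x z u a (gam x b w)) + tr (\<lambda>w. dgam x u a (dgam x z b w))
     = tr (\<lambda>w. pd (\<lambda>y. dgam y u a (gam x b w)) x z + dgam x u a (pd (\<lambda>y. gam y b w) x z)
         - dgam x u (D x z a) (gam x b w) - dgam x u a (gam x (D x z b) w) - dgam x (D x z u) a (gam x b w)
         + (D x z (dgam x u a (gam x b w)) - dgam x u a (gam x b (D x z w))))"
    unfolding tr_add[symmetric]
    by (rule arg_cong[where f = tr])
      (simp add: ddgam_def dgam_def[of x z b] dgam_add[OF x] linear_diff[OF dgam_linear(3)[OF x]] fun_eq_iff algebra_simps)
  also have "\<dots> = pd (\<lambda>y. sig y u a b) x z - sig x u (D x z a) b - sig x u a (D x z b) - sig x (D x z u) a b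
     + (tr (\<lambda>w. D x z (dgam x u a (gam x b w))) - tr (\<lambda>w. dgam x u a (gam x b (D x z w))))"
    unfolding 1 by (simp add: sig_def tr_add tr_diff)
  also have "tr (\<lambda>w. D x z (dgam x u a (gam x b w))) = tr (\<lambda>w. dgam x u a (gam x b (D x z w)))"
    by (rule tr_comp_commute[where B = "\<lambda>w. dgam x u a (gam x b w)", OF bilinear_imp_linear(1)[OF D_bil[OF x]]])
      (auto intro!: linearI simp: dgam_add[OF x] dgam_cmul[OF x] gam_simps[OF x])
  finally show ?thesis by simp
qed

lemma hess_scal:
  assumes x: "x \<in> U"
  shows "pd (\<lambda>y. pd scal y u) x z - pd scal x (D x z u) =
    2 * mtrace x (\<lambda>a b. tr (\<lambda>w. ddgam x z u a (gam x b w)) + tr (\<lambda>w. dgam x u a (dgam x z b w)))"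
proof -
  have "pd (\<lambda>y. pd scal y u) x z = pd (\<lambda>y. 2 *\<^sub>R mtrace y (sig y u)) x z"
    by (rule fun_cong[OF pd_cong_open[OF open_U x]]) (simp add: pd_scal)
  also have "\<dots> = 2 * pd (\<lambda>y. mtrace y (sig y u)) x z"
    by (subst pd_scaleR) (auto intro!: smooth_on_differentiable[OF mtrace_smooth x] sig_bil sig_smooth)
  also have "pd (\<lambda>y. mtrace y (sig y u)) x z = mtrace x (\<lambda>a b. pd (\<lambda>y. sig y u a b) x z - sig x u (D x z a) b - sig x u a (D x z b))"
    by (rule pd_mtrace[OF x sig_bil sig_smooth])
  finally show ?thesis
    unfolding cov_deriv_sig[OF x, symmetric]
    by (simp add: pd_scal[OF x] mtrace_def sum_subtractf right_diff_distrib)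
qed

end

text \<open>Self-adjointness together with the symmetry of \<open>gam\<close> makes the cubic form
  \<open>g x (gam x a b) c\<close> totally symmetric. Equivalently \<open>tor\<close> vanishes, the
  Codazzi condition that characterises Hessian metrics.\<close>

locale hessian_chart = trace_free_pluriclosed_chart +
  assumes gam_self_adjoint: "x \<in> U \<Longrightarrow> g x (gam x a b) c = g x b (gam x a c)"
begin

context
  fixes x assumes x: "x \<in> U"
begin

interpretation h: inner_form "g x" by (rule inner_form[OF x])

lemma curv_commutator: "curv x u v w = gam x v (gam x u w) - gam x u (gam x v w)"
  by (rule h.eqI) (simp add: curv_gam[OF x] g_simps[OF x] gam_self_adjoint[OF x])

text \<open>The Gauss equation makes the curvature exactly the commutator that occurs in
  \<open>curv_dgam\<close>, so the skew part of \<open>dgam\<close> must vanish.\<close>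

lemma dgam_sym1: "dgam x u v w = dgam x v u w"
  using curv_dgam[OF x, of u v w] by (simp add: curv_commutator)

text \<open>Self-adjointness of \<open>gam\<close> holds throughout the chart and may be
  differentiated; the metric is parallel.\<close>

lemma dgam_self_adjoint: "g x (dgam x u v w) z = g x w (dgam x u v z)"
proof -
  have 1: "pd (\<lambda>y. g y (gam y v w) z) x u = g x (D x u (gam x v w)) z + g x (gam x v w) (D x u z) + g x (pd (\<lambda>y. gam y v w) x u) z" for w z
    using pd_g_field[OF gam_smooth smooth_on_const x] by (simp add: D_metric[OF x] g_simps[OF x])
  have "pd (\<lambda>y. g y (gam y v w) z) x = pd (\<lambda>y. g y (gam y v z) w) x"
    by (rule pd_cong_open[OF open_U x]) (metis gam_self_adjoint g_sym)
  then have "pd (\<lambda>y. g y (gam y v w) z) x u = pd (\<lambda>y. g y (gam y v z) w) x u" by simp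
  then show ?thesis unfolding 1 dgam_def
    using g_sym[OF x, of w] g_sym[OF x, of z] g_sym[OF x, of "D x u w"] g_sym[OF x, of "D x u z"] 
      gam_self_adjoint[OF x, of v "D x u w" z] gam_self_adjoint[OF x, of v "D x u z" w]
      gam_self_adjoint[OF x, of "D x u v" w z]
    by (simp add: g_simps[OF x])
qed

end

text \<open>The context is opened anew so that the preceding symmetries hold at every point of the
  chart: the next lemmas differentiate them.\<close>

context
  fixes x assumes x: "x \<in> U"
begin

interpretation h: inner_form "g x" by (rule inner_form[OF x])

lemma ddgam_sym1: "ddgam x a u v w = ddgam x a v u w"
proof -
  have "pd (\<lambda>y. dgam y u v w) x = pd (\<lambda>y. dgam y v u w) x"
    by (rule pd_cong_open[OF open_U x]) (rule dgam_sym1)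
  then show ?thesis
    using dgam_sym1[OF x, of u v] dgam_sym1[OF x, of "D x a u"] dgam_sym1[OF x, of u "D x a v"]
    by (simp add: ddgam_def)
qed

lemma ddgam_sym2: "ddgam x a u v w = ddgam x a u w v"
proof -
  have "pd (\<lambda>y. dgam y u v w) x = pd (\<lambda>y. dgam y u w v) x"
    by (rule pd_cong_open[OF open_U x]) (rule dgam_sym)
  then show ?thesis
    using dgam_sym[OF x, of _ v w] dgam_sym[OF x, of u "D x a v"] dgam_sym[OF x, of u v "D x a w"]
    by (simp add: ddgam_def)
qed

context
  fixes E assumes E: "orthonormal_frame (g x) E"
begin

lemma sum_ddgam_frame0: "(\<Sum>b\<in>Basis. ddgam x a u (E b) (E b)) = 0"
proof (rule euclidean_eqI)
  fix e :: 'a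
  have bil: "bilinear (\<lambda>p q. ddgam x a u p q)" unfolding bilinear_def using ddgam_linear[OF x] by auto
  have bilP: "bilinear (\<lambda>p q. dgam y u p q)" if "y \<in> U" for y u
    unfolding bilinear_def using dgam_linear[OF that] by auto
  have bilD: "bilinear (\<lambda>p q. D x a (dgam x u p q))"
    unfolding bilinear_def by (auto intro!: linearI simp: D_simps[OF x] dgam_add[OF x] dgam_cmul[OF x])
  have B: "bilinear (\<lambda>p q. dgam y u p q \<bullet> e)" if "y \<in> U" for y u by (intro bilinear_inner bilP that)
  have m0: "mtrace y (\<lambda>p q. dgam y u p q \<bullet> e) = 0" if y: "y \<in> U" for y u
  proof -
    obtain F where F: "orthonormal_frame (g y) F"
      using inner_form.ex_orthonormal_frame[OF inner_form[OF y]] by blast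
    show ?thesis using mtrace_frame[OF y F B[OF y]] sum_dgam_frame[OF y F]
      by (simp add: inner_sum_left[symmetric])
  qed
  have "pd (\<lambda>y. mtrace y (\<lambda>p q. dgam y u p q \<bullet> e)) x = pd (\<lambda>y. 0) x"
    by (rule pd_cong_open[OF open_U x]) (rule m0)
  then have "0 = pd (\<lambda>y. mtrace y (\<lambda>p q. dgam y u p q \<bullet> e)) x a" by simp
  also have "\<dots> = mtrace x (\<lambda>p q. pd (\<lambda>y. dgam y u p q \<bullet> e) x a - dgam x u (D x a p) q \<bullet> e - dgam x u p (D x a q) \<bullet> e)"
    by (rule pd_mtrace[OF x B]) (auto intro!: smooth_on_inner open_U dgam_smooth)
  also have "\<dots> = mtrace x (\<lambda>p q. ddgam x a u p q \<bullet> e) - mtrace x (\<lambda>p q. D x a (dgam x u p q) \<bullet> e)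
      + mtrace x (\<lambda>p q. dgam x (D x a u) p q \<bullet> e)"
    by (simp add: mtrace_def ddgam_def pd_inner_right dgam_diff[OF x] inner_diff_left inner_add_left
        sum_subtractf[symmetric] sum.distrib[symmetric] algebra_simps)
  also have "mtrace x (\<lambda>p q. ddgam x a u p q \<bullet> e) = (\<Sum>b\<in>Basis. ddgam x a u (E b) (E b)) \<bullet> e"
    by (simp add: mtrace_frame[OF x E bilinear_inner[OF bil]] inner_sum_left)
  also have "mtrace x (\<lambda>p q. D x a (dgam x u p q) \<bullet> e) = D x a (\<Sum>b\<in>Basis. dgam x u (E b) (E b)) \<bullet> e"
    by (simp add: mtrace_frame[OF x E bilinear_inner[OF bilD]] inner_sum_left linear_sum[OF bilinear_imp_linear(1)[OF D_bil[OF x]]])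
  finally show "(\<Sum>b\<in>Basis. ddgam x a u (E b) (E b)) \<bullet> e = 0 \<bullet> e"
    by (simp add: sum_dgam_frame[OF x E] m0[OF x] D_simps[OF x])
qed

text \<open>A formula for the rough Laplacian of \<open>gam\<close>. Total symmetry of
  \<open>dgam\<close> and one commutation of derivatives move the repeated index into the trace
  slots, where the sum vanishes, so the Laplacian equals the curvature terms, which are cubic in
  \<open>gam\<close>.\<close>

lemma sum_ddgam_frame:
  "(\<Sum>c\<in>Basis. ddgam x (E c) (E c) a w) =
   (\<Sum>c\<in>Basis. gam x a (gam x (E c) (gam x (E c) w)) - 2 *\<^sub>R gam x (E c) (gam x a (gam x (E c) w))
     + gam x (E c) (gam x (E c) (gam x a w)) + gam x (gam x (E c) (gam x (E c) a)) w)"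
proof -
  have 1: "ddgam x (E c) (E c) a w = ddgam x a w (E c) (E c)
     + (gam x a (gam x (E c) (gam x (E c) w)) - 2 *\<^sub>R gam x (E c) (gam x a (gam x (E c) w))
     + gam x (E c) (gam x (E c) (gam x a w)) + gam x (gam x (E c) (gam x (E c) a)) w)
     - gam x (gam x a (gam x (E c) (E c))) w" for c
  proof -
    have "ddgam x (E c) (E c) a w = ddgam x (E c) a (E c) w" by (rule ddgam_sym1)
    \<comment> \<open>This is the only exchange of two differentiations, hence the only place where
      curvature enters.\<close>
    also have "\<dots> = ddgam x a (E c) (E c) w + (curv x (E c) a (gam x (E c) w)
        - gam x (curv x (E c) a (E c)) w - gam x (E c) (curv x (E c) a w))"
      using ddgam_commute[OF x, of "E c" a "E c" w] by (simp add: algebra_simps)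
    also have "ddgam x a (E c) (E c) w = ddgam x a w (E c) (E c)"
      using ddgam_sym2[of a "E c" "E c" w] ddgam_sym1[of a "E c" w "E c"] by simp
    finally show ?thesis
      using gam_sym[OF x, of a "E c"]
      by (simp add: curv_commutator[OF x] gam_simps[OF x] algebra_simps scaleR_2)
  qed
  have "(\<Sum>c\<in>Basis. gam x (gam x a (gam x (E c) (E c))) w) = gam x (gam x a (\<Sum>c\<in>Basis. gam x (E c) (E c))) w"
    by (simp add: linear_sum[OF bilinear_imp_linear(1)[OF gam_bil[OF x]]] linear_sum[OF bilinear_imp_linear(2)[OF gam_bil[OF x]]])
  also have "\<dots> = 0" by (simp add: sum_gam_frame[OF x E] gam_simps[OF x])
  finally have 2: "(\<Sum>c\<in>Basis. gam x (gam x a (gam x (E c) (E c))) w) = 0" .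
  show ?thesis unfolding 1 sum.distrib[of "\<lambda>c. ddgam x a w (E c) (E c)"] sum_subtractf[of _ "\<lambda>c. gam x (gam x a (gam x (E c) (E c))) w"]
    by (simp add: 2 sum_ddgam_frame0 del: sum_subtractf)
qed

lemma rho_frame: "rho x a b = (\<Sum>c\<in>Basis. g x (gam x a (E c)) (gam x b (E c)))"
proof -
  have "linear (\<lambda>w. gam x a (gam x b w))" by (rule linearI) (simp_all add: gam_simps[OF x])
  then show ?thesis
    using g_sym[OF x] by (simp add: rho_def h.tr_frame[OF E] gam_self_adjoint[OF x])
qed

text \<open>By self-adjointness and cyclicity of the trace the expression is the squared norm of the
  commutator of \<open>gam x c\<close> and \<open>gam x a\<close>.\<close>

lemma commutator_nonneg:
  "0 \<le> tr (\<lambda>w. gam x a (gam x c (gam x c (gam x a w)))) - 2 * tr (\<lambda>w. gam x c (gam x a (gam x c (gam x a w))))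
     + tr (\<lambda>w. gam x c (gam x c (gam x a (gam x a w))))"
proof -
  have lin: "linear (\<lambda>w. gam x p (gam x q (gam x r (gam x s w))))" "linear (\<lambda>w. gam x p (gam x q (gam x r w)))" for p q r s
    by (rule linearI; simp add: gam_simps[OF x])+
  have "tr (\<lambda>w. gam x c (gam x c (gam x a (gam x a w)))) = tr (\<lambda>w. gam x c (gam x a (gam x a (gam x c w))))"
    by (rule tr_comp_commute[OF bilinear_imp_linear(1)[OF gam_bil[OF x]] lin(2)])
  moreover have "g x (gam x c (gam x a w) - gam x a (gam x c w)) (gam x c (gam x a w) - gam x a (gam x c w)) =
     g x (gam x a (gam x c (gam x c (gam x a w)))) w - 2 * g x (gam x c (gam x a (gam x c (gam x a w)))) w
     + g x (gam x c (gam x a (gam x a (gam x c w)))) w" for w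
    using g_sym[OF x, of "gam x a (gam x c w)" "gam x c (gam x a w)"]
    by (simp add: gam_self_adjoint[OF x] g_simps[OF x])
  then have "(\<Sum>b\<in>Basis. g x (gam x c (gam x a (E b)) - gam x a (gam x c (E b))) (gam x c (gam x a (E b)) - gam x a (gam x c (E b))))
      = tr (\<lambda>w. gam x a (gam x c (gam x c (gam x a w)))) - 2 * tr (\<lambda>w. gam x c (gam x a (gam x c (gam x a w))))
       + tr (\<lambda>w. gam x c (gam x a (gam x a (gam x c w))))"
    by (simp add: h.tr_frame[OF E lin(1)] sum.distrib sum_subtractf sum_distrib_left)
  moreover have "0 \<le> (\<Sum>b\<in>Basis. g x (gam x c (gam x a (E b)) - gam x a (gam x c (E b))) (gam x c (gam x a (E b)) - gam x a (gam x c (E b))))"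
    by (intro sum_nonneg h.nonneg)
  ultimately show ?thesis by simp
qed

text \<open>The vector \<open>n\<close> in the proof represents the form \<open>rho x (E a)\<close>,
  so inserting it into \<open>rho\<close> gives the squares of the components.\<close>

lemma sum_rho_square:
  "(\<Sum>a\<in>Basis. \<Sum>c\<in>Basis. rho x (gam x (E c) (gam x (E c) (E a))) (E a)) = (\<Sum>a\<in>Basis. \<Sum>b\<in>Basis. (rho x (E a) (E b))\<^sup>2)"
proof (rule sum.cong[OF refl])
  fix a :: 'a
  define n where "n = (\<Sum>c\<in>Basis. gam x (E c) (gam x (E c) (E a)))"
  have "g x n (E b) = rho x (E a) (E b)" for b
    unfolding rho_frame n_def h.sum_left
    using gam_sym[OF x, of "E _" "E a"] gam_sym[OF x, of "E _" "E b"] by (simp add: gam_self_adjoint[OF x])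
  then have n: "n = (\<Sum>b\<in>Basis. rho x (E a) (E b) *\<^sub>R E b)" using h.frame_expand[OF E, of n] by simp
  have "(\<Sum>c\<in>Basis. rho x (gam x (E c) (gam x (E c) (E a))) (E a)) = rho x n (E a)"
    unfolding n_def by (rule linear_sum[OF bilinear_imp_linear(2)[OF rho_bil[OF x]], symmetric])
  also have "\<dots> = (\<Sum>b\<in>Basis. rho x (E a) (E b) * rho x (E b) (E a))"
    unfolding n by (simp add: linear_sum[OF bilinear_imp_linear(2)[OF rho_bil[OF x]]] bilinear_lmul[OF rho_bil[OF x]])
  also have "\<dots> = (\<Sum>b\<in>Basis. (rho x (E a) (E b))\<^sup>2)"
    using g_sym[OF x] by (simp add: rho_frame power2_eq_square)
  finally show "(\<Sum>c\<in>Basis. rho x (gam x (E c) (gam x (E c) (E a))) (E a)) = (\<Sum>b\<in>Basis. (rho x (E a) (E b))\<^sup>2)" .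
qed

lemma laplacian_scal:
  "2 * (\<Sum>a\<in>Basis. \<Sum>b\<in>Basis. (rho x (E a) (E b))\<^sup>2) \<le> divg (pd scal) x"
proof -
  let ?B = "Basis :: 'a set"
  let ?k = "\<lambda>a c. tr (\<lambda>w. gam x a (gam x c (gam x c (gam x a w))))
      - 2 * tr (\<lambda>w. gam x c (gam x a (gam x c (gam x a w))))
      + tr (\<lambda>w. gam x c (gam x c (gam x a (gam x a w))))"
  define T where "T z u a b = tr (\<lambda>w. ddgam x z u a (gam x b w)) + tr (\<lambda>w. dgam x u a (dgam x z b w))" for z u a b
  note l = dgam_add[OF x] dgam_cmul[OF x] gam_simps[OF x] inner_add_left sum.distrib sum_distrib_left
    ddgam_linear[OF x, THEN linear_add] ddgam_linear[OF x, THEN linear_cmul] algebra_simps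
  have T1: "bilinear (T z u)" for z u
    unfolding bilinear_def T_def tr_def by (auto intro!: linearI simp: l)
  have T2: "bilinear (\<lambda>z u. T z u a b)" for a b
    unfolding bilinear_def T_def tr_def by (auto intro!: linearI simp: l)
  have bil: "bilinear (\<lambda>z u. 2 * mtrace x (T z u))"
    unfolding bilinear_def mtrace_def
    by (auto intro!: linearI simp: bilinear_ladd[OF T2] bilinear_radd[OF T2] bilinear_lmul[OF T2] bilinear_rmul[OF T2]
        sum.distrib sum_distrib_left algebra_simps)
  have "divg (pd scal) x = (\<Sum>c\<in>?B. 2 * mtrace x (T (E c) (E c)))"
    unfolding divg_def hess_scal[OF x] T_def[symmetric] by (rule mtrace_frame[OF x E bil])
  also have "\<dots> = 2 * (\<Sum>c\<in>?B. \<Sum>a\<in>?B. T (E c) (E c) (E a) (E a))"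
    by (simp add: mtrace_frame[OF x E T1] sum_distrib_left)
  also have "(\<Sum>c\<in>?B. \<Sum>a\<in>?B. T (E c) (E c) (E a) (E a)) =
     (\<Sum>a\<in>?B. \<Sum>c\<in>?B. tr (\<lambda>w. ddgam x (E c) (E c) (E a) (gam x (E a) w)))
     + (\<Sum>a\<in>?B. \<Sum>c\<in>?B. tr (\<lambda>w. dgam x (E c) (E a) (dgam x (E c) (E a) w)))"
    by (subst sum.swap) (simp add: T_def sum.distrib)
  finally have 1: "divg (pd scal) x = 2 * (
     (\<Sum>a\<in>?B. \<Sum>c\<in>?B. tr (\<lambda>w. ddgam x (E c) (E c) (E a) (gam x (E a) w)))
     + (\<Sum>a\<in>?B. \<Sum>c\<in>?B. tr (\<lambda>w. dgam x (E c) (E a) (dgam x (E c) (E a) w))))" .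
  have "tr (\<lambda>w. dgam x p q (dgam x p q w)) = (\<Sum>b\<in>?B. g x (dgam x p q (E b)) (dgam x p q (E b)))" for p q
  proof -
    have "linear (\<lambda>w. dgam x p q (dgam x p q w))" by (rule linearI) (simp_all add: dgam_add[OF x] dgam_cmul[OF x])
    then show ?thesis by (simp add: h.tr_frame[OF E] dgam_self_adjoint[OF x])
  qed
  \<comment> \<open>These are the summands of the squared norm of \<open>dgam\<close>; only their
    sign is kept.\<close>
  then have 2: "0 \<le> (\<Sum>a\<in>?B. \<Sum>c\<in>?B. tr (\<lambda>w. dgam x (E c) (E a) (dgam x (E c) (E a) w)))"
    by (auto intro!: sum_nonneg h.nonneg)
  have tr_sum: "(\<Sum>c\<in>?B. tr (L c)) = tr (\<lambda>w. \<Sum>c\<in>?B. L c w)" for L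
    unfolding tr_def inner_sum_left by (rule sum.swap)
  have tr_scale: "tr (\<lambda>w. 2 *\<^sub>R L w) = 2 * tr L" for L :: "'a \<Rightarrow> 'a" by (simp add: tr_def sum_distrib_left)
  have "(\<Sum>a\<in>?B. \<Sum>c\<in>?B. tr (\<lambda>w. ddgam x (E c) (E c) (E a) (gam x (E a) w))) =
    (\<Sum>a\<in>?B. \<Sum>c\<in>?B. ?k (E a) (E c)
      + rho x (gam x (E c) (gam x (E c) (E a))) (E a))"
    unfolding tr_sum sum_ddgam_frame
    by (simp add: tr_sum[symmetric] tr_add tr_diff tr_scale rho_def)
  also have "\<dots> = (\<Sum>a\<in>?B. \<Sum>c\<in>?B. ?k (E a) (E c)) + (\<Sum>a\<in>?B. \<Sum>b\<in>?B. (rho x (E a) (E b))\<^sup>2)"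
    unfolding sum.distrib[of _ "\<lambda>c. rho x (gam x (E c) (gam x (E c) (E _))) (E _)"] sum_rho_square[symmetric]
    by (rule sum.distrib)
  also have "\<dots> \<ge> (\<Sum>a\<in>?B. \<Sum>b\<in>?B. (rho x (E a) (E b))\<^sup>2)"
    using sum_nonneg[of ?B "\<lambda>a. \<Sum>c\<in>?B. ?k (E a) (E c)"] commutator_nonneg
    by (simp add: sum_nonneg)
  finally show ?thesis using 1 2 by simp
qed

lemma gam_eq_0:
  assumes "(\<Sum>a\<in>Basis. \<Sum>b\<in>Basis. (rho x (E a) (E b))\<^sup>2) = 0"
  shows "gam x u v = 0"
proof -
  have "(\<Sum>b\<in>Basis. (rho x (E a) (E b))\<^sup>2) = 0" if "a \<in> Basis" for a
    using assms that sum_nonneg_eq_0_iff[of Basis "\<lambda>a. \<Sum>b\<in>Basis. (rho x (E a) (E b))\<^sup>2"]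
    by (simp add: sum_nonneg)
  then have "(rho x (E a) (E a))\<^sup>2 = 0" if "a \<in> Basis" for a
    using that sum_nonneg_eq_0_iff[of Basis "\<lambda>b. (rho x (E a) (E b))\<^sup>2"] by simp
  then have "g x (gam x (E a) (E b)) (gam x (E a) (E b)) = 0" if "a \<in> Basis" "b \<in> Basis" for a b
    using that sum_nonneg_eq_0_iff[of Basis "\<lambda>b. g x (gam x (E a) (E b)) (gam x (E a) (E b))"] h.nonneg
    by (simp add: rho_frame)
  then have 0: "gam x (E a) (E b) = 0" if "a \<in> Basis" "b \<in> Basis" for a b
    using that h.pos by (metis less_irrefl)
  have "gam x u v = gam x (\<Sum>a\<in>Basis. g x u (E a) *\<^sub>R E a) (\<Sum>b\<in>Basis. g x v (E b) *\<^sub>R E b)"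
    using h.frame_expand[OF E] by metis
  also have "\<dots> = 0"
    by (simp add: linear_sum[OF bilinear_imp_linear(1)[OF gam_bil[OF x]]]
        linear_sum[OF bilinear_imp_linear(2)[OF gam_bil[OF x]]] gam_simps[OF x] 0)
  finally show ?thesis .
qed

end
end
end

section \<open>Integration in Euclidean spaces\<close>

text \<open>The change of variables formula is available for \<open>real ^ 'n\<close> only, so integrals over a
  Euclidean space are transported to the coordinate space indexed by its basis.\<close>

typedef (overloaded) 'e basis_index = "Basis :: 'e::euclidean_space set"
  using nonempty_Basis by blast

lemma range_Rep_basis_index: "range (Rep_basis_index :: 'e::euclidean_space basis_index \<Rightarrow> 'e) = Basis"
  using type_definition.Rep_range[OF type_definition_basis_index] .

instance basis_index :: (euclidean_space) finite
proof
  have "finite (range (Rep_basis_index :: 'a basis_index \<Rightarrow> 'a))" by (simp add: range_Rep_basis_index)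
  then show "finite (UNIV :: 'a basis_index set)"
    by (rule finite_imageD) (simp add: inj_on_def Rep_basis_index_inject)
qed

text \<open>The change of variables formula asks for a well-ordered index type. The order is pulled
  back along an arbitrary injection into \<open>nat\<close>.\<close>

definition basis_index_rank :: "'e::euclidean_space basis_index \<Rightarrow> nat" where
  "basis_index_rank = (SOME f. inj f)"

lemma inj_basis_index_rank: "inj (basis_index_rank :: 'e::euclidean_space basis_index \<Rightarrow> nat)"
proof -
  have "\<exists>f :: 'e basis_index \<Rightarrow> nat. inj f"
    using finite_imp_inj_to_nat_seg[of "UNIV :: 'e basis_index set"] by auto
  then show ?thesis unfolding basis_index_rank_def by (rule someI_ex)
qed

instantiation basis_index :: (euclidean_space) wellorder
begin

definition "i \<le> j \<longleftrightarrow> basis_index_rank i \<le> basis_index_rank j"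
definition "i < j \<longleftrightarrow> basis_index_rank i < basis_index_rank j"

instance
proof
  fix P :: "'a basis_index \<Rightarrow> bool" and a
  assume step: "\<And>x. (\<And>y. y < x \<Longrightarrow> P y) \<Longrightarrow> P x"
  show "P a"
    by (induction a rule: measure_induct_rule[of basis_index_rank])
      (use step in \<open>simp add: less_basis_index_def\<close>)
qed (auto simp: less_eq_basis_index_def less_basis_index_def dest: injD[OF inj_basis_index_rank])

end

definition to_cart :: "'e::euclidean_space \<Rightarrow> real ^ 'e basis_index" where
  "to_cart v = (\<chi> i. v \<bullet> Rep_basis_index i)"

definition of_cart :: "real ^ 'e basis_index \<Rightarrow> 'e::euclidean_space" where
  "of_cart y = (\<Sum>i\<in>UNIV. y $ i *\<^sub>R Rep_basis_index i)"

lemma sum_basis_index: "(\<Sum>i\<in>UNIV. f (Rep_basis_index i)) = (\<Sum>b\<in>Basis. f b)"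
  unfolding range_Rep_basis_index[symmetric]
  by (subst sum.reindex) (simp_all add: inj_on_def Rep_basis_index_inject)

lemma Rep_basis_index_inner:
  "Rep_basis_index i \<bullet> Rep_basis_index j = (if i = j then 1 else 0)"
  using Rep_basis_index[of i] Rep_basis_index[of j]
  by (auto simp: inner_Basis Rep_basis_index_inject)

lemma of_to_cart [simp]: "of_cart (to_cart v) = v"
  by (simp add: of_cart_def to_cart_def sum_basis_index[of "\<lambda>b. (v \<bullet> b) *\<^sub>R b"] euclidean_representation)

lemma to_of_cart [simp]: "to_cart (of_cart y) = y"
  by (simp add: of_cart_def to_cart_def vec_eq_iff inner_sum_left Rep_basis_index_inner if_distrib cong: if_cong)

lemma linear_to_cart: "linear to_cart"
  by (rule linearI) (simp_all add: to_cart_def vec_eq_iff inner_add_left)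

lemma linear_of_cart: "linear of_cart"
  by (rule linearI) (simp_all add: of_cart_def algebra_simps sum.distrib scaleR_sum_right)

lemmas continuous_of_cart = linear_continuous_on[OF linear_conv_bounded_linear[THEN iffD1, OF linear_of_cart]]
lemmas has_derivative_of_cart = linear_imp_has_derivative[OF linear_of_cart]
lemmas has_derivative_to_cart = linear_imp_has_derivative[OF linear_to_cart]

definition endo_matrix :: "('e::euclidean_space \<Rightarrow> 'e) \<Rightarrow> real ^ 'e basis_index ^ 'e basis_index" where
  "endo_matrix L = (\<chi> i j. L (Rep_basis_index j) \<bullet> Rep_basis_index i)"

lemma of_cart_axis: "of_cart (axis j 1) = Rep_basis_index j"
  by (simp add: of_cart_def axis_def if_distrib if_distribR cong: if_cong)

lemma endo_matrix_cart: "endo_matrix L = matrix (\<lambda>y. to_cart (L (of_cart y)))"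
  by (simp add: endo_matrix_def matrix_def to_cart_def of_cart_axis)

lemma trace_endo_matrix: "trace (endo_matrix L) = tr L"
  by (simp add: trace_def endo_matrix_def tr_def sum_basis_index[of "\<lambda>b. L b \<bullet> b"])

section \<open>Integrals of compactly supported functions\<close>

definition compactly_supported :: "('a::euclidean_space \<Rightarrow> real) \<Rightarrow> bool" where
  "compactly_supported f \<longleftrightarrow> continuous_on UNIV f \<and> bounded {x. f x \<noteq> 0}"

lemma compactly_supported_cbox:
  assumes "compactly_supported f" obtains a b where "\<And>x. f x \<noteq> 0 \<Longrightarrow> x \<in> box a b" "box a b \<noteq> {}"
proof -
  obtain r where r: "r > 0" "\<And>x. f x \<noteq> 0 \<Longrightarrow> norm x \<le> r"
    using assms by (auto simp: compactly_supported_def bounded_pos)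
  have bd: "bounded (cball (0::'a) r)" by simp
  obtain a where a: "cball (0::'a) r \<subseteq> box (- a) a" using bounded_subset_box_symmetric[OF bd] by blast
  show ?thesis
  proof
    show "f x \<noteq> 0 \<Longrightarrow> x \<in> box (- a) a" for x using r(2)[of x] a by auto
    show "box (- a) a \<noteq> {}" using a r(1) by (metis cball_eq_empty less_le_not_le subset_empty linorder_not_less)
  qed
qed

lemma compactly_supported_absolutely_integrable:
  assumes "compactly_supported f" shows "f absolutely_integrable_on UNIV"
proof -
  obtain a b where ab: "\<And>x. f x \<noteq> 0 \<Longrightarrow> x \<in> box a b" using compactly_supported_cbox[OF assms] by metis
  have "continuous_on (cbox a b) f"
    using assms by (auto simp: compactly_supported_def intro: continuous_on_subset)
  then have "(\<lambda>x. if x \<in> cbox a b then f x else 0) absolutely_integrable_on UNIV"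
    by (subst absolutely_integrable_restrict_UNIV) (rule absolutely_integrable_continuous)
  moreover have "(\<lambda>x. if x \<in> cbox a b then f x else 0) = f" using ab box_subset_cbox by fastforce
  ultimately show ?thesis by simp
qed

lemma integral_compactly_supported_eq_0:
  assumes f: "compactly_supported f" and nn: "\<And>x. 0 \<le> f x" and 0: "integral UNIV f = 0"
  shows "f x = 0"
proof (rule ccontr)
  assume nz: "f x \<noteq> 0"
  obtain a b where ab: "\<And>x. f x \<noteq> 0 \<Longrightarrow> x \<in> box a b" "box a b \<noteq> {}" using compactly_supported_cbox[OF f] by metis
  have "(\<lambda>x. if x \<in> cbox a b then f x else 0) = f" using ab box_subset_cbox by fastforce
  then have "integral (cbox a b) f = 0" using 0 Henstock_Kurzweil_Integration.integral_restrict_UNIV[of "cbox a b" f] by simp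
  then have "\<forall>x\<in>cbox a b. f x = 0"
    using integral_cbox_eq_0_iff[of a b f] ab(2) nn f
    by (auto simp: compactly_supported_def intro: continuous_on_subset)
  then show False using nz ab(1)[OF nz] box_subset_cbox by blast
qed

text \<open>Translation invariance makes \<open>t \<mapsto> \<integral> f (x + t v) dx\<close> constant; differentiate it at \<open>0\<close>.\<close>

lemma integral_derivative_eq_0:
  fixes f :: "'a::euclidean_space \<Rightarrow> real"
  assumes C1: "Ck_on (Suc 0) f UNIV" and f: "compactly_supported f"
  shows "integral UNIV (\<lambda>x. pd f x v) = 0"
proof -
  have d: "f differentiable at x" for x using C1 by simp
  have c: "continuous_on UNIV (\<lambda>x. pd f x v)" using C1 by simp
  have fc: "continuous_on UNIV f" using f by (simp add: compactly_supported_def)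
  obtain r where r: "r > 0" "\<And>x. f x \<noteq> 0 \<Longrightarrow> norm x \<le> r"
    using f by (auto simp: compactly_supported_def bounded_pos)
  \<comment> \<open>The radius is enlarged by \<open>norm v\<close> so that for \<open>t\<close> in
    \<open>[-1, 1]\<close> every translate of the support stays inside the box.\<close>
  define R where "R = r + norm v"
  have bd: "bounded (cball (0::'a) R)" by simp
  obtain a where a: "cball (0::'a) R \<subseteq> cbox (- a) a" using bounded_subset_cbox_symmetric[OF bd] by blast
  have out: "f y = 0" if "norm y > r" for y using r(2)[of y] that by fastforce
  have pd0: "pd f y v = 0" if "norm y > r" for y
  proof -
    have "pd f y = pd (\<lambda>y. 0) y"
      by (rule pd_cong_open[of "- cball 0 r"]) (use that out in auto)
    then show ?thesis by simp
  qed
  have big: "norm (x + t *\<^sub>R v) > r" if "x \<notin> cbox (- a) a" "t \<in> {-1..1}" for x t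
  proof -
    have "x \<notin> cball 0 R" using that(1) a by blast
    then have "norm x > R" by simp
    moreover have "norm (t *\<^sub>R v) \<le> norm v" using that mult_right_mono[of "\<bar>t\<bar>" 1 "norm v"] by auto
    ultimately show ?thesis using norm_triangle_ineq2[of x "- (t *\<^sub>R v)"] by (simp add: R_def)
  qed
  have const: "integral (cbox (- a) a) (\<lambda>x. f (x + t *\<^sub>R v)) = integral UNIV f" if t: "t \<in> {-1..1}" for t
  proof -
    have "integral (cbox (- a) a) (\<lambda>x. f (x + t *\<^sub>R v)) = integral (cbox (- a + t *\<^sub>R v) (a + t *\<^sub>R v)) f"
      using integral_shift_cbox_plus[of "- a" a f "t *\<^sub>R v"] by (simp add: o_def add.commute)
    also have "\<dots> = integral UNIV (\<lambda>x. if x \<in> cbox (- a + t *\<^sub>R v) (a + t *\<^sub>R v) then f x else 0)"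
      by (rule Henstock_Kurzweil_Integration.integral_restrict_UNIV[symmetric])
    also have "(\<lambda>x. if x \<in> cbox (- a + t *\<^sub>R v) (a + t *\<^sub>R v) then f x else 0) = f"
    proof
      fix x
      have "x - t *\<^sub>R v \<in> cbox (- a) a" if "x \<notin> cbox (- a + t *\<^sub>R v) (a + t *\<^sub>R v) \<Longrightarrow> False"
        using that by (auto simp: mem_box algebra_simps)
      moreover have "x - t *\<^sub>R v \<notin> cbox (- a) a" if "x \<notin> cbox (- a + t *\<^sub>R v) (a + t *\<^sub>R v)"
        using that by (auto simp: mem_box algebra_simps)
      ultimately show "(if x \<in> cbox (- a + t *\<^sub>R v) (a + t *\<^sub>R v) then f x else 0) = f x"
        using big[OF _ t, of "x - t *\<^sub>R v"] out[of x] by auto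
    qed
    finally show ?thesis .
  qed
  have der: "((\<lambda>t. f (x + t *\<^sub>R v)) has_field_derivative pd f (x + t *\<^sub>R v) v) (at t within {-1..1})" for x t
  proof -
    have "((\<lambda>t. f (x + t *\<^sub>R v)) has_derivative (\<lambda>s. pd f (x + t *\<^sub>R v) (s *\<^sub>R v))) (at t within {-1..1})"
      by (rule has_derivative_compose[where g = f and f = "\<lambda>t. x + t *\<^sub>R v"])
        (use d in \<open>auto intro!: derivative_eq_intros simp: frechet_derivative_works[symmetric]\<close>)
    then show ?thesis
      using linear_cmul[OF linear_frechet_derivative[OF d]] by (simp add: has_field_derivative_def mult_commute_abs)
  qed
  have "((\<lambda>t. integral (cbox (- a) a) (\<lambda>x. f (x + t *\<^sub>R v))) has_field_derivative
      integral (cbox (- a) a) (\<lambda>x. pd f (x + 0 *\<^sub>R v) v)) (at 0 within {-1..1})"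
  proof (rule leibniz_rule_field_derivative)
    show "(\<lambda>x. f (x + t *\<^sub>R v)) integrable_on cbox (- a) a" for t
      by (intro integrable_continuous continuous_on_compose2[OF fc] continuous_intros) auto
    show "continuous_on ({-1..1} \<times> cbox (- a) a) (\<lambda>(t, x). pd f (x + t *\<^sub>R v) v)"
      unfolding split_beta by (intro continuous_on_compose2[OF c] continuous_intros) auto
  qed (use der in auto)
  moreover have "((\<lambda>t. integral (cbox (- a) a) (\<lambda>x. f (x + t *\<^sub>R v))) has_field_derivative 0) (at 0 within {-1..1})"
    by (rule DERIV_const[THEN has_field_derivative_transform_within[where d = 1]]) (use const in \<open>auto simp: dist_real_def\<close>)
  ultimately have "integral (cbox (- a) a) (\<lambda>x. pd f x v) = 0"
    using at_within_Icc_at[of "-1" "0::real" 1] DERIV_unique by fastforce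
  moreover have "(\<lambda>x. if x \<in> cbox (- a) a then pd f x v else 0) = (\<lambda>x. pd f x v)"
    using big[of _ 0] pd0 by fastforce
  ultimately show ?thesis
    using Henstock_Kurzweil_Integration.integral_restrict_UNIV[of "cbox (- a) a" "\<lambda>x. pd f x v"] by simp
qed

text \<open>The integral in coordinates relative to the standard basis, where determinants of linear
  maps are those of \<open>endo_matrix\<close>.\<close>

definition eint :: "('e::euclidean_space \<Rightarrow> real) \<Rightarrow> real" where
  "eint f = integral UNIV (\<lambda>y. f (of_cart y))"

lemma compactly_supported_of_cart:
  assumes "compactly_supported f" shows "compactly_supported (\<lambda>y. f (of_cart y))"
proof -
  have c: "continuous_on UNIV f" and b: "bounded {x. f x \<noteq> 0}" using assms by (auto simp: compactly_supported_def)
  have "{y. f (of_cart y) \<noteq> 0} = to_cart ` {x. f x \<noteq> 0}"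
    by (auto simp: image_iff) (metis to_of_cart of_to_cart)
  then have "bounded {y. f (of_cart y) \<noteq> 0}"
    using bounded_linear_image[OF b linear_conv_bounded_linear[THEN iffD1, OF linear_to_cart]] by simp
  then show ?thesis
    using continuous_on_compose2[OF c continuous_of_cart] by (auto simp: compactly_supported_def)
qed

lemma eint_integrable:
  "compactly_supported f \<Longrightarrow> (\<lambda>y. f (of_cart y)) integrable_on UNIV"
  using compactly_supported_absolutely_integrable[OF compactly_supported_of_cart] set_lebesgue_integral_eq_integral(1)
  by blast

lemma eint_sum:
  assumes "finite I" "\<And>i. i \<in> I \<Longrightarrow> compactly_supported (f i)"
  shows "eint (\<lambda>x. \<Sum>i\<in>I. f i x) = (\<Sum>i\<in>I. eint (f i))"
  unfolding eint_def using assms by (intro integral_sum) (auto intro: eint_integrable)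

lemma eint_add: "compactly_supported f \<Longrightarrow> compactly_supported h \<Longrightarrow> eint (\<lambda>x. f x + h x) = eint f + eint h"
  unfolding eint_def by (intro integral_add eint_integrable)

lemma eint_nonneg: "compactly_supported f \<Longrightarrow> (\<And>x. 0 \<le> f x) \<Longrightarrow> 0 \<le> eint f"
  unfolding eint_def by (rule Henstock_Kurzweil_Integration.integral_nonneg[OF eint_integrable])

lemma eint_eq_0_imp:
  assumes "compactly_supported f" "\<And>x. 0 \<le> f x" "eint f = 0" shows "f x = 0"
  using integral_compactly_supported_eq_0[OF compactly_supported_of_cart[OF assms(1)] assms(2) assms(3)[unfolded eint_def], of "to_cart x"]
  by simp

lemma eint_derivative_eq_0:
  fixes f :: "'e::euclidean_space \<Rightarrow> real"
  assumes C1: "Ck_on (Suc 0) f UNIV" and f: "compactly_supported f"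
  shows "eint (\<lambda>x. pd f x v) = 0"
proof -
  have d: "f differentiable at x" for x using C1 by simp
  have der: "((\<lambda>y. f (of_cart y)) has_derivative (\<lambda>w. pd f (of_cart y) (of_cart w))) (at y)" for y
    by (rule has_derivative_compose[OF has_derivative_of_cart])
      (use d in \<open>auto simp: frechet_derivative_works[symmetric]\<close>)
  have "Ck_on (Suc 0) (\<lambda>y. f (of_cart y)) UNIV"
    using C1 differentiableI[OF der] by (auto simp: pd_eqI[OF der] intro: continuous_on_compose2[OF _ continuous_of_cart])
  from integral_derivative_eq_0[OF this compactly_supported_of_cart[OF f], of "to_cart v"]
  show ?thesis by (simp add: pd_eqI[OF der] eint_def)
qed

text \<open>Both functions live on the whole space and vanish outside the domain and its image,
  which is the shape of functions cut off to a chart.\<close>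

lemma eint_change_of_variables:
  fixes f h :: "'e::euclidean_space \<Rightarrow> real"
  assumes S: "open S" and inj: "inj_on \<phi> S" and der: "\<And>x. x \<in> S \<Longrightarrow> (\<phi> has_derivative \<phi>' x) (at x)"
    and f: "compactly_supported f" and f0: "\<And>x. x \<notin> \<phi> ` S \<Longrightarrow> f x = 0"
    and h: "\<And>x. x \<in> S \<Longrightarrow> h x = \<bar>det (endo_matrix (\<phi>' x))\<bar> * f (\<phi> x)" and h0: "\<And>x. x \<notin> S \<Longrightarrow> h x = 0"
  shows "eint h = eint f"
proof -
  let ?S = "of_cart -` S :: (real ^ 'e basis_index) set"
  let ?\<phi> = "\<lambda>y. to_cart (\<phi> (of_cart y))"
  let ?\<phi>' = "\<lambda>y w. to_cart (\<phi>' (of_cart y) (of_cart w))"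
  \<comment> \<open>Real values are regarded as vectors of length one because the formula concerns
    vector-valued functions.\<close>
  let ?F = "\<lambda>y. vec (f (of_cart y)) :: real ^ 1"
  have oS: "open ?S" by (rule open_vimage[OF S continuous_of_cart])
  have der': "(?\<phi> has_derivative ?\<phi>' y) (at y within ?S)" if "y \<in> ?S" for y
  proof -
    have "((\<lambda>y. \<phi> (of_cart y)) has_derivative (\<lambda>w. \<phi>' (of_cart y) (of_cart w))) (at y)"
      by (rule has_derivative_compose[OF has_derivative_of_cart der]) (use that in simp)
    from has_derivative_compose[OF this has_derivative_to_cart] show ?thesis
      by (rule has_derivative_at_withinI)
  qed
  have inj': "inj_on ?\<phi> ?S"
  proof (rule inj_onI)
    fix y z assume "y \<in> ?S" "z \<in> ?S" "?\<phi> y = ?\<phi> z"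
    then have "of_cart y = of_cart z" using inj_onD[OF inj] by (metis of_to_cart vimageE)
    then show "y = z" by (metis to_of_cart)
  qed
  have im: "?\<phi> ` ?S = {y. of_cart y \<in> \<phi> ` S}"
  proof (rule set_eqI, rule iffI)
    fix y assume "y \<in> {y. of_cart y \<in> \<phi> ` S}"
    then obtain x where "x \<in> S" "of_cart y = \<phi> x" by auto
    then have "y = ?\<phi> (to_cart x)" "to_cart x \<in> ?S" by (metis of_to_cart to_of_cart, simp)
    then show "y \<in> ?\<phi> ` ?S" by blast
  qed auto
  have fi: "(\<lambda>y. f (of_cart y)) absolutely_integrable_on UNIV"
    by (rule compactly_supported_absolutely_integrable[OF compactly_supported_of_cart[OF f]])
  have fr: "(\<lambda>y. if y \<in> ?\<phi> ` ?S then f (of_cart y) else 0) = (\<lambda>y. f (of_cart y))"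
    using f0 unfolding im by auto
  have "(\<lambda>y. f (of_cart y)) absolutely_integrable_on ?\<phi> ` ?S"
    using fi absolutely_integrable_restrict_UNIV[of "?\<phi> ` ?S" "\<lambda>y. f (of_cart y)"] unfolding fr by simp
  then have 1: "?F absolutely_integrable_on ?\<phi> ` ?S \<and> integral (?\<phi> ` ?S) ?F = vec (integral (?\<phi> ` ?S) (\<lambda>y. f (of_cart y)))"
    by (simp add: absolutely_integrable_on_1_iff integral_on_1_eq)
  have "integral ?S (\<lambda>y. \<bar>det (matrix (?\<phi>' y))\<bar> *\<^sub>R ?F (?\<phi> y)) = vec (integral (?\<phi> ` ?S) (\<lambda>y. f (of_cart y)))"
    using has_absolute_integral_change_of_variables[of ?S ?\<phi> ?\<phi>' ?F "vec (integral (?\<phi> ` ?S) (\<lambda>y. f (of_cart y)))", OF _ der' inj'] 1 oS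
    by auto
  then have 2: "integral ?S (\<lambda>y. \<bar>det (matrix (?\<phi>' y))\<bar> * f (\<phi> (of_cart y))) = integral (?\<phi> ` ?S) (\<lambda>y. f (of_cart y))"
    by (simp add: integral_on_1_eq)
  have "eint h = integral UNIV (\<lambda>y. if y \<in> ?S then h (of_cart y) else 0)"
    unfolding eint_def using h0 by (intro arg_cong[where f = "integral UNIV"]) auto
  also have "\<dots> = integral ?S (\<lambda>y. h (of_cart y))" by (rule Henstock_Kurzweil_Integration.integral_restrict_UNIV)
  also have "\<dots> = integral ?S (\<lambda>y. \<bar>det (matrix (?\<phi>' y))\<bar> * f (\<phi> (of_cart y)))"
    by (rule Henstock_Kurzweil_Integration.integral_cong) (use h in \<open>auto simp: endo_matrix_cart\<close>)
  also have "\<dots> = integral UNIV (\<lambda>y. if y \<in> ?\<phi> ` ?S then f (of_cart y) else 0)"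
    unfolding 2 by (rule Henstock_Kurzweil_Integration.integral_restrict_UNIV[symmetric])
  finally show ?thesis unfolding fr eint_def .
qed

section \<open>The Riemannian density\<close>

lemma det_differentiable: "(det :: real ^ 'n ^ 'n \<Rightarrow> real) differentiable at A"
proof -
  have bl: "bounded_linear (\<lambda>A :: real ^ 'n ^ 'n. A $ i $ j)" for i j
    by (rule bounded_linear_compose[OF bounded_linear_vec_nth bounded_linear_vec_nth])
  have "((\<lambda>A :: real ^ 'n ^ 'n. \<Sum>p | p permutes UNIV. of_int (sign p) * (\<Prod>i\<in>UNIV. A $ i $ p i)) has_derivative
      (\<lambda>H. \<Sum>p | p permutes UNIV. of_int (sign p) * (\<Sum>i\<in>UNIV. H $ i $ p i * (\<Prod>j\<in>UNIV - {i}. A $ j $ p j)))) (at A)"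
    by (intro has_derivative_sum has_derivative_mult_right has_derivative_prod
        bounded_linear_imp_has_derivative bl)
  then show ?thesis unfolding det_def[abs_def] by (rule differentiableI)
qed

text \<open>In the Leibniz expansion a permutation other than the identity moves at least two
  indices, so its product keeps an off-diagonal zero of the identity matrix after one factor has
  been differentiated.\<close>

lemma DERIV_det_mat_1:
  fixes B :: "real ^ 'n ^ 'n"
  shows "DERIV (\<lambda>t. det (mat 1 + t *\<^sub>R B)) 0 :> trace B"
proof -
  let ?P = "{p :: 'n \<Rightarrow> 'n. p permutes UNIV}"
  let ?d = "\<lambda>p. of_int (sign p) * (\<Sum>i\<in>UNIV. B $ i $ p i * (\<Prod>j\<in>UNIV - {i}. (mat 1 + (0::real) *\<^sub>R B) $ j $ p j))"
  have c: "DERIV (\<lambda>t. (mat 1 + t *\<^sub>R B) $ i $ j) 0 :> B $ i $ j" for i j :: 'n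
    by (auto intro!: derivative_eq_intros)
  have "DERIV (\<lambda>t. \<Prod>i\<in>UNIV. (mat 1 + t *\<^sub>R B) $ i $ p i) 0 :>
     (\<Sum>i\<in>UNIV. B $ i $ p i * (\<Prod>j\<in>UNIV - {i}. (mat 1 + (0::real) *\<^sub>R B) $ j $ p j))" for p :: "'n \<Rightarrow> 'n"
  proof -
    have "((\<lambda>t. \<Prod>i\<in>UNIV. (mat 1 + t *\<^sub>R B) $ i $ p i) has_derivative
     (\<lambda>y. \<Sum>i\<in>UNIV. (B $ i $ p i * y) * (\<Prod>j\<in>UNIV - {i}. (mat 1 + (0::real) *\<^sub>R B) $ j $ p j))) (at 0)"
      by (rule has_derivative_prod) (use c in \<open>simp add: has_field_derivative_def\<close>)
    moreover have "(\<lambda>y. \<Sum>i\<in>UNIV. (B $ i $ p i * y) * (\<Prod>j\<in>UNIV - {i}. (mat 1 + (0::real) *\<^sub>R B) $ j $ p j)) =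
      (*) (\<Sum>i\<in>UNIV. B $ i $ p i * (\<Prod>j\<in>UNIV - {i}. (mat 1 + (0::real) *\<^sub>R B) $ j $ p j))"
      by (rule ext) (simp add: sum_distrib_left mult_ac)
    ultimately show ?thesis unfolding has_field_derivative_def by (simp only:)
  qed
  then have "DERIV (\<lambda>t. det (mat 1 + t *\<^sub>R B)) 0 :> (\<Sum>p\<in>?P. ?d p)"
    unfolding det_def by (intro DERIV_sum DERIV_cmult)
  moreover have "(\<Sum>p\<in>?P. ?d p) = ?d id"
  proof -
    have "?d p = 0" if p: "p \<in> ?P - {id}" for p
    proof -
      have "(\<Prod>j\<in>UNIV - {i}. (mat 1 + (0::real) *\<^sub>R B) $ j $ p j) = 0" for i
      proof -
        obtain k where k: "p k \<noteq> k" using p by (auto simp: fun_eq_iff)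
        \<comment> \<open>By injectivity \<open>p k\<close> is moved as well, so for every
          \<open>i\<close> some moved index differs from \<open>i\<close>.\<close>
        have pk: "p (p k) \<noteq> p k" using k p permutes_inj[of p UNIV] by (auto simp: inj_eq)
        obtain j where "j \<noteq> i" "p j \<noteq> j" using k pk by metis
        then have "\<exists>j\<in>UNIV - {i}. (mat 1 + (0::real) *\<^sub>R B) $ j $ p j = 0"
          by (intro bexI[of _ j]) (auto simp: mat_def)
        then show ?thesis by simp
      qed
      note z = this
      show ?thesis unfolding z by simp
    qed
    then have "(\<Sum>p\<in>?P. ?d p) = (\<Sum>p\<in>{id}. ?d p)"
      by (intro sum.mono_neutral_right) (auto simp: permutes_id finite_permutations)
    then show ?thesis by simp
  qed
  moreover have "?d id = trace B"
    by (simp add: trace_def sign_id mat_def)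
  ultimately show ?thesis by simp
qed

text \<open>Jacobi's formula in the directions in which a metric connection moves a Gram matrix.
  There the perturbed determinant factors, so neither inverse nor adjugate of \<open>A\<close> is
  involved.\<close>

lemma pd_det:
  fixes A B :: "real ^ 'n ^ 'n"
  shows "pd det A (transpose B ** A + A ** B) = 2 * trace B * det A"
proof -
  have lin: "linear (pd det A)" by (rule linear_frechet_derivative[OF det_differentiable])
  have der: "DERIV (\<lambda>t. det (A + t *\<^sub>R H)) 0 :> pd det A H" for H
  proof -
    have "((\<lambda>t. det (A + t *\<^sub>R H)) has_derivative (\<lambda>s. pd det (A + 0 *\<^sub>R H) (s *\<^sub>R H))) (at 0)"
      by (rule has_derivative_compose[where g = det and f = "\<lambda>t. A + t *\<^sub>R H"])
        (auto intro!: derivative_eq_intros simp: det_differentiable frechet_derivative_works[symmetric])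
    then show ?thesis using linear_cmul[OF lin] by (simp add: has_field_derivative_def mult_commute_abs)
  qed
  have "pd det A (A ** B) = det A * trace B"
  proof -
    have "A + t *\<^sub>R (A ** B) = A ** (mat 1 + t *\<^sub>R B)" for t
      by (simp add: matrix_add_ldistrib matrix_scalar_ac scalar_matrix_assoc[symmetric])
    then have "det (A + t *\<^sub>R (A ** B)) = det A * det (mat 1 + t *\<^sub>R B)" for t by (simp add: det_mul)
    then show ?thesis using der[of "A ** B"] DERIV_cmult[OF DERIV_det_mat_1[of B], of "det A"] DERIV_unique by auto
  qed
  moreover have "pd det A (transpose B ** A) = det A * trace B"
  proof -
    have "(P + Q) ** A = P ** A + Q ** A" for P Q :: "real ^ 'n ^ 'n"
      by (simp add: matrix_matrix_mult_def vec_eq_iff distrib_right sum.distrib)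
    then have "A + t *\<^sub>R (transpose B ** A) = (mat 1 + t *\<^sub>R transpose B) ** A" for t
      by (simp add: scalar_matrix_assoc[symmetric])
    then have "det (A + t *\<^sub>R (transpose B ** A)) = det A * det (mat 1 + t *\<^sub>R transpose B)" for t by (simp add: det_mul)
    moreover have "trace (transpose B) = trace B" by (simp add: trace_def transpose_def)
    ultimately show ?thesis using der[of "transpose B ** A"] DERIV_cmult[OF DERIV_det_mat_1[of "transpose B"], of "det A"] DERIV_unique by auto
  qed
  ultimately show ?thesis by (simp add: linear_add[OF lin])
qed

definition gram :: "('e \<Rightarrow> 'e \<Rightarrow> real) \<Rightarrow> real ^ 'e basis_index ^ 'e::euclidean_space basis_index" where
  "gram h = (\<chi> i j. h (Rep_basis_index i) (Rep_basis_index j))"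

lemma gram_endo:
  assumes "bilinear h" "linear L"
  shows "gram (\<lambda>u v. h (L u) v) = transpose (endo_matrix L) ** gram h"
    and "gram (\<lambda>u v. h u (L v)) = gram h ** endo_matrix L"
proof -
  have "h (L u) v = (\<Sum>k\<in>UNIV. (L u \<bullet> Rep_basis_index k) * h (Rep_basis_index k) v)" for u v
    unfolding sum_basis_index[of "\<lambda>k. (L u \<bullet> k) * h k v"] unfolding real_scaleR_def[symmetric]
    by (rule linear_Basis_expand[OF bilinear_imp_linear(2)[OF assms(1)]])
  then show "gram (\<lambda>u v. h (L u) v) = transpose (endo_matrix L) ** gram h"
    by (simp add: gram_def endo_matrix_def transpose_def matrix_matrix_mult_def vec_eq_iff)
  have "h u (L v) = (\<Sum>k\<in>UNIV. (L v \<bullet> Rep_basis_index k) * h u (Rep_basis_index k))" for u v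
    unfolding sum_basis_index[of "\<lambda>k. (L v \<bullet> k) * h u k"] unfolding real_scaleR_def[symmetric]
    by (rule linear_Basis_expand[OF bilinear_imp_linear(1)[OF assms(1)]])
  then show "gram (\<lambda>u v. h u (L v)) = gram h ** endo_matrix L"
    by (simp add: gram_def endo_matrix_def matrix_matrix_mult_def vec_eq_iff mult.commute)
qed

lemma det_gram_endo:
  assumes "bilinear h" "linear L"
  shows "det (gram (\<lambda>u v. h (L u) (L v))) = (det (endo_matrix L))\<^sup>2 * det (gram h)"
proof -
  have "bilinear (\<lambda>u v. h u (L v))"
    unfolding bilinear_def
    by (auto intro!: linearI simp: linear_add[OF assms(2)] linear_cmul[OF assms(2)] bilinear_ladd[OF assms(1)]
        bilinear_radd[OF assms(1)] bilinear_lmul[OF assms(1)] bilinear_rmul[OF assms(1)])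
  then have "gram (\<lambda>u v. h (L u) (L v)) = transpose (endo_matrix L) ** (gram h ** endo_matrix L)"
    using gram_endo(1)[of "\<lambda>u v. h u (L v)" L] gram_endo(2)[of h L] assms by simp
  then show ?thesis by (simp add: det_mul det_transpose power2_eq_square)
qed

text \<open>The linear map taking the standard basis to an orthonormal frame transforms the Gram
  matrix into the identity, so its determinant times a square equals 1.\<close>

lemma (in inner_form) det_gram_pos: "0 < det (gram h)"
proof -
  obtain E where E: "orthonormal_frame h E" using ex_orthonormal_frame by blast
  define L where "L v = (\<Sum>b\<in>Basis. (v \<bullet> b) *\<^sub>R E b)" for v :: 'e
  have L: "linear L" by (rule linearI) (simp_all add: L_def inner_add_left algebra_simps sum.distrib scaleR_sum_right)
  have LE: "L b = E b" if "b \<in> Basis" for b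
  proof -
    have "L b = (\<Sum>c\<in>Basis. if c = b then E c else 0)"
      unfolding L_def using that by (intro sum.cong) (auto simp: inner_Basis)
    then show ?thesis using that by simp
  qed
  have "gram (\<lambda>u v. h (L u) (L v)) = mat 1"
    by (auto simp: gram_def mat_def vec_eq_iff Rep_basis_index_inject LE[OF Rep_basis_index]
        frame[OF E Rep_basis_index Rep_basis_index])
  then have 1: "(det (endo_matrix L))\<^sup>2 * det (gram h) = 1" using det_gram_endo[OF bil L] by simp
  then show ?thesis by (smt (verit) mult_nonneg_nonpos zero_le_power2)
qed

context affine_riemann_chart
begin

definition vol :: "'e \<Rightarrow> real" where "vol x = sqrt (det (gram (g x)))"

lemma vol_pos: "x \<in> U \<Longrightarrow> 0 < vol x"
  by (simp add: vol_def inner_form.det_gram_pos[OF inner_form])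

text \<open>Since \<open>D\<close> is metric, the Gram matrix moves in the direction
  \<open>transpose B ** A + A ** B\<close> with \<open>B\<close> the matrix of \<open>D x u\<close>,
  and \<open>pd_det\<close> applies; the square root halves the factor 2.\<close>

lemma vol_has_derivative:
  assumes x: "x \<in> U"
  shows "(vol has_derivative (\<lambda>u. vol x * tr (D x u))) (at x)"
proof -
  have eq: "gram h = (\<Sum>i\<in>UNIV. \<Sum>j\<in>UNIV. h (Rep_basis_index i) (Rep_basis_index j) *\<^sub>R axis i (axis j 1))" for h :: "'e \<Rightarrow> 'e \<Rightarrow> real"
  proof -
    have "(\<Sum>j\<in>UNIV. h (Rep_basis_index i) (Rep_basis_index j) * ((axis i (axis j 1) :: real ^ 'e basis_index ^ 'e basis_index) $ a $ b)) =
        (if i = a then h (Rep_basis_index i) (Rep_basis_index b) else 0)" for i a b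
      by (cases "i = a") (simp_all add: axis_def if_distrib[of "(*) _"] cong: if_cong)
    then show ?thesis by (simp add: gram_def vec_eq_iff)
  qed
  have "((\<lambda>y. gram (g y)) has_derivative (\<lambda>u. \<Sum>i\<in>UNIV. \<Sum>j\<in>UNIV.
      pd (\<lambda>y. g y (Rep_basis_index i) (Rep_basis_index j)) x u *\<^sub>R axis i (axis j 1))) (at x)"
    unfolding eq by (intro has_derivative_sum has_derivative_scaleR_left smooth_on_has_derivative[OF g_smooth x])
  also have "(\<lambda>u. \<Sum>i\<in>UNIV. \<Sum>j\<in>UNIV. pd (\<lambda>y. g y (Rep_basis_index i) (Rep_basis_index j)) x u *\<^sub>R axis i (axis j 1))
     = (\<lambda>u. gram (\<lambda>v w. g x (D x u v) w) + gram (\<lambda>v w. g x v (D x u w)))"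
    by (simp add: eq D_metric[OF x] algebra_simps sum.distrib)
  also have "\<dots> = (\<lambda>u. transpose (endo_matrix (D x u)) ** gram (g x) + gram (g x) ** endo_matrix (D x u))"
    using gram_endo[OF g_bil[OF x] bilinear_imp_linear(1)[OF D_bil[OF x]]] by simp
  finally have "((\<lambda>y. det (gram (g y))) has_derivative (\<lambda>u. pd det (gram (g x)) (transpose (endo_matrix (D x u)) ** gram (g x) + gram (g x) ** endo_matrix (D x u)))) (at x)"
    by (rule has_derivative_compose) (auto simp: det_differentiable frechet_derivative_works[symmetric])
  then have "((\<lambda>y. det (gram (g y))) has_derivative (\<lambda>u. 2 * tr (D x u) * det (gram (g x)))) (at x)"
    unfolding pd_det trace_endo_matrix .
  note der = this
  define d where "d = det (gram (g x))"
  have d: "d > 0" unfolding d_def by (rule inner_form.det_gram_pos[OF inner_form[OF x]])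
  have "(sqrt has_derivative (*) (inverse (sqrt d) / 2)) (at d)"
    using DERIV_real_sqrt[OF d] unfolding has_field_derivative_def .
  from has_derivative_compose[OF der this[unfolded d_def]]
  have "(vol has_derivative (\<lambda>u. inverse (sqrt d) / 2 * (2 * tr (D x u) * d))) (at x)"
    unfolding vol_def[abs_def] d_def .
  moreover have "inverse (sqrt d) / 2 * (2 * t * d) = vol x * t" for t
    using d unfolding vol_def d_def[symmetric] by (simp add: field_simps)
  ultimately show ?thesis by (simp only:)
qed

text \<open>The derivative of \<open>vol\<close> is \<open>vol\<close> times a smooth function, so
  differentiability propagates to all orders.\<close>

lemma vol_smooth: "smooth_on vol U"
proof -
  have "Ck_on k vol U" for k
  proof (induction k)
    case 0
    then show ?case
      using vol_has_derivative by (auto intro!: continuous_at_imp_continuous_on has_derivative_continuous)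
  next
    case (Suc k)
    have A: "Ck_on k (\<lambda>x. vol x * tr (D x u)) U" for u
      using Ck_on_mult[OF open_U Suc, of "\<lambda>x. tr (D x u)"] smooth_on_tr[OF open_U D_smooth]
      by (simp add: smooth_on_def)
    have "Ck_on k (\<lambda>x. pd vol x u) U" for u
      by (rule Ck_on_cong[OF open_U _ A[of u]]) (simp add: pd_eqI[OF vol_has_derivative])
    then show ?case using differentiableI[OF vol_has_derivative] by simp
  qed
  then show ?thesis by (simp add: smooth_on_def)
qed

lemma divergence_vol_raise:
  assumes x: "x \<in> U" and l: "\<And>x. x \<in> U \<Longrightarrow> linear (\<beta> x)" and sm: "\<And>v. smooth_on (\<lambda>x. \<beta> x v) U"
  shows "pd vol x (raise \<beta> x) + vol x * tr (pd (raise \<beta>) x) = vol x * divg \<beta> x"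
proof -
  have "tr (pd (raise \<beta>) x) = divg \<beta> x - tr (D x (raise \<beta> x))"
    by (rule divergence_raise[OF assms])
  then show ?thesis unfolding pd_eqI[OF vol_has_derivative[OF x]] by (simp add: right_diff_distrib)
qed

end

section \<open>The divergence theorem on a compact manifold\<close>

lemma DERIV_max_0_square: "DERIV (\<lambda>t::real. (max 0 t)\<^sup>2) t :> 2 * max 0 t"
proof -
  consider "t > 0" | "t < 0" | "t = 0" by linarith
  then show ?thesis
  proof cases
    case 1
    have "DERIV (\<lambda>t::real. t\<^sup>2) t :> 2 * max 0 t" using 1 by (auto intro!: derivative_eq_intros)
    then show ?thesis
      by (rule has_field_derivative_transform_within_open[where S = "{0<..}"]) (use 1 in auto)
  next
    case 2
    have "DERIV (\<lambda>t::real. 0) t :> 2 * max 0 t" using 2 by auto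
    then show ?thesis
      by (rule has_field_derivative_transform_within_open[where S = "{..<0}"]) (use 2 in auto)
  next
    case 3
    have "((\<lambda>h::real. (max 0 h)\<^sup>2 / h) \<longlongrightarrow> 0) (at 0)"
    proof (rule Lim_null_comparison[where g = "\<lambda>h. \<bar>h\<bar>"])
      show "\<forall>\<^sub>F h in at 0. norm ((max 0 h)\<^sup>2 / h) \<le> \<bar>h::real\<bar>"
        by (rule always_eventually) (auto simp: max_def power2_eq_square)
    qed (auto intro!: tendsto_eq_intros)
    then show ?thesis using 3 by (simp add: has_field_derivative_iff)
  qed
qed

text \<open>Squaring the positive part makes the function C^1, and it is positive exactly on the
  open ball. This suffices for the weights, which are differentiated once.\<close>

definition bump :: "'e::euclidean_space \<Rightarrow> real \<Rightarrow> 'e \<Rightarrow> real" where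
  "bump c r y = (max 0 (r\<^sup>2 - (y - c) \<bullet> (y - c)))\<^sup>2"

lemma bump_nonneg: "0 \<le> bump c r y" by (simp add: bump_def)

lemma bump_pos_iff: "r > 0 \<Longrightarrow> 0 < bump c r y \<longleftrightarrow> y \<in> ball c r"
proof -
  assume "r > 0"
  then have "dist c y < r \<longleftrightarrow> (y - c) \<bullet> (y - c) < r\<^sup>2"
    by (metis dist_commute dist_norm norm_ge_zero order_less_imp_le power2_norm_eq_inner power_mono_iff
        abs_le_square_iff abs_of_nonneg linorder_not_less)
  then show ?thesis by (auto simp: bump_def max_def)
qed

lemma bump_C1: "Ck_on (Suc 0) (bump c r) UNIV"
proof -
  have der: "(bump c r has_derivative (\<lambda>v. 2 * max 0 (r\<^sup>2 - (y - c) \<bullet> (y - c)) * (- ((y - c) \<bullet> v + v \<bullet> (y - c))))) (at y)" for y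
    unfolding bump_def[abs_def]
    by (rule has_derivative_compose[where g = "\<lambda>t. (max 0 t)\<^sup>2" and g' = "(*) (2 * max 0 (r\<^sup>2 - (y - c) \<bullet> (y - c)))"])
      (use DERIV_max_0_square in \<open>auto intro!: derivative_eq_intros simp: has_field_derivative_def\<close>)
  then show ?thesis
    by (auto simp: pd_eqI[OF der] intro!: differentiableI[OF der] continuous_intros)
qed

lemma C1_compose:
  fixes f :: "'a::euclidean_space \<Rightarrow> 'c::real_normed_vector" and \<phi> :: "'b::real_normed_vector \<Rightarrow> 'a"
  assumes "open S" "Ck_on (Suc 0) \<phi> S" "Ck_on (Suc 0) f T" "\<phi> ` S \<subseteq> T"
  shows "Ck_on (Suc 0) (\<lambda>x. f (\<phi> x)) S"
proof -
  have der: "((\<lambda>x. f (\<phi> x)) has_derivative (\<lambda>v. pd f (\<phi> x) (pd \<phi> x v))) (at x)" if "x \<in> S" for x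
    by (rule has_derivative_compose[where g = f and f = \<phi>])
      (use that assms in \<open>auto simp: frechet_derivative_works[symmetric] image_subset_iff\<close>)
  have cphi: "continuous_on S \<phi>" using Ck_on_continuous[OF assms(2)] .
  have "Ck_on 0 (\<lambda>x. pd f (\<phi> x) (pd \<phi> x v)) S" for v
  proof (rule Ck_on_field[OF assms(1), where L = "\<lambda>x. pd f (\<phi> x)"])
    show "linear (pd f (\<phi> x))" if "x \<in> S" for x
      using assms that by (intro linear_frechet_derivative) (auto simp: image_subset_iff)
    show "Ck_on 0 (\<lambda>x. pd f (\<phi> x) w) S" for w
      using assms(3,4) by (auto intro: continuous_on_compose2[OF _ cphi])
  qed (use assms(2) in auto)
  then have "continuous_on S (\<lambda>x. pd (\<lambda>x. f (\<phi> x)) x v)" for v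
    by (rule continuous_on_eq[OF iffD1[OF Ck_on.simps(1)]]) (simp add: pd_eqI[OF der])
  then show ?thesis using differentiableI[OF der] by simp
qed

lemma C1_divide:
  fixes f h :: "'a::euclidean_space \<Rightarrow> real"
  assumes "open S" "Ck_on (Suc 0) f S" "Ck_on (Suc 0) h S" "\<And>x. x \<in> S \<Longrightarrow> h x \<noteq> 0"
  shows "Ck_on (Suc 0) (\<lambda>x. f x / h x) S"
proof -
  have der: "((\<lambda>t::real. inverse t) has_derivative (\<lambda>s. - (inverse t * s * inverse t))) (at t)" if "t \<in> - {0}" for t
    using that by (intro has_derivative_inverse') auto
  have "continuous_on (- {0::real}) (\<lambda>t. pd (\<lambda>t. inverse t) t v)" for v
    by (rule continuous_on_eq[of _ "\<lambda>t. - (inverse t * v * inverse t)"])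
      (auto intro!: continuous_intros simp: pd_eqI[OF der])
  then have "Ck_on (Suc 0) (\<lambda>t::real. inverse t) (- {0})"
    using differentiableI[OF der] by simp
  then have "Ck_on (Suc 0) (\<lambda>x. inverse (h x)) S"
    by (rule C1_compose[OF assms(1,3)]) (use assms(4) in auto)
  then show ?thesis using Ck_on_mult[OF assms(1,2)] by (simp add: divide_inverse)
qed

section \<open>Charts, transition maps and bumps on the manifold\<close>

locale smooth_manifold_charts =
  fixes M :: "('i, 'm, 'e::euclidean_space) manifold"
  assumes manifold: "smooth_manifold M"
begin

abbreviation psi :: "'i \<Rightarrow> 'e \<Rightarrow> 'm" where "psi k \<equiv> inv_into (chart_dom M k) (chart_map M k)"

lemma atlas: "smooth_atlas M" using manifold by (simp add: smooth_manifold_def)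

lemma chart_inj: "i \<in> charts M \<Longrightarrow> inj_on (chart_map M i) (chart_dom M i)"
  and open_chart_image: "i \<in> charts M \<Longrightarrow> open (chart_image M i)"
  and open_overlap: "i \<in> charts M \<Longrightarrow> j \<in> charts M \<Longrightarrow> open (overlap M i j)"
  and transition_smooth: "i \<in> charts M \<Longrightarrow> j \<in> charts M \<Longrightarrow> smooth_on (transition M i j) (overlap M i j)"
  using atlas by (auto simp: smooth_atlas_def)

lemma psi_in: "x \<in> chart_image M i \<Longrightarrow> psi i x \<in> chart_dom M i"
  and chart_psi: "x \<in> chart_image M i \<Longrightarrow> chart_map M i (psi i x) = x"
  by (auto simp: chart_image_def inv_into_into f_inv_into_f)

lemma psi_chart: "i \<in> charts M \<Longrightarrow> m \<in> chart_dom M i \<Longrightarrow> psi i (chart_map M i m) = m"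
  by (rule inv_into_f_f[OF chart_inj])

lemma overlap_iff:
  assumes "i \<in> charts M"
  shows "x \<in> overlap M i j \<longleftrightarrow> x \<in> chart_image M i \<and> psi i x \<in> chart_dom M j"
  using psi_chart[OF assms] psi_in chart_psi unfolding overlap_def chart_image_def by (auto simp: image_iff)

lemma transition_in:
  assumes "i \<in> charts M" "j \<in> charts M" "x \<in> overlap M i j"
  shows "transition M i j x \<in> overlap M j i" "psi j (transition M i j x) = psi i x"
proof -
  have "x \<in> chart_image M i" "psi i x \<in> chart_dom M j" using assms overlap_iff by auto
  then show "psi j (transition M i j x) = psi i x" "transition M i j x \<in> overlap M j i"
    using psi_chart[OF assms(2)] psi_in[of x i] by (auto simp: transition_def overlap_def)
qed

lemma transition_inverse:
  assumes "i \<in> charts M" "j \<in> charts M" "x \<in> overlap M i j"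
  shows "transition M j i (transition M i j x) = x"
  using transition_in(2)[OF assms] assms overlap_iff chart_psi by (simp add: transition_def)

lemma transition_image:
  assumes "i \<in> charts M" "j \<in> charts M" shows "transition M i j ` overlap M i j = overlap M j i"
  using transition_in(1)[OF assms] transition_in(1)[OF assms(2,1)] transition_inverse[OF assms(2,1)]
  by (auto simp: image_iff) metis

lemma transition_inj: "i \<in> charts M \<Longrightarrow> j \<in> charts M \<Longrightarrow> inj_on (transition M i j) (overlap M i j)"
  by (rule inj_on_inverseI[where g = "transition M j i"]) (rule transition_inverse)

lemma transition_has_derivative:
  "i \<in> charts M \<Longrightarrow> j \<in> charts M \<Longrightarrow> x \<in> overlap M i j \<Longrightarrow> (transition M i j has_derivative jacobian M i j x) (at x)"
  unfolding jacobian_def by (rule smooth_on_has_derivative[OF transition_smooth])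

lemma topspace_eq: "topspace (manifold_topology M) = points M"
proof -
  have "openin (manifold_topology M) (points M)"
    unfolding openin_manifold_topology[OF atlas]
  proof (intro conjI ballI)
    fix i assume i: "i \<in> charts M"
    then have "chart_map M i ` (points M \<inter> chart_dom M i) = chart_image M i"
      by (auto simp: points_def chart_image_def)
    then show "open (chart_map M i ` (points M \<inter> chart_dom M i))" using open_chart_image[OF i] by simp
  qed simp
  moreover have "topspace (manifold_topology M) \<subseteq> points M"
    using openin_topspace[of "manifold_topology M"] unfolding openin_manifold_topology[OF atlas] by blast
  ultimately show ?thesis using openin_subset by blast
qed

lemma psi_vimage:
  assumes "k \<in> charts M"
  shows "{y \<in> chart_image M k. psi k y \<in> W} = chart_map M k ` (W \<inter> chart_dom M k)"
proof (rule set_eqI, rule iffI)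
  fix y assume "y \<in> {y \<in> chart_image M k. psi k y \<in> W}"
  then show "y \<in> chart_map M k ` (W \<inter> chart_dom M k)"
    using psi_in[of y k] chart_psi[of y k] by (auto simp: image_iff intro!: bexI[of _ "psi k y"])
qed (auto simp: psi_chart[OF assms] chart_image_def)

lemma open_psi_vimage:
  "k \<in> charts M \<Longrightarrow> openin (manifold_topology M) W \<Longrightarrow> open {y \<in> chart_image M k. psi k y \<in> W}"
  unfolding psi_vimage openin_manifold_topology[OF atlas] by blast

lemma psi_continuous:
  assumes k: "k \<in> charts M"
  shows "continuous_map (top_of_set (chart_image M k)) (manifold_topology M) (psi k)"
  unfolding continuous_map_def topspace_eq
proof (intro conjI allI impI)
  show "psi k \<in> topspace (top_of_set (chart_image M k)) \<rightarrow> points M"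
    using psi_in[of _ k] k by (auto simp: points_def)
  fix W assume "openin (manifold_topology M) W"
  then show "openin (top_of_set (chart_image M k)) {x \<in> topspace (top_of_set (chart_image M k)). psi k x \<in> W}"
    using open_psi_vimage[OF k, of W] open_chart_image[OF k] by (auto simp: openin_open_eq)
qed

text \<open>This is the use of the Hausdorff property: the support of a bump is closed in the whole
  manifold, so extension by zero is regular in the other charts too.\<close>

lemma closedin_psi_image:
  assumes k: "k \<in> charts M" and K: "compact K" "K \<subseteq> chart_image M k"
  shows "closedin (manifold_topology M) (psi k ` K)"
proof (rule compactin_imp_closedin)
  show "Hausdorff_space (manifold_topology M)" using manifold by (simp add: smooth_manifold_def)
  show "compactin (manifold_topology M) (psi k ` K)"
    by (rule image_compactin[OF _ psi_continuous[OF k]]) (use K in \<open>simp add: compactin_subtopology\<close>)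
qed

definition mbump :: "'i \<times> 'e \<times> real \<Rightarrow> 'm \<Rightarrow> real" where
  "mbump p m = (case p of (j, c, r) \<Rightarrow> if m \<in> chart_dom M j then bump c r (chart_map M j m) else 0)"

definition supp :: "'i \<times> 'e \<times> real \<Rightarrow> 'm set" where
  "supp p = (case p of (j, c, r) \<Rightarrow> psi j ` cball c r)"

definition good :: "'i \<times> 'e \<times> real \<Rightarrow> bool" where
  "good p \<longleftrightarrow> (case p of (j, c, r) \<Rightarrow> j \<in> charts M \<and> r > 0 \<and> cball c r \<subseteq> chart_image M j)"

lemma mbump_nonneg: "0 \<le> mbump p m"
  by (simp add: mbump_def bump_nonneg split: prod.split)

lemma mbump_zero:
  assumes "good p" "m \<notin> supp p" shows "mbump p m = 0"
proof -
  obtain j c r where p: "p = (j, c, r)" by (cases p)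
  have g: "j \<in> charts M" "r > 0" using assms(1) by (auto simp: good_def p)
  show ?thesis
  proof (cases "m \<in> chart_dom M j")
    case True
    then have "chart_map M j m \<notin> cball c r"
      using assms(2) psi_chart[OF g(1) True] imageI[of "chart_map M j m" "cball c r" "psi j"]
      unfolding supp_def p by auto
    then have "\<not> 0 < bump c r (chart_map M j m)" using bump_pos_iff[OF g(2), of c "chart_map M j m"] by auto
    then show ?thesis using bump_nonneg[of c r "chart_map M j m"] by (simp add: mbump_def p)
  qed (simp add: mbump_def p)
qed

lemma open_compl_supp:
  assumes "good p" "k \<in> charts M"
  shows "open {y \<in> chart_image M k. psi k y \<notin> supp p}"
proof -
  obtain j c r where p: "p = (j, c, r)" by (cases p)
  have "closedin (manifold_topology M) (supp p)"
    using assms closedin_psi_image[of j "cball c r"] by (auto simp: good_def supp_def p)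
  then have "openin (manifold_topology M) (points M - supp p)" by (simp add: closedin_def topspace_eq)
  then have "open {y \<in> chart_image M k. psi k y \<in> points M - supp p}" by (rule open_psi_vimage[OF assms(2)])
  moreover have "{y \<in> chart_image M k. psi k y \<in> points M - supp p} = {y \<in> chart_image M k. psi k y \<notin> supp p}"
    using psi_in[of _ k] assms(2) by (auto simp: points_def)
  ultimately show ?thesis by simp
qed

text \<open>The chart is covered by two open sets, the overlap with the chart of the bump, where a
  transition map is composed with \<open>bump\<close>, and the complement of the support, where the
  function is zero.\<close>

lemma mbump_C1:
  assumes "good p" "k \<in> charts M"
  shows "Ck_on (Suc 0) (\<lambda>y. mbump p (psi k y)) (chart_image M k)"
proof -
  obtain j c r where p: "p = (j, c, r)" by (cases p)
  have g: "j \<in> charts M" "cball c r \<subseteq> chart_image M j" using assms(1) by (auto simp: good_def p)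
  let ?V = "{y \<in> chart_image M k. psi k y \<notin> supp p}"
  have "Ck_on (Suc 0) (\<lambda>y. bump c r (transition M k j y)) (overlap M k j)"
    by (rule C1_compose[OF open_overlap[OF assms(2) g(1)] _ bump_C1])
      (use transition_smooth[OF assms(2) g(1)] in \<open>auto simp: smooth_on_def simp del: Ck_on.simps\<close>)
  then have "Ck_on (Suc 0) (\<lambda>y. mbump p (psi k y)) (overlap M k j)"
    by (rule Ck_on_cong[OF open_overlap[OF assms(2) g(1)], rotated])
      (use overlap_iff[OF assms(2)] in \<open>auto simp: mbump_def p transition_def\<close>)
  moreover have "Ck_on (Suc 0) (\<lambda>y. mbump p (psi k y)) ?V"
    by (rule Ck_on_cong[OF open_compl_supp[OF assms], of "\<lambda>y. 0"]) (use mbump_zero[OF assms(1)] in auto)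
  ultimately have "Ck_on (Suc 0) (\<lambda>y. mbump p (psi k y)) (overlap M k j \<union> ?V)"
    by (rule Ck_on_Un[OF open_overlap[OF assms(2) g(1)] open_compl_supp[OF assms]])
  moreover have "chart_image M k \<subseteq> overlap M k j \<union> ?V"
    using overlap_iff[OF assms(2)] psi_in[of _ j] g(2) by (auto simp: supp_def p)
  ultimately show ?thesis by (rule Ck_on_subset)
qed

definition cut :: "'i \<Rightarrow> ('e \<Rightarrow> real) \<Rightarrow> 'e \<Rightarrow> real" where
  "cut k f y = (if y \<in> chart_image M k then f y else 0)"

lemma cut_Ck:
  assumes "k \<in> charts M" "compact K" "K \<subseteq> chart_image M k" "Ck_on n f (chart_image M k)"
    and "\<And>y. y \<in> chart_image M k \<Longrightarrow> y \<notin> K \<Longrightarrow> f y = 0"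
  shows "Ck_on n (cut k f) UNIV"
proof -
  have "Ck_on n (cut k f) (chart_image M k)"
    by (rule Ck_on_cong[OF open_chart_image[OF assms(1)] _ assms(4)]) (simp add: cut_def)
  moreover have "open (- K)" using compact_imp_closed[OF assms(2)] by auto
  moreover have "Ck_on n (cut k f) (- K)"
    by (rule Ck_on_cong[OF \<open>open (- K)\<close>, of "\<lambda>y. 0"]) (use assms(5) in \<open>auto simp: cut_def\<close>)
  ultimately have "Ck_on n (cut k f) (chart_image M k \<union> - K)"
    by (intro Ck_on_Un open_chart_image assms(1))
  moreover have "chart_image M k \<union> - K = UNIV" using assms(3) by auto
  ultimately show ?thesis by simp
qed

lemma cut_compactly_supported:
  assumes "k \<in> charts M" "compact K" "K \<subseteq> chart_image M k" "continuous_on (chart_image M k) f"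
    and "\<And>y. y \<in> chart_image M k \<Longrightarrow> y \<notin> K \<Longrightarrow> f y = 0"
  shows "compactly_supported (cut k f)"
proof -
  have "continuous_on UNIV (cut k f)" using cut_Ck[OF assms(1-3), of 0 f] assms(4,5) by simp
  moreover have "{y. cut k f y \<noteq> 0} \<subseteq> K" using assms(5) by (auto simp: cut_def split: if_splits)
  ultimately show ?thesis
    using bounded_subset[OF compact_imp_bounded[OF assms(2)]] by (auto simp: compactly_supported_def)
qed

end

section \<open>Divergences of constant sign vanish on a compact manifold\<close>

locale divergence_setting = smooth_manifold_charts M
  for M :: "('i, 'm, 'e::euclidean_space) manifold" +
  fixes mu :: "'i \<Rightarrow> 'e \<Rightarrow> real" and X :: "'i \<Rightarrow> 'e \<Rightarrow> 'e" and d :: "'i \<Rightarrow> 'e \<Rightarrow> real"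
  assumes mu_pos: "i \<in> charts M \<Longrightarrow> x \<in> chart_image M i \<Longrightarrow> 0 < mu i x"
    and mu_smooth: "i \<in> charts M \<Longrightarrow> smooth_on (mu i) (chart_image M i)"
    and mu_trans: "i \<in> charts M \<Longrightarrow> j \<in> charts M \<Longrightarrow> x \<in> overlap M i j \<Longrightarrow>
      mu i x = \<bar>det (endo_matrix (jacobian M i j x))\<bar> * mu j (transition M i j x)"
    and X_smooth: "i \<in> charts M \<Longrightarrow> smooth_on (X i) (chart_image M i)"
    and X_trans: "i \<in> charts M \<Longrightarrow> j \<in> charts M \<Longrightarrow> x \<in> overlap M i j \<Longrightarrow>
      X j (transition M i j x) = jacobian M i j x (X i x)"
    and divergence: "i \<in> charts M \<Longrightarrow> x \<in> chart_image M i \<Longrightarrow>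
      pd (mu i) x (X i x) + mu i x * tr (pd (X i) x) = mu i x * d i x"
    and d_nonneg: "i \<in> charts M \<Longrightarrow> x \<in> chart_image M i \<Longrightarrow> 0 \<le> d i x"
begin

text \<open>Nothing is assumed about the regularity of \<open>d\<close>; the identity
  \<open>divergence\<close> makes its product with the density smooth.\<close>

lemma mu_d_continuous: "i \<in> charts M \<Longrightarrow> continuous_on (chart_image M i) (\<lambda>x. mu i x * d i x)"
proof -
  assume i: "i \<in> charts M"
  note o = open_chart_image[OF i] and m = mu_smooth[OF i] and s = X_smooth[OF i]
  have "smooth_on (\<lambda>x. pd (mu i) x (X i x)) (chart_image M i)"
    by (rule smooth_on_field[OF o smooth_on_linear_pd[OF m] smooth_on_pd[OF m] s])
  moreover have "smooth_on (\<lambda>x. mu i x * tr (pd (X i) x)) (chart_image M i)"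
    by (intro smooth_on_mult o m smooth_on_tr smooth_on_pd s)
  ultimately have "smooth_on (\<lambda>x. pd (mu i) x (X i x) + mu i x * tr (pd (X i) x)) (chart_image M i)"
    by (rule smooth_on_add[OF o])
  then have "smooth_on (\<lambda>x. mu i x * d i x) (chart_image M i)"
    by (rule smooth_on_cong[OF o, rotated]) (rule divergence[OF i])
  then show ?thesis using Ck_on.simps(1) unfolding smooth_on_def by blast
qed

context
  fixes P :: "('i \<times> 'e \<times> real) set"
  assumes P: "finite P" "\<And>p. p \<in> P \<Longrightarrow> good p" and cover: "\<And>m. m \<in> points M \<Longrightarrow> \<exists>p\<in>P. 0 < mbump p m"
begin

text \<open>The partition of unity obtained by normalising the bumps, read in chart
  \<open>k\<close>.\<close>

definition R :: "'i \<times> 'e \<times> real \<Rightarrow> 'i \<Rightarrow> 'e \<Rightarrow> real" where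
  "R p k y = mbump p (psi k y) / (\<Sum>q\<in>P. mbump q (psi k y))"

lemma psi_points: "k \<in> charts M \<Longrightarrow> y \<in> chart_image M k \<Longrightarrow> psi k y \<in> points M"
  using psi_in[of y k] by (auto simp: points_def)

lemma total_pos:
  assumes "k \<in> charts M" "y \<in> chart_image M k" shows "0 < (\<Sum>q\<in>P. mbump q (psi k y))"
proof -
  obtain p where "p \<in> P" "0 < mbump p (psi k y)" using cover[OF psi_points[OF assms]] by blast
  then show ?thesis by (rule sum_pos2[OF P(1)]) (rule mbump_nonneg)
qed

lemma R_nonneg: "0 \<le> R p k y"
  unfolding R_def by (intro divide_nonneg_nonneg sum_nonneg mbump_nonneg)

lemma sum_R: "k \<in> charts M \<Longrightarrow> y \<in> chart_image M k \<Longrightarrow> (\<Sum>p\<in>P. R p k y) = 1"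
  using total_pos[of k y] by (simp add: R_def sum_divide_distrib[symmetric])

lemma R_C1: "p \<in> P \<Longrightarrow> k \<in> charts M \<Longrightarrow> Ck_on (Suc 0) (R p k) (chart_image M k)"
  unfolding R_def[abs_def] using total_pos[of k] P(2)
  by (intro C1_divide open_chart_image mbump_C1 Ck_on_sum) fastforce+

lemma R_trans:
  assumes "k \<in> charts M" "l \<in> charts M" "y \<in> overlap M k l"
  shows "R p l (transition M k l y) = R p k y"
  by (simp add: R_def transition_in(2)[OF assms])

lemma R_zero: "p \<in> P \<Longrightarrow> psi k y \<notin> supp p \<Longrightarrow> R p k y = 0"
  using mbump_zero[OF P(2)] by (simp add: R_def)

lemma pd_R_zero:
  assumes "p \<in> P" "k \<in> charts M" "y \<in> chart_image M k" "psi k y \<notin> supp p"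
  shows "pd (R p k) y v = 0"
proof -
  have "pd (R p k) y = pd (\<lambda>y. 0) y"
    by (rule pd_cong_open[OF open_compl_supp[OF P(2)[OF assms(1)] assms(2)]]) (use assms R_zero in auto)
  then show ?thesis by simp
qed

lemma good_chart:
  assumes "p \<in> P"
  obtains c r where "p = (fst p, c, r)" "fst p \<in> charts M" "0 < r" "cball c r \<subseteq> chart_image M (fst p)"
    "\<And>y. y \<in> chart_image M (fst p) \<Longrightarrow> y \<notin> cball c r \<Longrightarrow> psi (fst p) y \<notin> supp p"
proof -
  obtain j c r where p: "p = (j, c, r)" by (cases p)
  have g: "j \<in> charts M" "0 < r" "cball c r \<subseteq> chart_image M j" using P(2)[OF assms] by (auto simp: good_def p)
  have "psi j y \<notin> supp p" if "y \<in> chart_image M j" "y \<notin> cball c r" for y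
  proof
    assume "psi j y \<in> supp p"
    then obtain z where "z \<in> cball c r" "psi j y = psi j z" by (auto simp: supp_def p)
    then show False using chart_psi[of y j] chart_psi[of z j] that g(3) by (metis subsetD)
  qed
  then show thesis using that[of c r] g by (simp add: p)
qed

text \<open>The density of the derivative of a weight along \<open>X\<close>, the error term in the
  product rule for the weighted field.\<close>

definition dX :: "'i \<times> 'e \<times> real \<Rightarrow> 'i \<Rightarrow> 'e \<Rightarrow> real" where
  "dX p k y = mu k y * pd (R p k) y (X k y)"

lemma mu_continuous: "k \<in> charts M \<Longrightarrow> continuous_on (chart_image M k) (mu k)"
  using mu_smooth Ck_on.simps(1) unfolding smooth_on_def by blast

lemma R_continuous: "p \<in> P \<Longrightarrow> k \<in> charts M \<Longrightarrow> continuous_on (chart_image M k) (R p k)"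
  using R_C1 Ck_on_continuous by blast

lemma dX_continuous:
  assumes "p \<in> P" "k \<in> charts M" shows "continuous_on (chart_image M k) (dX p k)"
proof -
  have "Ck_on 0 (\<lambda>y. pd (R p k) y (X k y)) (chart_image M k)"
    by (rule Ck_on_field[OF open_chart_image[OF assms(2)]])
      (use R_C1[OF assms] X_smooth[OF assms(2)] in \<open>auto simp: smooth_on_def simp del: Ck_on.simps(1)
        intro: linear_frechet_derivative\<close>)
  then show ?thesis unfolding dX_def[abs_def] using mu_continuous[OF assms(2)] by (auto intro: continuous_on_mult)
qed

lemma cut_R_cs:
  assumes "q \<in> P" "continuous_on (chart_image M (fst q)) f"
  shows "compactly_supported (cut (fst q) (\<lambda>y. R q (fst q) y * f y))"
proof -
  obtain c r where q: "fst q \<in> charts M" "cball c r \<subseteq> chart_image M (fst q)"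
    "\<And>y. y \<in> chart_image M (fst q) \<Longrightarrow> y \<notin> cball c r \<Longrightarrow> psi (fst q) y \<notin> supp q"
    using good_chart[OF assms(1)] by metis
  show ?thesis
    by (rule cut_compactly_supported[OF q(1) compact_cball q(2)])
      (use q R_zero[OF assms(1)] R_continuous[OF assms(1) q(1)] assms(2) in \<open>auto intro: continuous_on_mult\<close>)
qed

lemma cut_dX_cs:
  assumes "p \<in> P" "continuous_on (chart_image M (fst p)) f"
  shows "compactly_supported (cut (fst p) (\<lambda>y. f y * dX p (fst p) y))"
proof -
  obtain c r where q: "fst p \<in> charts M" "cball c r \<subseteq> chart_image M (fst p)"
    "\<And>y. y \<in> chart_image M (fst p) \<Longrightarrow> y \<notin> cball c r \<Longrightarrow> psi (fst p) y \<notin> supp p"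
    using good_chart[OF assms(1)] by metis
  show ?thesis
    by (rule cut_compactly_supported[OF q(1) compact_cball q(2)])
      (use q pd_R_zero[OF assms(1)] dX_continuous[OF assms(1) q(1)] assms(2) in \<open>auto intro: continuous_on_mult simp: dX_def\<close>)
qed

text \<open>The integrand is the coordinate divergence of the weighted field
  \<open>R p * mu * X\<close>. This field has compact support in the chart, so each partial
  derivative integrates to zero.\<close>

lemma chart_divergence:
  assumes p: "p \<in> P"
  shows "eint (cut (fst p) (\<lambda>y. R p (fst p) y * (mu (fst p) y * d (fst p) y))) + eint (cut (fst p) (dX p (fst p))) = 0"
proof -
  define j where "j = fst p"
  obtain c r where q: "j \<in> charts M" "cball c r \<subseteq> chart_image M j"
    "\<And>y. y \<in> chart_image M j \<Longrightarrow> y \<notin> cball c r \<Longrightarrow> psi j y \<notin> supp p"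
    using good_chart[OF p] unfolding j_def by metis
  note o = open_chart_image[OF q(1)]
  let ?f = "\<lambda>b y. mu j y * R p j y * (X j y \<bullet> b)"
  have C1: "Ck_on (Suc 0) (?f b) (chart_image M j)" for b
    by (intro Ck_on_mult o Ck_on_inner Ck_on_const R_C1[OF p q(1)])
      (use mu_smooth[OF q(1)] X_smooth[OF q(1)] in \<open>auto simp: smooth_on_def simp del: Ck_on.simps\<close>)
  have z: "?f b y = 0" if "y \<in> chart_image M j" "y \<notin> cball c r" for b y
    using R_zero[OF p q(3)[OF that]] by simp
  have F1: "Ck_on (Suc 0) (cut j (?f b)) UNIV" for b
    by (rule cut_Ck[OF q(1) compact_cball q(2) C1 z])
  have F2: "compactly_supported (cut j (?f b))" for b
    by (rule cut_compactly_supported[OF q(1) compact_cball q(2) Ck_on_continuous[OF C1] z])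
  have pd_in: "pd (cut j (?f b)) y b = R p j y * (pd (mu j) y b * (X j y \<bullet> b))
      + mu j y * (pd (R p j) y b * (X j y \<bullet> b)) + R p j y * mu j y * (pd (X j) y b \<bullet> b)" if y: "y \<in> chart_image M j" for b y
  proof -
    have "R p j differentiable at y" using R_C1[OF p q(1)] y by simp
    then have R: "(R p j has_derivative pd (R p j) y) (at y)" by (simp add: frechet_derivative_works[symmetric])
    have "(?f b has_derivative (\<lambda>v. mu j y * R p j y * (pd (X j) y v \<bullet> b) + (mu j y * pd (R p j) y v + pd (mu j) y v * R p j y) * (X j y \<bullet> b))) (at y)"
      by (intro has_derivative_mult has_derivative_inner_left R smooth_on_has_derivative[OF mu_smooth[OF q(1)] y]
          smooth_on_has_derivative[OF X_smooth[OF q(1)] y])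
    moreover have "pd (cut j (?f b)) y = pd (?f b) y" by (rule pd_cong_open[OF o y]) (simp add: cut_def)
    ultimately show ?thesis by (simp add: pd_eqI algebra_simps)
  qed
  have pd_out: "pd (cut j (?f b)) y v = 0" if "y \<notin> cball c r" for b y v
  proof -
    have "pd (cut j (?f b)) y = pd (\<lambda>y. 0) y"
      by (rule pd_cong_open[of "- cball c r"]) (use that z in \<open>auto simp: cut_def\<close>)
    then show ?thesis by simp
  qed
  have cs: "compactly_supported (\<lambda>y. pd (cut j (?f b)) y b)" for b
  proof -
    have "{y. pd (cut j (?f b)) y b \<noteq> 0} \<subseteq> cball c r" using pd_out by blast
    then show ?thesis
      using F1[of b] bounded_subset[OF bounded_cball] by (auto simp: compactly_supported_def)
  qed
  have "0 = (\<Sum>b\<in>Basis. eint (\<lambda>y. pd (cut j (?f b)) y b))"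
    by (simp add: eint_derivative_eq_0[OF F1 F2])
  also have "\<dots> = eint (\<lambda>y. \<Sum>b\<in>Basis. pd (cut j (?f b)) y b)"
    by (rule eint_sum[symmetric]) (use cs in auto)
  also have "(\<lambda>y. \<Sum>b\<in>Basis. pd (cut j (?f b)) y b) = (\<lambda>y. cut j (\<lambda>y. R p j y * (mu j y * d j y)) y + cut j (dX p j) y)"
  proof
    fix y
    show "(\<Sum>b\<in>Basis. pd (cut j (?f b)) y b) = cut j (\<lambda>y. R p j y * (mu j y * d j y)) y + cut j (dX p j) y"
    proof (cases "y \<in> chart_image M j")
      case True
      have lm: "linear (pd (mu j) y)" by (rule smooth_on_linear_pd[OF mu_smooth[OF q(1)] True])
      have lR: "linear (pd (R p j) y)" using R_C1[OF p q(1)] True by (auto intro: linear_frechet_derivative)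
      have "(\<Sum>b\<in>Basis. pd (mu j) y b * (X j y \<bullet> b)) = pd (mu j) y (X j y)"
        using linear_Basis_expand[OF lm, of "X j y"] by (simp add: mult.commute)
      moreover have "(\<Sum>b\<in>Basis. pd (R p j) y b * (X j y \<bullet> b)) = pd (R p j) y (X j y)"
        using linear_Basis_expand[OF lR, of "X j y"] by (simp add: mult.commute)
      ultimately have "(\<Sum>b\<in>Basis. pd (cut j (?f b)) y b) = R p j y * pd (mu j) y (X j y)
          + mu j y * pd (R p j) y (X j y) + R p j y * mu j y * tr (pd (X j) y)"
        by (simp add: pd_in[OF True] sum.distrib sum_distrib_left[symmetric] tr_def)
      also have "\<dots> = R p j y * (mu j y * d j y) + dX p j y"
        unfolding divergence[OF q(1) True, symmetric] dX_def by (simp add: algebra_simps)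
      finally show ?thesis using True by (simp add: cut_def)
    next
      case False
      then have "y \<notin> cball c r" using q(2) by auto
      then show ?thesis using False pd_out by (simp add: cut_def)
    qed
  qed
  also have "eint \<dots> = eint (cut j (\<lambda>y. R p j y * (mu j y * d j y))) + eint (cut j (dX p j))"
    using cut_R_cs[OF p, of "\<lambda>y. mu j y * d j y"] mu_d_continuous[OF q(1)] cut_dX_cs[OF p, of "\<lambda>y. 1"]
    by (intro eint_add) (auto simp: j_def)
  finally show ?thesis by (simp add: j_def)
qed

text \<open>The integrand is supported where both supports meet, hence in the overlap, and it
  transforms as a density. Its integral can therefore be computed in either chart.\<close>

lemma chart_swap:
  assumes p: "p \<in> P" and q: "q \<in> P"
  shows "eint (cut (fst p) (\<lambda>y. R q (fst p) y * dX p (fst p) y)) = eint (cut (fst q) (\<lambda>y. R q (fst q) y * dX p (fst q) y))"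
proof -
  define j l where "j = fst p" and "l = fst q"
  have j: "j \<in> charts M" and l: "l \<in> charts M" using good_chart[OF p] good_chart[OF q] unfolding j_def l_def by metis+
  have sp: "supp s \<subseteq> chart_dom M (fst s)" if "s \<in> P" for s
    using P(2)[OF that] psi_in by (cases s) (fastforce simp: supp_def good_def)
  show ?thesis
    unfolding j_def[symmetric] l_def[symmetric]
  proof (rule eint_change_of_variables[OF open_overlap[OF j l] transition_inj[OF j l] transition_has_derivative[OF j l]])
    show "compactly_supported (cut l (\<lambda>y. R q l y * dX p l y))"
      using cut_R_cs[OF q] dX_continuous[OF p l] unfolding l_def by blast
    show "cut l (\<lambda>y. R q l y * dX p l y) y = 0" if "y \<notin> transition M j l ` overlap M j l" for y
    proof (cases "y \<in> chart_image M l")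
      case True
      then have "psi l y \<notin> supp p"
        using that sp[OF p] overlap_iff[OF l, of y j] unfolding transition_image[OF j l] unfolding j_def by auto
      then show ?thesis using pd_R_zero[OF p l True] by (simp add: cut_def dX_def)
    qed (simp add: cut_def)
    show "cut j (\<lambda>y. R q j y * dX p j y) y = 0" if "y \<notin> overlap M j l" for y
    proof (cases "y \<in> chart_image M j")
      case True
      then have "psi j y \<notin> supp q" using that sp[OF q] overlap_iff[OF j, of y l] unfolding l_def by auto
      then show ?thesis using R_zero[OF q] by (simp add: cut_def)
    qed (simp add: cut_def)
    fix y assume y: "y \<in> overlap M j l"
    let ?t = "transition M j l"
    have im: "y \<in> chart_image M j" "?t y \<in> chart_image M l"
      using y overlap_iff[OF j] transition_in(1)[OF j l y] overlap_iff[OF l] by auto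
    have "R p l differentiable at (?t y)" using R_C1[OF p l] im(2) by simp
    then have "(R p l has_derivative pd (R p l) (?t y)) (at (?t y))" by (simp add: frechet_derivative_works[symmetric])
    from has_derivative_compose[OF transition_has_derivative[OF j l y] this]
    have "pd (\<lambda>y. R p l (?t y)) y = (\<lambda>v. pd (R p l) (?t y) (jacobian M j l y v))" by (rule pd_eqI)
    moreover have "pd (R p j) y = pd (\<lambda>y. R p l (?t y)) y"
      by (rule pd_cong_open[OF open_overlap[OF j l] y]) (simp add: R_trans[OF j l])
    ultimately have "pd (R p j) y (X j y) = pd (R p l) (?t y) (X l (?t y))" using X_trans[OF j l y] by simp
    then show "cut j (\<lambda>y. R q j y * dX p j y) y =
      \<bar>det (endo_matrix (jacobian M j l y))\<bar> * cut l (\<lambda>y. R q l y * dX p l y) (?t y)"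
      using im mu_trans[OF j l y] R_trans[OF j l y, of q] by (simp add: cut_def dX_def)
  qed
qed

lemma sum_dX:
  assumes k: "k \<in> charts M" and y: "y \<in> chart_image M k" shows "(\<Sum>p\<in>P. dX p k y) = 0"
proof -
  have "pd (\<lambda>y. \<Sum>p\<in>P. R p k y) y = pd (\<lambda>y. 1) y"
    by (rule pd_cong_open[OF open_chart_image[OF k] y]) (rule sum_R[OF k])
  moreover have "pd (\<lambda>y. \<Sum>p\<in>P. R p k y) y v = (\<Sum>p\<in>P. pd (R p k) y v)" for v
    using R_C1[OF _ k] y by (intro pd_sum) simp
  ultimately have "(\<Sum>p\<in>P. pd (R p k) y v) = 0" for v by simp
  then show ?thesis by (simp add: dX_def sum_distrib_left[symmetric])
qed

text \<open>After summation over all weights the error terms cancel, so integrals of nonnegative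
  functions add up to zero. Each integrand then vanishes, and at \<open>y\<close> both the weight
  and the density are positive.\<close>

lemma divergence_zero_bump:
  assumes p: "p \<in> P" and y: "y \<in> chart_image M (fst p)" and pos: "0 < mbump p (psi (fst p) y)"
  shows "d (fst p) y = 0"
proof -
  let ?A = "\<lambda>p. eint (cut (fst p) (\<lambda>y. R p (fst p) y * (mu (fst p) y * d (fst p) y)))"
  have ch: "fst q \<in> charts M" if "q \<in> P" for q using good_chart[OF that] by metis
  have cs: "compactly_supported (cut (fst q) (\<lambda>y. R q (fst q) y * (mu (fst q) y * d (fst q) y)))" if "q \<in> P" for q
    by (intro cut_R_cs mu_d_continuous ch that)
  have nn: "0 \<le> cut (fst q) (\<lambda>y. R q (fst q) y * (mu (fst q) y * d (fst q) y)) y" if "q \<in> P" for q y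
    using R_nonneg mu_pos[OF ch[OF that]] d_nonneg[OF ch[OF that]] by (simp add: cut_def less_imp_le)
  \<comment> \<open>Each error term is split by the whole partition of unity so that its pieces can
    be moved to the charts of the other weights.\<close>
  have "(\<Sum>p\<in>P. eint (cut (fst p) (dX p (fst p)))) = (\<Sum>p\<in>P. \<Sum>q\<in>P. eint (cut (fst p) (\<lambda>y. R q (fst p) y * dX p (fst p) y)))"
  proof (rule sum.cong[OF refl])
    fix p assume p: "p \<in> P"
    have "cut (fst p) (dX p (fst p)) = (\<lambda>y. \<Sum>q\<in>P. cut (fst p) (\<lambda>y. R q (fst p) y * dX p (fst p) y) y)"
      using sum_R[OF ch[OF p]] by (auto simp: cut_def fun_eq_iff sum_distrib_right[symmetric])
    then show "eint (cut (fst p) (dX p (fst p))) = (\<Sum>q\<in>P. eint (cut (fst p) (\<lambda>y. R q (fst p) y * dX p (fst p) y)))"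
      using eint_sum[OF P(1), of "\<lambda>q. cut (fst p) (\<lambda>y. R q (fst p) y * dX p (fst p) y)"]
        cut_dX_cs[OF p R_continuous[OF _ ch[OF p]]] by simp
  qed
  \<comment> \<open>All pieces weighted by \<open>q\<close> are now in the chart of
    \<open>q\<close>, where the derivatives of the weights sum to the derivative of 1.\<close>
  also have "\<dots> = (\<Sum>q\<in>P. \<Sum>p\<in>P. eint (cut (fst q) (\<lambda>y. R q (fst q) y * dX p (fst q) y)))"
    by (subst sum.swap) (simp add: chart_swap)
  also have "\<dots> = 0"
  proof (rule sum.neutral, rule ballI)
    fix q assume q: "q \<in> P"
    have "(\<Sum>p\<in>P. eint (cut (fst q) (\<lambda>y. R q (fst q) y * dX p (fst q) y))) =
        eint (\<lambda>y. \<Sum>p\<in>P. cut (fst q) (\<lambda>y. R q (fst q) y * dX p (fst q) y) y)"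
      by (rule eint_sum[symmetric, OF P(1)]) (intro cut_R_cs q dX_continuous ch)
    also have "(\<lambda>y. \<Sum>p\<in>P. cut (fst q) (\<lambda>y. R q (fst q) y * dX p (fst q) y) y) = (\<lambda>y. 0)"
    proof
      fix y
      show "(\<Sum>p\<in>P. cut (fst q) (\<lambda>y. R q (fst q) y * dX p (fst q) y) y) = 0"
        using sum_dX[OF ch[OF q], of y]
        by (cases "y \<in> chart_image M (fst q)") (simp_all add: cut_def sum_distrib_left[symmetric])
    qed
    finally show "(\<Sum>p\<in>P. eint (cut (fst q) (\<lambda>y. R q (fst q) y * dX p (fst q) y))) = 0"
      by (simp add: eint_def)
  qed
  finally have "(\<Sum>p\<in>P. eint (cut (fst p) (dX p (fst p)))) = 0" .
  moreover have "(\<Sum>p\<in>P. ?A p + eint (cut (fst p) (dX p (fst p)))) = 0"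
    by (rule sum.neutral) (use chart_divergence in blast)
  ultimately have "(\<Sum>p\<in>P. ?A p) = 0" by (simp add: sum.distrib)
  then have "?A p = 0"
    using sum_nonneg_eq_0_iff[OF P(1), of ?A] eint_nonneg[OF cs nn] p by auto
  then have "cut (fst p) (\<lambda>y. R p (fst p) y * (mu (fst p) y * d (fst p) y)) y = 0"
    by (rule eint_eq_0_imp[OF cs[OF p] nn[OF p]])
  moreover have "R p (fst p) y > 0" using pos total_pos[OF ch[OF p] y] by (simp add: R_def)
  ultimately show ?thesis using y mu_pos[OF ch[OF p] y] by (simp add: cut_def)
qed

end

theorem divergence_eq_0:
  assumes compact: "compact_space (manifold_topology M)" and i: "i \<in> charts M" and x: "x \<in> chart_image M i"
  shows "d i x = 0"
proof -
  define W where "W p = {m \<in> points M. 0 < mbump p m}" for p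
  have W: "W (j, c, r) = {m \<in> chart_dom M j. chart_map M j m \<in> ball c r}" if "good (j, c, r)" for j c r
    using that bump_pos_iff[of r c] by (auto simp: W_def mbump_def good_def points_def)
  have oW: "openin (manifold_topology M) (W p)" if p: "good p" for p
    unfolding openin_manifold_topology[OF atlas]
  proof (intro conjI ballI)
    show "W p \<subseteq> points M" by (auto simp: W_def)
    fix k assume k: "k \<in> charts M"
    have "open {y \<in> chart_image M k. 0 < mbump p (psi k y)}"
      using continuous_on_open_vimage[OF open_chart_image[OF k], THEN iffD1, OF Ck_on_continuous[OF mbump_C1[OF p k]], rule_format, of "{0<..}"]
      by (simp add: vimage_def Int_def conj_commute)
    moreover have "{y \<in> chart_image M k. 0 < mbump p (psi k y)} = chart_map M k ` (W p \<inter> chart_dom M k)"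
      unfolding psi_vimage[OF k, symmetric] W_def using psi_in[of _ k] k by (auto simp: points_def)
    ultimately show "open (chart_map M k ` (W p \<inter> chart_dom M k))" by simp
  qed
  have ex: "\<exists>r. good (j, c, r)" if "j \<in> charts M" "c \<in> chart_image M j" for j c
    using open_contains_cball[of "chart_image M j"] open_chart_image[OF that(1)] that by (auto simp: good_def)
  obtain r where r: "good (i, x, r)" using ex[OF i x] by blast
  have inW: "\<exists>p. good p \<and> m \<in> W p" if m: "m \<in> points M" for m
  proof -
    obtain j where j: "j \<in> charts M" "m \<in> chart_dom M j" using m by (auto simp: points_def)
    then obtain s where s: "good (j, chart_map M j m, s)" using ex[of j "chart_map M j m"] by (auto simp: chart_image_def)
    then have "m \<in> W (j, chart_map M j m, s)" using W[OF s] j by (auto simp: good_def)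
    then show ?thesis using s by blast
  qed
  have "compactin (manifold_topology M) (points M)" using compact by (simp add: compact_space_def topspace_eq)
  moreover have "openin (manifold_topology M) V" if "V \<in> W ` {p. good p}" for V using that oW by blast
  moreover have "points M \<subseteq> \<Union> (W ` {p. good p})" using inW by blast
  ultimately obtain \<F> where F: "finite \<F>" "\<F> \<subseteq> W ` {p. good p}" "points M \<subseteq> \<Union>\<F>"
    using compactinD[of "manifold_topology M" "points M" "W ` {p. good p}"] by blast
  obtain Q where Q: "finite Q" "Q \<subseteq> {p. good p}" "\<F> = W ` Q" using finite_subset_image[OF F(1,2)] by blast
  \<comment> \<open>A bump centred at the given point is added to the finite subcover, so that the
    conclusion is available there in the chart \<open>i\<close> itself.\<close>
  let ?P = "insert (i, x, r) Q"
  have "d (fst (i, x, r)) x = 0"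
  proof (rule divergence_zero_bump[of ?P])
    show "\<exists>p\<in>?P. 0 < mbump p m" if "m \<in> points M" for m
      using that F(3) Q(3) by (auto simp: W_def)
    show "0 < mbump (i, x, r) (psi (fst (i, x, r)) x)"
      using psi_in[OF x] chart_psi[OF x] r bump_pos_iff[of r x x] by (simp add: mbump_def good_def)
  qed (use Q r x in auto)
  then show ?thesis by simp
qed

end

section \<open>The theorem\<close>

lemma curvature_eq:
  assumes "bilinear (G x)"
  shows "curvature G x u v w = pd (\<lambda>y. G y v w) x u - pd (\<lambda>y. G y u w) x v + G x u (G x v w) - G x v (G x u w)"
proof -
  have "cov_deriv G (\<lambda>_. a) (\<lambda>_. b) = (\<lambda>y. G y a b)" for a b
    by (simp add: cov_deriv_def fun_eq_iff)
  moreover have "lie_bracket (\<lambda>_. u) (\<lambda>_. v) = (\<lambda>_. 0)" by (simp add: lie_bracket_def fun_eq_iff)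
  ultimately show ?thesis
    by (simp add: curvature_def cov_deriv_def[of G _ "\<lambda>y. G y _ _"] bilinear_lzero[OF assms])
qed

lemma torsion_eq: "torsion G x u v = G x u v - G x v u"
  by (simp add: torsion_def cov_deriv_def lie_bracket_def)

lemma difference_tensor_eq: "difference_tensor D G x u v = D x u v - G x u v"
  by (simp add: difference_tensor_def cov_deriv_def)

lemma metric_connection_iff:
  "metric_connection M g G \<longleftrightarrow> (\<forall>i\<in>charts M. \<forall>x\<in>chart_image M i. \<forall>u v w.
     pd (\<lambda>y. g i y v w) x u = g i x (G i x u v) w + g i x v (G i x u w))"
  by (simp add: metric_connection_def cov_deriv_def)

lemma (in smooth_manifold_charts) jacobian_linear:
  "i \<in> charts M \<Longrightarrow> j \<in> charts M \<Longrightarrow> x \<in> overlap M i j \<Longrightarrow> linear (jacobian M i j x)"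
  using transition_has_derivative has_derivative_linear by blast

lemma (in smooth_manifold_charts) jacobian_inverse:
  assumes "i \<in> charts M" "j \<in> charts M" "x \<in> overlap M i j"
  shows "jacobian M j i (transition M i j x) (jacobian M i j x v) = v"
proof -
  have "((\<lambda>x. transition M j i (transition M i j x)) has_derivative
      (\<lambda>v. jacobian M j i (transition M i j x) (jacobian M i j x v))) (at x)"
    by (rule has_derivative_compose[OF transition_has_derivative transition_has_derivative])
      (use assms transition_in in auto)
  moreover have "((\<lambda>x. transition M j i (transition M i j x)) has_derivative (\<lambda>v. v)) (at x)"
    by (rule has_derivative_transform_within_open[OF has_derivative_ident open_overlap[OF assms(1,2)] assms(3)])
      (simp add: transition_inverse[OF assms(1,2)])
  ultimately show ?thesis using has_derivative_unique by metis
qed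

text \<open>Provides the points of the tangent bundle at which the pluriclosed condition is
  evaluated.\<close>

lemma (in smooth_manifold_charts) zero_section_in_chart:
  assumes "i \<in> charts M" "x \<in> chart_image M i"
  shows "(x, 0) \<in> chart_image (tangent_bundle M) i"
proof -
  have "jacobian M k l (chart_map M k (psi i x)) 0 = 0"
    if "k \<in> charts M" "l \<in> charts M" "psi i x \<in> chart_dom M k" "psi i x \<in> chart_dom M l" for k l
    using that by (intro linear_0 jacobian_linear) (auto simp: overlap_def)
  then have "(\<lambda>_. 0) \<in> tangent_space M (psi i x)" by (auto simp: tangent_space_def)
  then show ?thesis
    using psi_in[OF assms(2)] chart_psi[OF assms(2)]
    unfolding chart_image_def tangent_bundle_def
    by (intro image_eqI[of _ _ "(psi i x, \<lambda>_. 0)"]) auto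
qed

locale pluriclosed_affine_riemann =
  fixes M :: "('i, 'm, 'e::euclidean_space) manifold"
    and nabla D :: "('i, 'e) connection"
    and g :: "('i, 'e) metric_field"
  assumes affine: "affine_riemann M nabla g"
    and levi_civita: "levi_civita_connection M g D"
    and pluriclosed: "pluriclosed (tangent_bundle M) (J1 nabla) (g1 nabla g)"
    and koszul: "\<forall>i\<in>charts M. \<forall>x\<in>chart_image M i. \<forall>u.
           dual_koszul_form (g i) (difference_tensor (D i) (nabla i)) x u = 0"
begin

sublocale smooth_manifold_charts M
  by unfold_locales (use affine in \<open>simp add: affine_riemann_def\<close>)

lemma metric: "riemannian_metric M g" and nabla_connection: "is_connection M nabla"
  and nabla_flat: "flat M nabla" and nabla_torsion_free: "torsion_free M nabla"
  and D_connection: "is_connection M D" and D_torsion_free: "torsion_free M D"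
  and D_metric_connection: "metric_connection M g D"
  using affine levi_civita by (auto simp: affine_riemann_def levi_civita_connection_def)

lemma affine_riemann_chart:
  assumes i: "i \<in> charts M"
  shows "affine_riemann_chart (chart_image M i) (g i) (D i) (nabla i)"
proof
  show "open (chart_image M i)" by (rule open_chart_image[OF i])
  fix x :: 'e assume x: "x \<in> chart_image M i"
  show bil: "bilinear (nabla i x)" "bilinear (D i x)" "bilinear (g i x)"
    using nabla_connection D_connection metric i x by (auto simp: is_connection_def riemannian_metric_def)
  show "g i x u v = g i x v u" "u \<noteq> 0 \<Longrightarrow> 0 < g i x u u" for u v
    using metric i x by (auto simp: riemannian_metric_def)
  show "D i x u v = D i x v u" "nabla i x u v = nabla i x v u" for u v
    using D_torsion_free nabla_torsion_free i x by (auto simp: torsion_free_def torsion_eq)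
  show "pd (\<lambda>y. g i y v w) x u = g i x (D i x u v) w + g i x v (D i x u w)" for u v w
    using D_metric_connection i x by (auto simp: metric_connection_iff)
  show "pd (\<lambda>y. nabla i y v w) x u - pd (\<lambda>y. nabla i y u w) x v + nabla i x u (nabla i x v w) - nabla i x v (nabla i x u w) = 0" for u v w
    using nabla_flat i x curvature_eq[of "nabla i" x u v w, OF bil(1)] by (simp add: flat_def)
qed (use nabla_connection D_connection metric i in \<open>auto simp: is_connection_def riemannian_metric_def\<close>)

lemma trace_free_pluriclosed_chart:
  assumes i: "i \<in> charts M"
  shows "trace_free_pluriclosed_chart (chart_image M i) (g i) (D i) (nabla i)"
proof -
  interpret C: affine_riemann_chart "chart_image M i" "g i" "D i" "nabla i" by (rule affine_riemann_chart[OF i])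
  show ?thesis
  proof
    fix x u v w z assume x: "x \<in> chart_image M i"
    show "g i x (C.curv x u v w) z = g i x (C.gam x u w) (C.gam x v z) - g i x (C.gam x v w) (C.gam x u z)"
    proof (rule C.curv_eq_gam[OF x], rule C.pluriclosed_imp_tor[OF _ _ x, of nabla i g])
      have "i \<in> charts (tangent_bundle M)" using i by (simp add: tangent_bundle_def)
      then show "ext_deriv (J_form (J1 nabla i) (ext_deriv (fundamental_form (J1 nabla i) (g1 nabla g i)))) (x, 0)
          [(u, 0), (v, 0), (0, w), (0, z)] = 0"
        using pluriclosed zero_section_in_chart[OF i x] unfolding pluriclosed_def by auto
    qed auto
  next
    fix x e assume x: "x \<in> chart_image M i"
    interpret h: inner_form "g i x" by (rule C.inner_form[OF x])
    define E where "E = (SOME E. orthonormal_frame (g i x) E)"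
    have E: "orthonormal_frame (g i x) E" unfolding E_def by (rule someI_ex[OF h.ex_orthonormal_frame])
    have mt: "metric_trace (g i x) (difference_tensor (D i) (nabla i) x) = (\<Sum>b\<in>Basis. C.gam x (E b) (E b))"
      by (simp add: metric_trace_def E_def[symmetric] difference_tensor_eq C.gam_def)
    have "(\<Sum>b\<in>Basis. C.gam x (E b) (E b)) = 0"
      by (rule h.eqI) (use koszul i x in \<open>simp add: dual_koszul_form_def mt[symmetric] h.h_simps\<close>)
    then show "C.mtrace x (\<lambda>a b. C.gam x a b \<bullet> e) = 0"
      using C.mtrace_frame[OF x E bilinear_inner[OF C.gam_bil[OF x]], of e] by (simp add: inner_sum_left[symmetric])
  qed
qed

lemma ricci_nonneg:
  assumes i: "i \<in> charts M" and x: "x \<in> chart_image M i"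
  shows "0 \<le> ricci (D i) x v v"
proof -
  interpret C: trace_free_pluriclosed_chart "chart_image M i" "g i" "D i" "nabla i"
    by (rule trace_free_pluriclosed_chart[OF i])
  have "ricci (D i) x v v = tr (\<lambda>u. C.curv x u v v)"
    by (simp add: ricci_def tr_def curvature_eq[of "D i" x, OF C.D_bil[OF x]] C.curv_def)
  then show ?thesis using C.tr_curv_nonneg[OF x] by simp
qed

section \<open>Behaviour under a change of chart\<close>

abbreviation "Gam i \<equiv> affine_riemann_chart.gam (D i) (nabla i)"
abbreviation "Scal i \<equiv> affine_riemann_chart.scal (g i) (D i) (nabla i)"
abbreviation "Vol i \<equiv> affine_riemann_chart.vol (g i)"
abbreviation "Raise i \<equiv> affine_riemann_chart.raise (g i)"
abbreviation "Divg i \<equiv> affine_riemann_chart.divg (g i) (D i)"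

context
  fixes i j x assumes i: "i \<in> charts M" and j: "j \<in> charts M" and x: "x \<in> overlap M i j"
begin

abbreviation (input) "J \<equiv> jacobian M i j x"
abbreviation (input) "K \<equiv> jacobian M j i (transition M i j x)"
abbreviation (input) "x' \<equiv> transition M i j x"

interpretation C: affine_riemann_chart "chart_image M i" "g i" "D i" "nabla i" by (rule affine_riemann_chart[OF i])
interpretation C': affine_riemann_chart "chart_image M j" "g j" "D j" "nabla j" by (rule affine_riemann_chart[OF j])

lemma xi: "x \<in> chart_image M i" and xj: "x' \<in> chart_image M j" and x': "x' \<in> overlap M j i"
  using x transition_in(1)[OF i j x] overlap_iff[OF i] overlap_iff[OF j] by auto

lemma KJ: "K (J v) = v" by (rule jacobian_inverse[OF i j x])

lemma JK: "J (K v) = v"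
  using jacobian_inverse[OF j i x'] transition_inverse[OF i j x] by simp

lemma J_linear: "linear J" by (rule jacobian_linear[OF i j x])
lemma K_linear: "linear K" by (rule jacobian_linear[OF j i x'])

lemma g_trans: "g j x' (J u) (J v) = g i x u v"
  using metric i j x by (auto simp: riemannian_metric_def)

text \<open>The inhomogeneous terms in the transformation laws of the two connections agree and
  cancel in the difference.\<close>

lemma gam_trans: "J (C.gam x u v) = C'.gam x' (J u) (J v)"
proof -
  have "J (D i x u v) = pd (\<lambda>y. jacobian M i j y v) x u + D j x' (J u) (J v)"
    "J (nabla i x u v) = pd (\<lambda>y. jacobian M i j y v) x u + nabla j x' (J u) (J v)"
    using D_connection nabla_connection i j x unfolding is_connection_def by blast+
  then show ?thesis by (simp add: C.gam_def C'.gam_def linear_diff[OF J_linear])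
qed

lemma gam_trans': "C'.gam x' (J u) v = J (C.gam x u (K v))"
  by (simp add: gam_trans JK)

lemma tr_conjugate:
  assumes "linear A" shows "tr (\<lambda>v. J (A (K v))) = tr A"
proof -
  have "tr (\<lambda>v. J (A (K v))) = tr (\<lambda>v. A (K (J v)))"
    by (rule tr_comp_commute[OF J_linear]) (use linear_compose[OF K_linear assms] in \<open>simp add: o_def\<close>)
  then show ?thesis by (simp add: KJ)
qed

lemma kap_trans: "C.kap x u = C'.kap x' (J u)"
  unfolding C.kap_def C'.kap_def gam_trans'
  by (rule tr_conjugate[symmetric]) (rule bilinear_imp_linear(1)[OF C.gam_bil[OF xi]])

lemma rho_trans: "C.rho x u v = C'.rho x' (J u) (J v)"
proof -
  have "linear (\<lambda>w. C.gam x u (C.gam x v w))" by (rule linearI) (simp_all add: C.gam_simps[OF xi])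
  then show ?thesis
    unfolding C.rho_def C'.rho_def gam_trans' KJ by (rule tr_conjugate[symmetric])
qed

text \<open>The Jacobian is an isometry between the metrics of the two charts, so it carries an
  orthonormal frame to one and the traces can be compared termwise.\<close>

lemma scal_trans: "C.scal x = C'.scal x'"
proof -
  obtain E where E: "orthonormal_frame (g i x) E"
    using inner_form.ex_orthonormal_frame[OF C.inner_form[OF xi]] by blast
  then have E': "orthonormal_frame (g j x') (\<lambda>b. J (E b))"
    by (simp add: orthonormal_frame_def g_trans)
  show ?thesis
    unfolding C.scal_def C'.scal_def C.mtrace_frame[OF xi E C.rho_bil[OF xi]] C'.mtrace_frame[OF xj E' C'.rho_bil[OF xj]]
    by (simp add: rho_trans)
qed

lemma vol_trans: "C.vol x = \<bar>det (endo_matrix J)\<bar> * C'.vol x'"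
proof -
  have "gram (g i x) = gram (\<lambda>u v. g j x' (J u) (J v))" by (simp add: g_trans)
  then have "det (gram (g i x)) = (det (endo_matrix J))\<^sup>2 * det (gram (g j x'))"
    using det_gram_endo[OF C'.g_bil[OF xj] J_linear] by simp
  then show ?thesis by (simp add: C.vol_def C'.vol_def real_sqrt_mult)
qed

text \<open>Both sides represent the same covector with respect to the metric of chart
  \<open>j\<close>, which is nondegenerate.\<close>

lemma raise_trans:
  assumes "linear (\<beta> x)" "linear (\<beta>' x')" "\<And>v. \<beta> x v = \<beta>' x' (J v)"
  shows "C'.raise \<beta>' x' = J (C.raise \<beta> x)"
proof (rule inner_form.eqI[OF C'.inner_form[OF xj]])
  fix w
  have "g j x' (J (C.raise \<beta> x)) w = g i x (C.raise \<beta> x) (K w)" using g_trans[of _ "K w"] by (simp add: JK)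
  then show "g j x' (C'.raise \<beta>' x') w = g j x' (J (C.raise \<beta> x)) w"
    by (simp add: C.g_raise[of x \<beta>, OF xi assms(1)] C'.g_raise[of x' \<beta>', OF xj assms(2)] assms(3) JK)
qed

end

lemma pd_scal_trans:
  assumes i: "i \<in> charts M" and j: "j \<in> charts M" and x: "x \<in> overlap M i j"
  shows "pd (Scal i) x v =
    pd (Scal j) (transition M i j x) (jacobian M i j x v)"
proof -
  interpret C: affine_riemann_chart "chart_image M i" "g i" "D i" "nabla i" by (rule affine_riemann_chart[OF i])
  interpret C': affine_riemann_chart "chart_image M j" "g j" "D j" "nabla j" by (rule affine_riemann_chart[OF j])
  have "pd C.scal x = pd (\<lambda>y. C'.scal (transition M i j y)) x"
    by (rule pd_cong_open[OF open_overlap[OF i j] x]) (rule scal_trans[OF i j])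
  also have "\<dots> = (\<lambda>v. pd C'.scal (transition M i j x) (jacobian M i j x v))"
    by (rule pd_eqI, rule has_derivative_compose[OF transition_has_derivative[OF i j x]])
      (rule smooth_on_has_derivative[OF C'.scal_smooth xj[OF i j x]])
  finally show ?thesis by simp
qed

section \<open>The compact case\<close>

context
  assumes compact: "compact_space (manifold_topology M)"
begin

lemma divergence_eq_0:
  assumes lin: "\<And>i x. i \<in> charts M \<Longrightarrow> x \<in> chart_image M i \<Longrightarrow> linear (\<beta> i x)"
    and smooth: "\<And>i v. i \<in> charts M \<Longrightarrow> smooth_on (\<lambda>x. \<beta> i x v) (chart_image M i)"
    and trans: "\<And>i j x v. i \<in> charts M \<Longrightarrow> j \<in> charts M \<Longrightarrow> x \<in> overlap M i j \<Longrightarrow>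
      \<beta> i x v = \<beta> j (transition M i j x) (jacobian M i j x v)"
    and nonneg: "\<And>i x. i \<in> charts M \<Longrightarrow> x \<in> chart_image M i \<Longrightarrow>
      0 \<le> Divg i (\<beta> i) x"
    and i: "i \<in> charts M" and x: "x \<in> chart_image M i"
  shows "Divg i (\<beta> i) x = 0"
proof -
  interpret d: divergence_setting M "\<lambda>i. Vol i" "\<lambda>i. Raise i (\<beta> i)"
    "\<lambda>i x. Divg i (\<beta> i) x"
  proof
    fix i x assume i: "i \<in> charts M"
    interpret C: affine_riemann_chart "chart_image M i" "g i" "D i" "nabla i" by (rule affine_riemann_chart[OF i])
    show "smooth_on C.vol (chart_image M i)" by (rule C.vol_smooth)
    show "smooth_on (C.raise (\<beta> i)) (chart_image M i)" by (rule C.raise_smooth[OF smooth[OF i]])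
    assume x: "x \<in> chart_image M i"
    show "0 < C.vol x" by (rule C.vol_pos[OF x])
    show "pd C.vol x (C.raise (\<beta> i) x) + C.vol x * tr (pd (C.raise (\<beta> i)) x) =
      C.vol x * C.divg (\<beta> i) x"
      by (rule C.divergence_vol_raise[OF x lin[OF i] smooth[OF i]])
    show "0 \<le> C.divg (\<beta> i) x" by (rule nonneg[OF i x])
  next
    fix i j x assume i: "i \<in> charts M" and j: "j \<in> charts M" and x: "x \<in> overlap M i j"
    show "Vol i x = \<bar>det (endo_matrix (jacobian M i j x))\<bar> * Vol j (transition M i j x)"
      by (rule vol_trans[OF i j x])
    show "Raise j (\<beta> j) (transition M i j x) = jacobian M i j x (Raise i (\<beta> i) x)"
      by (rule raise_trans[OF i j x]) (intro lin i j xi[OF i j x] xj[OF i j x] trans x)+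
  qed
  show ?thesis by (rule d.divergence_eq_0[OF compact i x])
qed

lemma gam_self_adjoint:
  assumes i: "i \<in> charts M" and x: "x \<in> chart_image M i"
  shows "g i x (Gam i x a b) c = g i x b (Gam i x a c)"
proof -
  \<comment> \<open>The sign is reversed because the divergence of \<open>kap\<close> is minus a sum
    of squares, whereas the divergence theorem is stated for nonnegative divergences.\<close>
  let ?\<beta> = "\<lambda>i x v. - affine_riemann_chart.kap (D i) (nabla i) x v"
  have div: "Divg i (?\<beta> i) x =
     (\<Sum>a\<in>Basis. \<Sum>b\<in>Basis. \<Sum>c\<in>Basis. (g i x (Gam i x (E a) (E b)) (E c) - g i x (Gam i x (E a) (E c)) (E b))\<^sup>2) / 2"
    if i: "i \<in> charts M" and x: "x \<in> chart_image M i" and E: "orthonormal_frame (g i x) E" for i x E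
  proof -
    interpret C: trace_free_pluriclosed_chart "chart_image M i" "g i" "D i" "nabla i"
      by (rule trace_free_pluriclosed_chart[OF i])
    have "pd (\<lambda>y. - C.kap y v) x u = - pd (\<lambda>y. C.kap y v) x u" for u v
      using pd_scaleR[OF smooth_on_differentiable[OF C.kap_smooth x], of "-1"] by simp
    then have "C.divg (\<lambda>x v. - C.kap x v) x
       = - C.divg C.kap x"
      by (simp add: C.divg_def C.mtrace_def sum_negf[symmetric])
    then show ?thesis using C.divergence_kap[OF x E] by simp
  qed
  have ex: "\<exists>E. orthonormal_frame (g i x) E" if "i \<in> charts M" "x \<in> chart_image M i" for i x
    using inner_form.ex_orthonormal_frame[OF affine_riemann_chart.inner_form[OF affine_riemann_chart[OF that(1)] that(2)]] .
  obtain E where E: "orthonormal_frame (g i x) E" using ex[OF i x] by blast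
  have "Divg i (?\<beta> i) x = 0"
  proof (rule divergence_eq_0[OF _ _ _ _ i x])
    fix i assume i: "i \<in> charts M"
    interpret C: affine_riemann_chart "chart_image M i" "g i" "D i" "nabla i" by (rule affine_riemann_chart[OF i])
    show "linear (\<lambda>v. - C.kap x v)" if "x \<in> chart_image M i" for x
      using linear_compose_neg[OF C.kap_linear[OF that]] .
    show "smooth_on (\<lambda>x. - C.kap x v) (chart_image M i)" for v
      using smooth_on_scaleR[OF C.open_U smooth_on_const C.kap_smooth, of "-1"] by simp
    show "0 \<le> C.divg (\<lambda>x v. - C.kap x v) x" if x: "x \<in> chart_image M i" for x
    proof -
      obtain F where F: "orthonormal_frame (g i x) F" using ex[OF i x] by blast
      show ?thesis unfolding div[OF i x F] by (simp add: sum_nonneg)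
    qed
  qed (simp add: kap_trans)
  then have 0: "(\<Sum>a\<in>Basis. \<Sum>b\<in>Basis. \<Sum>c\<in>Basis. (g i x (Gam i x (E a) (E b)) (E c) - g i x (Gam i x (E a) (E c)) (E b))\<^sup>2) = 0"
    using div[OF i x E] by simp
  interpret C: affine_riemann_chart "chart_image M i" "g i" "D i" "nabla i" by (rule affine_riemann_chart[OF i])
  interpret h: inner_form "g i x" by (rule C.inner_form[OF x])
  define S where "S a b c = g i x (C.gam x a b) c - g i x b (C.gam x a c)" for a b c
  have S0: "S (E a) (E b) (E c) = 0" if "a \<in> Basis" "b \<in> Basis" "c \<in> Basis" for a b c
  proof -
    have "(\<Sum>b\<in>Basis. \<Sum>c\<in>Basis. (g i x (Gam i x (E a) (E b)) (E c) - g i x (Gam i x (E a) (E c)) (E b))\<^sup>2) = 0"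
      using 0 that(1) by (subst (asm) sum_nonneg_eq_0_iff) (auto intro!: sum_nonneg)
    then have "(\<Sum>c\<in>Basis. (g i x (Gam i x (E a) (E b)) (E c) - g i x (Gam i x (E a) (E c)) (E b))\<^sup>2) = 0"
      using that(2) by (subst (asm) sum_nonneg_eq_0_iff) (auto intro!: sum_nonneg)
    then have "(g i x (Gam i x (E a) (E b)) (E c) - g i x (Gam i x (E a) (E c)) (E b))\<^sup>2 = 0"
      using that(3) by (subst (asm) sum_nonneg_eq_0_iff) auto
    then show ?thesis using h.sym[of "E b"] by (simp add: S_def)
  qed
  have lin: "linear (\<lambda>a. S a b c)" "linear (\<lambda>b. S a b c)" "linear (\<lambda>c. S a b c)" for a b c
    unfolding S_def by (rule linearI; simp add: C.gam_simps[OF x] h.h_simps algebra_simps)+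
  have vanish: "L v = 0" if "linear L" "\<And>b. b \<in> Basis \<Longrightarrow> L (E b) = 0" for L :: "'e \<Rightarrow> real" and v
  proof -
    have "L v = L (\<Sum>b\<in>Basis. g i x v (E b) *\<^sub>R E b)" using h.frame_expand[OF E, of v] by simp
    then show ?thesis using that by (simp add: linear_sum linear_cmul)
  qed
  have S1: "S (E a) (E b) c = 0" if "a \<in> Basis" "b \<in> Basis" for a b c
    by (rule vanish[OF lin(3)]) (rule S0[OF that])
  have S2: "S (E a) b c = 0" if "a \<in> Basis" for a b c
    by (rule vanish[where L = "\<lambda>b. S (E a) b c", OF lin(2)]) (rule S1[OF that])
  have "S a b c = 0"
    by (rule vanish[where L = "\<lambda>a. S a b c", OF lin(1)]) (rule S2)
  then show ?thesis by (simp add: S_def)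
qed

text \<open>The 1-form is now the differential of \<open>scal\<close>, so its divergence is the
  Laplacian. It dominates twice the squared norm of \<open>rho\<close>, and since it is zero
  \<open>rho\<close> vanishes, whose diagonal entries are sums of squares of
  \<open>gam\<close>.\<close>

lemma Gam_eq_0:
  assumes i: "i \<in> charts M" and x: "x \<in> chart_image M i"
  shows "Gam i x u v = 0"
proof -
  let ?\<beta> = "\<lambda>i. pd (Scal i)"
  have hess: "hessian_chart (chart_image M i) (g i) (D i) (nabla i)" if i: "i \<in> charts M" for i
  proof -
    interpret C: trace_free_pluriclosed_chart "chart_image M i" "g i" "D i" "nabla i"
      by (rule trace_free_pluriclosed_chart[OF i])
    show ?thesis by unfold_locales (rule gam_self_adjoint[OF i])
  qed
  interpret C: hessian_chart "chart_image M i" "g i" "D i" "nabla i" by (rule hess[OF i])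
  obtain E where E: "orthonormal_frame (g i x) E"
    using inner_form.ex_orthonormal_frame[OF C.inner_form[OF x]] by blast
  have "C.divg (?\<beta> i) x = 0"
  proof (rule divergence_eq_0[OF _ _ _ _ i x, where \<beta> = ?\<beta>])
    fix i assume i: "i \<in> charts M"
    interpret H: hessian_chart "chart_image M i" "g i" "D i" "nabla i" by (rule hess[OF i])
    show "linear (pd H.scal x)" if "x \<in> chart_image M i" for x
      by (rule smooth_on_linear_pd[OF H.scal_smooth that])
    show "smooth_on (\<lambda>x. pd H.scal x v) (chart_image M i)" for v
      by (rule smooth_on_pd[OF H.scal_smooth])
    show "0 \<le> H.divg (pd H.scal) x" if x: "x \<in> chart_image M i" for x
    proof -
      obtain E where E: "orthonormal_frame (g i x) E"
        using inner_form.ex_orthonormal_frame[OF H.inner_form[OF x]] by blast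
      have "0 \<le> 2 * (\<Sum>a\<in>Basis. \<Sum>b\<in>Basis. (H.rho x (E a) (E b))\<^sup>2)" by (simp add: sum_nonneg)
      then show ?thesis using H.laplacian_scal[OF x E] by linarith
    qed
  qed (rule pd_scal_trans)
  then have "2 * (\<Sum>a\<in>Basis. \<Sum>b\<in>Basis. (C.rho x (E a) (E b))\<^sup>2) \<le> 0" using C.laplacian_scal[OF x E] by simp
  moreover have "0 \<le> (\<Sum>a\<in>Basis. \<Sum>b\<in>Basis. (C.rho x (E a) (E b))\<^sup>2)" by (simp add: sum_nonneg)
  ultimately have "(\<Sum>a\<in>Basis. \<Sum>b\<in>Basis. (C.rho x (E a) (E b))\<^sup>2) = 0" by linarith
  then show ?thesis by (rule C.gam_eq_0[OF x E])
qed

lemma difference_tensor_eq_0: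
  assumes "i \<in> charts M" "x \<in> chart_image M i"
  shows "difference_tensor (D i) (nabla i) x u v = 0"
  using Gam_eq_0[OF assms] affine_riemann_chart.gam_def[OF affine_riemann_chart[OF assms(1)]]
  by (simp add: difference_tensor_eq)

lemma nabla_levi_civita: "levi_civita_connection M g nabla"
proof -
  have "D i x u v = nabla i x u v" if "i \<in> charts M" "x \<in> chart_image M i" for i x u v
    using difference_tensor_eq_0[OF that, of u v] by (simp add: difference_tensor_eq)
  then have "metric_connection M g nabla"
    using D_metric_connection by (simp add: metric_connection_iff)
  then show ?thesis
    using nabla_connection nabla_torsion_free by (simp add: levi_civita_connection_def)
qed

end
end

theorem theorem4p1:
  fixes M :: "('i, 'm, 'e::euclidean_space) manifold"
    and nabla D :: "('i, 'e) connection"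
    and g :: "('i, 'e) metric_field"
  assumes "affine_riemann M nabla g"
    and "levi_civita_connection M g D"
    and "pluriclosed (tangent_bundle M) (J1 nabla) (g1 nabla g)"
    and "\<forall>i\<in>charts M. \<forall>x\<in>chart_image M i. \<forall>u.
           dual_koszul_form (g i) (difference_tensor (D i) (nabla i)) x u = 0"
  shows "(\<forall>i\<in>charts M. \<forall>x\<in>chart_image M i. \<forall>v. ricci (D i) x v v \<ge> 0) \<and>
    (compact_space (manifold_topology M) \<and> geodesically_complete M nabla \<longrightarrow>
      (\<forall>i\<in>charts M. \<forall>x\<in>chart_image M i. \<forall>u v.
         difference_tensor (D i) (nabla i) x u v = 0) \<and>
      levi_civita_connection M g nabla)"
proof -
  interpret pluriclosed_affine_riemann M nabla D g by unfold_locales (fact assms)+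
  show ?thesis using ricci_nonneg difference_tensor_eq_0 nabla_levi_civita by blast
qed

end
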